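(* Let $(A,\mathfrak m)$ be a one-dimensional Cohen-Macaulay local ring with infinite residue field and reduction number $r$, and let $xA$ be a minimal reduction of $\mathfrak m$. Let $\alpha_i$, $\beta_i$, $\gamma_i$ be the invariants of the tangent cone, the micro-invariants of $A$, and the Apery invariants of $A$ with respect to $x$, respectively. The following conditions are equivalent: (1) $G(\mathfrak m)$ is a Cohen-Macaulay ring. (2) $\alpha_i=\beta_i$ for all $i\le r$. (3) $\alpha_i=\gamma_i$ for all $i\le r$. (4) $\beta_i=\gamma_i$ for all $i\le r$.
   Context: $\lambda$ denotes length of $A$-modules and $\mathfrak m^0=A$. $K=A/\mathfrak m$. The tangent cone is $G(\mathfrak m)=\bigoplus_{n\ge 0}\mathfrak m^n/\mathfrak m^{n+1}$. An ideal $xA$ with $x\in\mathfrak m$ is a minimal reduction of $\mathfrak m$ if $\mathfrak m^{n+1}=x\mathfrak m^n$ for some $n$; the reduction number $r$ is the least integer $r\ge 0$ with $\mathfrak m^{r+1}=x\mathfrak m^r$ (independent of the choice of $x$). The index $i$ ranges over $0\le i\le r$. Invariants of the tangent cone: let $F(x)=\bigoplus_{n\ge 0}x^nA/x^n\mathfrak m\hookrightarrow G(\mathfrak m)$, a polynomial ring $K[x^*]$ in the initial form $x^*\in\mathfrak m/\mathfrak m^2$. As a graded $F(x)$-module, $$G(\mathfrak m)\cong\bigoplus_{i=0}^{r}\left(F(x)(-i)\right)^{\alpha_i}\oplus\bigoplus_{i=1}^{r-1}\bigoplus_{j=1}^{r-i}\left(\frac{F(x)}{(x^* )^jF(x)}(-i)\right)^{\alpha_{i,j}}$$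 for uniquely determined non-negative integers $\alpha_i,\alpha_{i,j}$ (with $\alpha_0=1$). Micro-invariants: let $A'=A[\mathfrak m/x]$ be the first neighborhood ring of $A$, i.e. the subring of the total ring of fractions of $A$ generated over $A$ by the elements $b/x$, $b\in\mathfrak m$. Then $\beta_0=1$ and, for $1\le i\le r$, $$\beta_i=\lambda\left(\frac{A+\mathfrak m^{i-1}A'}{A+\mathfrak m^iA'}\right)-\lambda\left(\frac{A+\mathfrak m^{i}A'}{A+\mathfrak m^{i+1}A'}\right).$$ Apery invariants with respect to $x$: $\gamma_i=\lambda\left(\dfrac{\mathfrak m^i+xA}{\mathfrak m^{i+1}+xA}\right)$. *)

theory Defs
  imports "HOL-Algebra.Algebra" "HOL-Library.Extended_Nat"
begin

definition is_local_ring :: "('a, 'b) ring_scheme \<Rightarrow> 'a set \<Rightarrow> bool" where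
  "is_local_ring R m \<longleftrightarrow> cring R \<and> {J. maximalideal J R} = {m}"

definition prime_chain :: "('a, 'b) ring_scheme \<Rightarrow> nat \<Rightarrow> (nat \<Rightarrow> 'a set) \<Rightarrow> bool" where
  "prime_chain R n P \<longleftrightarrow> (\<forall>i\<le>n. primeideal (P i) R) \<and> (\<forall>i<n. P i \<subset> P (Suc i))"

definition krull_dim :: "('a, 'b) ring_scheme \<Rightarrow> enat" where
  "krull_dim R = Sup {enat n | n. \<exists>P. prime_chain R n P}"

definition height :: "('a, 'b) ring_scheme \<Rightarrow> 'a set \<Rightarrow> enat" where
  "height R Q = Sup {enat n | n. \<exists>P. prime_chain R n P \<and> P n = Q}"

definition regular_seq :: "('a, 'b) ring_scheme \<Rightarrow> 'a list \<Rightarrow> bool" where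
  "regular_seq R xs \<longleftrightarrow>
     set xs \<subseteq> carrier R \<and>
     (\<forall>i<length xs. \<forall>a\<in>carrier R.
        xs ! i \<otimes>\<^bsub>R\<^esub> a \<in> Idl\<^bsub>R\<^esub> (set (take i xs)) \<longrightarrow> a \<in> Idl\<^bsub>R\<^esub> (set (take i xs))) \<and>
     Idl\<^bsub>R\<^esub> (set xs) \<noteq> carrier R"

definition ideal_depth :: "('a, 'b) ring_scheme \<Rightarrow> 'a set \<Rightarrow> enat" where
  "ideal_depth R I = Sup {enat (length xs) | xs. regular_seq R xs \<and> set xs \<subseteq> I}"

text \<open>The definition in the form of Kaplansky and Eisenbud, which applies to local and non-local
  rings alike. For a local ring the only instance is the equality of depth and dimension.\<close>

definition cohen_macaulay_ring :: "('a, 'b) ring_scheme \<Rightarrow> bool" where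
  "cohen_macaulay_ring R \<longleftrightarrow>
     cring R \<and> noetherian_ring R \<and> (\<forall>P. maximalideal P R \<longrightarrow> ideal_depth R P = height R P)"

text \<open>The zeroth power is the whole ring, the unit of the monoid of ideals.\<close>

definition ideal_pow :: "('a, 'b) ring_scheme \<Rightarrow> 'a set \<Rightarrow> nat \<Rightarrow> 'a set" where
  "ideal_pow R I n = I [^]\<^bsub>ideals_set R\<^esub> n"

definition minimal_reduction :: "('a, 'b) ring_scheme \<Rightarrow> 'a set \<Rightarrow> 'a \<Rightarrow> bool" where
  "minimal_reduction R m x \<longleftrightarrow>
     x \<in> m \<and> (\<exists>n. ideal_pow R m (Suc n) = x <#\<^bsub>R\<^esub> ideal_pow R m n)"

definition reduction_number :: "('a, 'b) ring_scheme \<Rightarrow> 'a set \<Rightarrow> 'a \<Rightarrow> nat" where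
  "reduction_number R m x = (LEAST n. ideal_pow R m (Suc n) = x <#\<^bsub>R\<^esub> ideal_pow R m n)"

text \<open>The ring \<open>S\<close> as a module over the source of a ring homomorphism \<open>\<phi>\<close> into \<open>S\<close>.\<close>

definition scalars_along :: "('r \<Rightarrow> 'a) \<Rightarrow> ('a, 'b) ring_scheme \<Rightarrow> ('r, 'a) module" where
  "scalars_along \<phi> S =
     \<lparr>carrier = carrier S, monoid.mult = monoid.mult S, one = one S,
      ring.zero = ring.zero S, add = add S,
      smult = (\<lambda>a s. \<phi> a \<otimes>\<^bsub>S\<^esub> s)\<rparr>"

text \<open>The fields \<open>mult\<close> and \<open>one\<close> of a module record have no meaning for a module that is not an
  algebra.\<close>

definition quot_module :: "('r, 'a) module \<Rightarrow> 'a set \<Rightarrow> ('r, 'a set) module" where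
  "quot_module M N =
     \<lparr>carrier = a_rcosets\<^bsub>M\<^esub> N, monoid.mult = undefined, one = undefined,
      ring.zero = N, add = set_add M,
      smult = (\<lambda>a C. \<Union>u\<in>C. N +>\<^bsub>M\<^esub> (a \<odot>\<^bsub>M\<^esub> u))\<rparr>"

definition module_length :: "('r, 'c) ring_scheme \<Rightarrow> ('r, 'a) module \<Rightarrow> enat" where
  "module_length R M = Sup {enat n | n. \<exists>N.
     (\<forall>i\<le>n. submodule (N i) R M) \<and> (\<forall>i<n. N i \<subset> N (Suc i))}"

text \<open>The length of \<open>P / N\<close> for submodules \<open>N \<subseteq> P\<close> of \<open>M\<close>, as a natural number; it is only
  meaningful when this length is finite.\<close>

definition quot_length :: "('r, 'c) ring_scheme \<Rightarrow> ('r, 'a) module \<Rightarrow> 'a set \<Rightarrow> 'a set \<Rightarrow> nat" where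
  "quot_length R M P N = the_enat (module_length R (quot_module (M\<lparr>carrier := P\<rparr>) N))"

text \<open>A graded module is a module together with its homogeneous components.\<close>

type_synonym ('r, 'a) graded_module = "('r, 'a) module \<times> (nat \<Rightarrow> 'a set)"

definition graded_iso ::
    "('r, 'c) ring_scheme \<Rightarrow> ('r, 'a) graded_module \<Rightarrow> ('r, 'b) graded_module \<Rightarrow> bool" where
  "graded_iso R = (\<lambda>(M, D) (N, E). \<exists>\<phi>.
     bij_betw \<phi> (carrier M) (carrier N) \<and>
     (\<forall>u\<in>carrier M. \<forall>v\<in>carrier M. \<phi> (u \<oplus>\<^bsub>M\<^esub> v) = \<phi> u \<oplus>\<^bsub>N\<^esub> \<phi> v) \<and>
     (\<forall>a\<in>carrier R. \<forall>u\<in>carrier M. \<phi> (a \<odot>\<^bsub>M\<^esub> u) = a \<odot>\<^bsub>N\<^esub> \<phi> u) \<and>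
     (\<forall>n. \<phi> ` D n = E n))"

text \<open>The twist \<open>M(-i)\<close>.\<close>

definition graded_shift :: "nat \<Rightarrow> ('r, 'a) graded_module \<Rightarrow> ('r, 'a) graded_module" where
  "graded_shift i = (\<lambda>(M, D). (M, \<lambda>n. if n < i then {\<zero>\<^bsub>M\<^esub>} else D (n - i)))"

text \<open>The direct sum of a family with a finite index set.\<close>

definition graded_dsum :: "'i set \<Rightarrow> ('i \<Rightarrow> ('r, 'a) graded_module) \<Rightarrow> ('r, 'i \<Rightarrow> 'a) graded_module"
  where
  "graded_dsum I M =
     (\<lparr>carrier = (\<Pi>\<^sub>E i\<in>I. carrier (fst (M i))), monoid.mult = undefined, one = undefined,
       ring.zero = (\<lambda>i\<in>I. \<zero>\<^bsub>fst (M i)\<^esub>),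
       add = (\<lambda>f g. \<lambda>i\<in>I. f i \<oplus>\<^bsub>fst (M i)\<^esub> g i),
       smult = (\<lambda>a f. \<lambda>i\<in>I. a \<odot>\<^bsub>fst (M i)\<^esub> f i)\<rparr>,
      \<lambda>n. \<Pi>\<^sub>E i\<in>I. snd (M i) n)"

definition graded_sum2 ::
    "('r, 'a) graded_module \<Rightarrow> ('r, 'b) graded_module \<Rightarrow> ('r, 'a \<times> 'b) graded_module" where
  "graded_sum2 = (\<lambda>(M, D) (N, E).
     (\<lparr>carrier = carrier M \<times> carrier N, monoid.mult = undefined, one = undefined,
       ring.zero = (\<zero>\<^bsub>M\<^esub>, \<zero>\<^bsub>N\<^esub>),
       add = (\<lambda>(u, v) (u', v'). (u \<oplus>\<^bsub>M\<^esub> u', v \<oplus>\<^bsub>N\<^esub> v')),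
       smult = (\<lambda>a (u, v). (a \<odot>\<^bsub>M\<^esub> u, a \<odot>\<^bsub>N\<^esub> v))\<rparr>,
      \<lambda>n. D n \<times> E n))"

text \<open>An element of \<open>G(I)\<close> is the sequence of its homogeneous components, the \<open>n\<close>-th one being a
  coset of \<open>I\<^sup>n\<^sup>+\<^sup>1\<close> that is contained in \<open>I\<^sup>n\<close>. The product of the classes of \<open>a \<in> I\<^sup>i\<close> and
  \<open>b \<in> I\<^sup>j\<close> is the class of \<open>a b\<close> modulo \<open>I\<^sup>i\<^sup>+\<^sup>j\<^sup>+\<^sup>1\<close>.\<close>

definition tangent_cone :: "('a, 'b) ring_scheme \<Rightarrow> 'a set \<Rightarrow> (nat \<Rightarrow> 'a set) ring" where
  "tangent_cone R I =
     \<lparr>carrier = {f. (\<forall>n. f n \<in> (\<lambda>a. ideal_pow R I (Suc n) +>\<^bsub>R\<^esub> a) ` ideal_pow R I n) \<and>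
                    finite {n. f n \<noteq> ideal_pow R I (Suc n)}},
      monoid.mult = (\<lambda>f g n. \<Oplus>\<^bsub>R Quot ideal_pow R I (Suc n)\<^esub> i\<in>{..n}.
                rcoset_mult R (ideal_pow R I (Suc n)) (f i) (g (n - i))),
      one = (\<lambda>n. if n = 0 then ideal_pow R I 1 +>\<^bsub>R\<^esub> \<one>\<^bsub>R\<^esub> else ideal_pow R I (Suc n)),
      ring.zero = (\<lambda>n. ideal_pow R I (Suc n)),
      add = (\<lambda>f g n. f n <+>\<^bsub>R\<^esub> g n)\<rparr>"

definition homogeneous :: "('a, 'b) ring_scheme \<Rightarrow> 'a set \<Rightarrow> nat \<Rightarrow> (nat \<Rightarrow> 'a set) set" where
  "homogeneous R I n = {f \<in> carrier (tangent_cone R I). \<forall>k. k \<noteq> n \<longrightarrow> f k = ideal_pow R I (Suc k)}"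

text \<open>The subring \<open>F(x)\<close> of the tangent cone, that is, the image of the direct sum of the
  \<open>x\<^sup>n A / x\<^sup>n m\<close>.\<close>

definition fiber_cone :: "('a, 'b) ring_scheme \<Rightarrow> 'a set \<Rightarrow> 'a \<Rightarrow> (nat \<Rightarrow> 'a set) ring" where
  "fiber_cone R m x = (tangent_cone R m)
     \<lparr>carrier := {f \<in> carrier (tangent_cone R m).
        \<forall>n. f n \<in> (\<lambda>a. ideal_pow R m (Suc n) +>\<^bsub>R\<^esub> (x [^]\<^bsub>R\<^esub> n \<otimes>\<^bsub>R\<^esub> a)) ` carrier R}\<rparr>"

definition initial_form :: "('a, 'b) ring_scheme \<Rightarrow> 'a set \<Rightarrow> 'a \<Rightarrow> (nat \<Rightarrow> 'a set)" where
  "initial_form R m x =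
     (\<lambda>n. if n = 1 then ideal_pow R m 2 +>\<^bsub>R\<^esub> x else ideal_pow R m (Suc n))"

definition cone_graded :: "('a, 'b) ring_scheme \<Rightarrow> 'a set
    \<Rightarrow> (nat \<Rightarrow> 'a set, nat \<Rightarrow> 'a set) graded_module" where
  "cone_graded R m = (scalars_along (\<lambda>f. f) (tangent_cone R m), homogeneous R m)"

definition fiber_graded :: "('a, 'b) ring_scheme \<Rightarrow> 'a set \<Rightarrow> 'a
    \<Rightarrow> (nat \<Rightarrow> 'a set, nat \<Rightarrow> 'a set) graded_module" where
  "fiber_graded R m x =
     (scalars_along (\<lambda>f. f) (fiber_cone R m x),
      \<lambda>n. carrier (fiber_cone R m x) \<inter> homogeneous R m n)"

text \<open>\<open>F(x) / (x\<^sup>*)\<^sup>j F(x)\<close>, a module over \<open>F(x)\<close> by way of the residue map.\<close>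

definition fiber_torsion_graded :: "('a, 'b) ring_scheme \<Rightarrow> 'a set \<Rightarrow> 'a \<Rightarrow> nat
    \<Rightarrow> (nat \<Rightarrow> 'a set, (nat \<Rightarrow> 'a set) set) graded_module" where
  "fiber_torsion_graded R m x j =
     (let F = fiber_cone R m x; J = PIdl\<^bsub>F\<^esub> (initial_form R m x [^]\<^bsub>F\<^esub> j)
      in (scalars_along (\<lambda>f. J +>\<^bsub>F\<^esub> f) (F Quot J),
          \<lambda>n. (\<lambda>f. J +>\<^bsub>F\<^esub> f) ` (carrier F \<inter> homogeneous R m n)))"

text \<open>The defining property of the invariants \<open>\<alpha>\<^sub>i\<close>, \<open>\<alpha>\<^sub>i\<^sub>,\<^sub>j\<close> (here \<open>\<alpha> i\<close> and \<open>\<tau> i j\<close>). The copies of a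
  summand are numbered by \<open>k\<close>.\<close>

definition tangent_cone_invariants ::
    "('a, 'b) ring_scheme \<Rightarrow> 'a set \<Rightarrow> 'a \<Rightarrow> (nat \<Rightarrow> nat) \<Rightarrow> (nat \<Rightarrow> nat \<Rightarrow> nat) \<Rightarrow> bool" where
  "tangent_cone_invariants R m x \<alpha> \<tau> \<longleftrightarrow>
     (let r = reduction_number R m x in
      graded_iso (fiber_cone R m x) (cone_graded R m)
        (graded_sum2
          (graded_dsum {(i, k). i \<le> r \<and> k < \<alpha> i}
             (\<lambda>(i, k). graded_shift i (fiber_graded R m x)))
          (graded_dsum {(i, j, k). 1 \<le> i \<and> i \<le> r - 1 \<and> 1 \<le> j \<and> j \<le> r - i \<and> k < \<tau> i j}
             (\<lambda>(i, j, k). graded_shift i (fiber_torsion_graded R m x j)))))"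

definition nonzerodivisors :: "('a, 'b) ring_scheme \<Rightarrow> 'a set" where
  "nonzerodivisors R = {s \<in> carrier R. \<forall>a\<in>carrier R. s \<otimes>\<^bsub>R\<^esub> a = \<zero>\<^bsub>R\<^esub> \<longrightarrow> a = \<zero>\<^bsub>R\<^esub>}"

definition frac_rel :: "('a, 'b) ring_scheme \<Rightarrow> (('a \<times> 'a) \<times> ('a \<times> 'a)) set" where
  "frac_rel R = {((a, s), (b, t)).
     a \<in> carrier R \<and> b \<in> carrier R \<and> s \<in> nonzerodivisors R \<and> t \<in> nonzerodivisors R \<and>
     a \<otimes>\<^bsub>R\<^esub> t = b \<otimes>\<^bsub>R\<^esub> s}"

definition frac :: "('a, 'b) ring_scheme \<Rightarrow> 'a \<Rightarrow> 'a \<Rightarrow> ('a \<times> 'a) set" where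
  "frac R a s = frac_rel R `` {(a, s)}"

definition total_frac :: "('a, 'b) ring_scheme \<Rightarrow> (('a \<times> 'a) set) ring" where
  "total_frac R =
     \<lparr>carrier = (carrier R \<times> nonzerodivisors R) // frac_rel R,
      monoid.mult = (\<lambda>C D. \<Union>(a, s)\<in>C. \<Union>(b, t)\<in>D. frac R (a \<otimes>\<^bsub>R\<^esub> b) (s \<otimes>\<^bsub>R\<^esub> t)),
      one = frac R \<one>\<^bsub>R\<^esub> \<one>\<^bsub>R\<^esub>,
      ring.zero = frac R \<zero>\<^bsub>R\<^esub> \<one>\<^bsub>R\<^esub>,
      add = (\<lambda>C D. \<Union>(a, s)\<in>C. \<Union>(b, t)\<in>D.
               frac R (a \<otimes>\<^bsub>R\<^esub> t \<oplus>\<^bsub>R\<^esub> b \<otimes>\<^bsub>R\<^esub> s) (s \<otimes>\<^bsub>R\<^esub> t))\<rparr>"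

definition frac_embed :: "('a, 'b) ring_scheme \<Rightarrow> 'a \<Rightarrow> ('a \<times> 'a) set" where
  "frac_embed R a = frac R a \<one>\<^bsub>R\<^esub>"

text \<open>The fractions \<open>b / x\<close> are elements of the total ring of fractions only if \<open>x\<close> is a
  nonzerodivisor. This holds for a minimal reduction of a one-dimensional Cohen--Macaulay local
  ring.\<close>

definition first_neighborhood :: "('a, 'b) ring_scheme \<Rightarrow> 'a set \<Rightarrow> 'a \<Rightarrow> ('a \<times> 'a) set set" where
  "first_neighborhood R m x =
     generate_ring (total_frac R) (frac_embed R ` carrier R \<union> (\<lambda>b. frac R b x) ` m)"

text \<open>The \<open>A\<close>-submodule \<open>A + m\<^sup>i A'\<close> of the total ring of fractions, where \<open>m\<^sup>i A'\<close> is the extension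
  of \<open>m\<^sup>i\<close> to an ideal of \<open>A'\<close>.\<close>

definition micro_module :: "('a, 'b) ring_scheme \<Rightarrow> 'a set \<Rightarrow> 'a \<Rightarrow> nat \<Rightarrow> ('a \<times> 'a) set set" where
  "micro_module R m x i =
     (let Q = total_frac R
      in frac_embed R ` carrier R <+>\<^bsub>Q\<^esub>
         Idl\<^bsub>Q\<lparr>carrier := first_neighborhood R m x\<rparr>\<^esub> (frac_embed R ` ideal_pow R m i))"

definition micro_invariant :: "('a, 'b) ring_scheme \<Rightarrow> 'a set \<Rightarrow> 'a \<Rightarrow> nat \<Rightarrow> int" where
  "micro_invariant R m x i =
     (if i = 0 then 1
      else let Q = scalars_along (frac_embed R) (total_frac R); B = micro_module R m x
           in int (quot_length R Q (B (i - 1)) (B i)) - int (quot_length R Q (B i) (B (i + 1))))"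

definition apery_invariant :: "('a, 'b) ring_scheme \<Rightarrow> 'a set \<Rightarrow> 'a \<Rightarrow> nat \<Rightarrow> nat" where
  "apery_invariant R m x i =
     quot_length R (scalars_along (\<lambda>a. a) R)
       (ideal_pow R m i <+>\<^bsub>R\<^esub> PIdl\<^bsub>R\<^esub> x) (ideal_pow R m (i + 1) <+>\<^bsub>R\<^esub> PIdl\<^bsub>R\<^esub> x)"

end

theory Submission
  imports Defs
begin

text \<open>Write \<open>\<lambda>\<close> for the length and \<open>H(n) = \<lambda>(m\<^sup>n/m\<^sup>n\<^sup>+\<^sup>1)\<close> for the Hilbert function of the tangent cone \<open>G\<close>. Since
\<open>m\<^sup>n\<^sup>+\<^sup>1 = x m\<^sup>n\<close> for \<open>n \<ge> r\<close>, it has the constant value \<open>e = \<lambda>(A/xA)\<close> from \<open>r\<close> on. Let \<open>a\<^sub>n\<close>, \<open>b\<^sub>n\<close>, \<open>c\<^sub>n\<close>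
be the sums of \<open>\<alpha>\<^sub>i\<close>, \<open>\<beta>\<^sub>i\<close>, \<open>\<gamma>\<^sub>i\<close> over \<open>i \<le> n\<close>. Equality of two families of invariants is equality of
their partial sums, and each kind of partial sum is compared with \<open>H\<close>.

  \<^item> The sum \<open>c\<^sub>n\<close> telescopes to \<open>\<lambda>(A/(m\<^sup>n\<^sup>+\<^sup>1 + xA))\<close>. Kernel and cokernel of the multiplication by \<open>x\<close>
    on \<open>A/m\<^sup>n\<^sup>+\<^sup>1\<close> have the same length, whence \<open>c\<^sub>n = H(n) + \<lambda>((m\<^sup>n\<^sup>+\<^sup>1 : x)/m\<^sup>n) \<ge> H(n)\<close>
    (\<open>sum_apery_invariants\<close>).
  \<^item> In the decomposition of \<open>G\<close> every summand that is nonzero in degree \<open>n\<close> contributes one dimension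
    to that degree, so \<open>H(n)\<close> exceeds \<open>a\<^sub>n\<close> by the number of torsion summands that live in degree \<open>n\<close>
    (\<open>hilb_decomposition\<close>).
  \<^item> The first neighborhood ring is \<open>x\<^sup>-\<^sup>r m\<^sup>r\<close>. Multiplication by \<open>x\<^sup>r\<close> thus turns the lengths \<open>\<lambda>\<^sub>n\<close> of
    \<open>(A + m\<^sup>n A')/(A + m\<^sup>n\<^sup>+\<^sup>1 A')\<close> into lengths between ideals of \<open>A\<close>. The sum \<open>b\<^sub>n\<close> telescopes to \<open>e - \<lambda>\<^sub>n\<close>,
    and as the sum of the \<open>\<lambda>\<^sub>n\<close> over \<open>n < r\<close> is \<open>\<lambda>(A'/A) = r e - \<lambda>(A/m\<^sup>r)\<close>, the sum of the \<open>b\<^sub>n\<close> over \<open>n < r\<close>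
    equals the sum of the \<open>H(n)\<close> (\<open>sum_micro_invariant\<close>, \<open>sum_sum_micro\<close>).

If the initial form \<open>x\<^sup>*\<close> is a nonzerodivisor of \<open>G\<close>, then \<open>a\<^sub>n = b\<^sub>n = c\<^sub>n = H(n)\<close> for \<open>n \<le> r\<close>. Conversely
\<open>a\<^sub>n \<le> H(n) \<le> c\<^sub>n\<close>, and on average over \<open>n < r\<close> the number \<open>b\<^sub>n\<close> is \<open>H(n)\<close>; hence each of the equalities
\<open>a = b\<close>, \<open>a = c\<close>, \<open>b = c\<close> forces \<open>a\<^sub>n = H(n)\<close> for all \<open>n < r\<close> or \<open>c\<^sub>n = H(n)\<close> for all \<open>n < r\<close>. The former
excludes torsion summands, the latter says \<open>(m\<^sup>n\<^sup>+\<^sup>1 : x) = m\<^sup>n\<close> for \<open>n < r\<close>, which holds for \<open>n \<ge> r\<close> in any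
case. Either way \<open>x\<^sup>*\<close> is a nonzerodivisor.

It remains to see that \<open>G\<close> is Cohen--Macaulay if and only if \<open>x\<^sup>*\<close> is a nonzerodivisor
(\<open>cohen_macaulay_iff_regular\<close>). If \<open>G\<close> is Cohen--Macaulay, the ideal of the elements of positive degree
has height at least one and so contains a nonzerodivisor \<open>y\<close>; its power \<open>y\<^sup>r\<^sup>+\<^sup>1\<close> is a multiple of \<open>x\<^sup>*\<close>.
For the converse, \<open>G\<close> is noetherian by an argument with leading coefficients, and every maximal ideal
contains \<open>x\<^sup>*\<close> or an element \<open>1 - x\<^sup>* u\<close>, and both are nonzerodivisors if \<open>x\<^sup>*\<close> is. That depth and height are at most one
comes from the boundedness of \<open>H\<close>: the length of the part of \<open>G/P\<close> in degrees below \<open>n\<close> grows at most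
linearly with \<open>n\<close>. If \<open>f\<close> is a nonzerodivisor modulo \<open>P\<close>, this bounds the lengths of the corresponding parts
of \<open>G/(P + fG)\<close> uniformly in \<open>n\<close>, so the powers of any element of that ring generate a descending chain of
ideals that stops (\<open>powers_stop\<close>).\<close>

section \<open>Lengths of modules\<close>

definition strict_chain :: "'x set set \<Rightarrow> nat \<Rightarrow> (nat \<Rightarrow> 'x set) \<Rightarrow> bool" where
  "strict_chain \<F> n f \<longleftrightarrow> (\<forall>i\<le>n. f i \<in> \<F>) \<and> (\<forall>i<n. f i \<subset> f (Suc i))"

text \<open>Families of submodules are compared through their chains alone. This lets one notion serve for
submodules of a quotient, for submodules between two given ones, and for ideals.\<close>

definition chain_length :: "'x set set \<Rightarrow> enat" where
  "chain_length \<F> = Sup {enat n | n. \<exists>f. strict_chain \<F> n f}"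

lemma chain_length_ge: "strict_chain \<F> n f \<Longrightarrow> enat n \<le> chain_length \<F>"
  unfolding chain_length_def by (rule Sup_upper) blast

lemma chain_length_ge_iff:
  assumes "\<F> \<noteq> {}"
  shows "enat n \<le> chain_length \<F> \<longleftrightarrow> (\<exists>f. strict_chain \<F> n f)"
proof
  assume le: "enat n \<le> chain_length \<F>"
  show "\<exists>f. strict_chain \<F> n f"
  proof (cases n)
    case 0
    obtain U where "U \<in> \<F>" using assms by blast
    then have "strict_chain \<F> n (\<lambda>_. U)" using 0 by (simp add: strict_chain_def)
    then show ?thesis by blast
  next
    case (Suc k)
    have "enat k < chain_length \<F>" using le Suc by (meson enat_ord_simps(2) lessI order_less_le_trans)
    then obtain n' f where "enat k < enat n'" and c: "strict_chain \<F> n' f"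
      unfolding chain_length_def less_Sup_iff by blast
    then have "strict_chain \<F> n f" using Suc by (simp add: strict_chain_def)
    then show ?thesis by blast
  qed
next
  assume "\<exists>f. strict_chain \<F> n f"
  then show "enat n \<le> chain_length \<F>" using chain_length_ge by blast
qed

text \<open>Most comparisons of lengths that do not come from additivity are instances of this: a strictly
monotone map carries chains to chains.\<close>

lemma chain_length_mono_map:
  assumes "\<And>U. U \<in> \<F> \<Longrightarrow> \<Psi> U \<in> \<G>"
    and "\<And>U V. U \<in> \<F> \<Longrightarrow> V \<in> \<F> \<Longrightarrow> U \<subset> V \<Longrightarrow> \<Psi> U \<subset> \<Psi> V"
  shows "chain_length \<F> \<le> chain_length \<G>"
  unfolding chain_length_def
proof (rule Sup_mono)
  fix e assume "e \<in> {enat n | n. \<exists>f. strict_chain \<F> n f}"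
  then obtain n f where e: "e = enat n" and f: "strict_chain \<F> n f" by blast
  have "strict_chain \<G> n (\<lambda>i. \<Psi> (f i))"
    using f assms by (simp add: strict_chain_def)
  then show "\<exists>e'\<in>{enat n | n. \<exists>f. strict_chain \<G> n f}. e \<le> e'" using e by blast
qed

text \<open>The repetitions of a weakly increasing chain can be removed. Chains that arise from a strict chain by
intersections and sums are only weakly increasing.\<close>

lemma chain_length_ge_card_strict:
  assumes "\<forall>i\<le>n. f i \<in> \<F>" "\<forall>i<n. f i \<subseteq> f (Suc i)"
  shows "enat (card {i. i < n \<and> f i \<noteq> f (Suc i)}) \<le> chain_length \<F>"
proof -
  have "\<exists>g. strict_chain \<F> (card {i. i < n \<and> f i \<noteq> f (Suc i)}) g
      \<and> g (card {i. i < n \<and> f i \<noteq> f (Suc i)}) = f n"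
    using assms
  proof (induction n)
    case 0
    then have "strict_chain \<F> 0 f" by (simp add: strict_chain_def)
    then show ?case by auto
  next
    case (Suc n)
    define c where "c = card {i. i < n \<and> f i \<noteq> f (Suc i)}"
    obtain g where g: "strict_chain \<F> c g" "g c = f n"
      using Suc unfolding c_def by auto
    show ?case
    proof (cases "f n = f (Suc n)")
      case True
      then have "{i. i < Suc n \<and> f i \<noteq> f (Suc i)} = {i. i < n \<and> f i \<noteq> f (Suc i)}"
        by (auto simp: less_Suc_eq)
      then have "card {i. i < Suc n \<and> f i \<noteq> f (Suc i)} = c" by (simp add: c_def)
      then show ?thesis using g True by auto
    next
      case False
      then have "{i. i < Suc n \<and> f i \<noteq> f (Suc i)} = insert n {i. i < n \<and> f i \<noteq> f (Suc i)}"
        by (auto simp: less_Suc_eq)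
      then have c: "card {i. i < Suc n \<and> f i \<noteq> f (Suc i)} = Suc c" by (simp add: c_def)
      have "f n \<subset> f (Suc n)" "f (Suc n) \<in> \<F>" using Suc.prems False by auto
      then have "strict_chain \<F> (Suc c) (g(Suc c := f (Suc n)))"
        using g by (simp add: strict_chain_def less_Suc_eq le_Suc_eq)
      then show ?thesis unfolding c by (metis fun_upd_same)
    qed
  qed
  then show ?thesis using chain_length_ge by blast
qed

definition segment :: "('r, 'c) ring_scheme \<Rightarrow> ('r, 'a, 'd) module_scheme \<Rightarrow> 'a set \<Rightarrow> 'a set \<Rightarrow> 'a set set" where
  "segment R M N P = {U. submodule U R M \<and> N \<subseteq> U \<and> U \<subseteq> P}"

text \<open>The length of \<open>P / N\<close>, measured without forming the quotient.\<close>

definition len :: "('r, 'c) ring_scheme \<Rightarrow> ('r, 'a, 'd) module_scheme \<Rightarrow> 'a set \<Rightarrow> 'a set \<Rightarrow> enat" where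
  "len R M N P = chain_length (segment R M N P)"

text \<open>Additivity of lengths is an equation in \<^typ>\<open>enat\<close>; it is proved by comparing the finite lower bounds of
both sides, which correspond to chains.\<close>

lemma enat_le_add_iff:
  "enat k \<le> a + b \<longleftrightarrow> (\<exists>p q. k = p + q \<and> enat p \<le> a \<and> enat q \<le> b)"
proof
  assume k: "enat k \<le> a + b"
  show "\<exists>p q. k = p + q \<and> enat p \<le> a \<and> enat q \<le> b"
  proof (cases a)
    case (enat a')
    have "enat (k - min k a') \<le> b" using k enat by (cases b) (auto simp: min_def)
    then have "k = min k a' + (k - min k a')" "enat (min k a') \<le> a" "enat (k - min k a') \<le> b"
      using enat by simp_all
    then show ?thesis by blast
  next
    case infinity
    then have "k = k + 0" "enat k \<le> a" "enat 0 \<le> b" by (simp_all add: zero_enat_def[symmetric])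
    then show ?thesis by blast
  qed
next
  assume "\<exists>p q. k = p + q \<and> enat p \<le> a \<and> enat q \<le> b"
  then obtain p q where "k = p + q" "enat p \<le> a" "enat q \<le> b" by auto
  then show "enat k \<le> a + b" using add_mono[of "enat p" a "enat q" b] by simp
qed

lemma enat_eqI: "(\<And>k. enat k \<le> a \<longleftrightarrow> enat k \<le> b) \<Longrightarrow> a = b"
proof -
  have le: "a' \<le> b'" if h: "\<And>k. enat k \<le> a' \<Longrightarrow> enat k \<le> b'" for a' b' :: enat
  proof (rule ccontr)
    assume "\<not> a' \<le> b'"
    then have "b' < a'" by simp
    then obtain n where n: "b' = enat n" by (cases b') auto
    then have "enat (Suc n) \<le> a'" using \<open>b' < a'\<close> by (simp add: Suc_ile_eq)
    then show False using h n by fastforce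
  qed
  assume "\<And>k. enat k \<le> a \<longleftrightarrow> enat k \<le> b"
  then show "a = b" using le[of a b] le[of b a] by auto
qed

context module
begin

lemma submodule_Int:
  assumes "submodule U R M" "submodule V R M"
  shows "submodule (U \<inter> V) R M"
  using submoduleE[OF assms(1)] submoduleE[OF assms(2)] submodule.axioms(1)[OF assms(1)]
     submodule.axioms(1)[OF assms(2)] 
  by (intro submoduleI) (auto dest: subgroup.one_closed)

lemma submodule_zero: "submodule U R M \<Longrightarrow> \<zero>\<^bsub>M\<^esub> \<in> U"
  using submodule.axioms(1) subgroup.one_closed by fastforce

lemma set_addE: "u \<in> U <+>\<^bsub>M\<^esub> V \<Longrightarrow> (\<And>a b. a \<in> U \<Longrightarrow> b \<in> V \<Longrightarrow> u = a \<oplus>\<^bsub>M\<^esub> b \<Longrightarrow> thesis) \<Longrightarrow> thesis"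
  unfolding set_add_def' by blast

lemma set_addI: "a \<in> U \<Longrightarrow> b \<in> V \<Longrightarrow> a \<oplus>\<^bsub>M\<^esub> b \<in> U <+>\<^bsub>M\<^esub> V"
  unfolding set_add_def' by blast

lemma submodule_set_add:
  assumes U: "submodule U R M" and V: "submodule V R M"
  shows "submodule (U <+>\<^bsub>M\<^esub> V) R M"
proof (rule submoduleI)
  have Uc: "U \<subseteq> carrier M" and Vc: "V \<subseteq> carrier M" using U V submoduleE(1) by auto
  show "U <+>\<^bsub>M\<^esub> V \<subseteq> carrier M"
    by (rule subsetI, erule set_addE) (use Uc Vc in auto)
  show "\<zero>\<^bsub>M\<^esub> \<in> U <+>\<^bsub>M\<^esub> V" using set_addI[OF submodule_zero[OF U] submodule_zero[OF V]] by simp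
  fix a assume "a \<in> U <+>\<^bsub>M\<^esub> V"
  then obtain u v where uv: "u \<in> U" "v \<in> V" "a = u \<oplus>\<^bsub>M\<^esub> v" by (rule set_addE)
  have uvc: "u \<in> carrier M" "v \<in> carrier M" using uv Uc Vc by auto
  have "\<ominus>\<^bsub>M\<^esub> a = \<ominus>\<^bsub>M\<^esub> u \<oplus>\<^bsub>M\<^esub> \<ominus>\<^bsub>M\<^esub> v" using uv(3) uvc M.minus_add by simp
  then show "\<ominus>\<^bsub>M\<^esub> a \<in> U <+>\<^bsub>M\<^esub> V"
    using set_addI[OF submoduleE(3)[OF U uv(1)] submoduleE(3)[OF V uv(2)]] by simp
  { fix b assume "b \<in> U <+>\<^bsub>M\<^esub> V"
    then obtain u' v' where uv': "u' \<in> U" "v' \<in> V" "b = u' \<oplus>\<^bsub>M\<^esub> v'" by (rule set_addE)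
    have c: "u' \<in> carrier M" "v' \<in> carrier M" using uv' Uc Vc by auto
    have "a \<oplus>\<^bsub>M\<^esub> b = (u \<oplus>\<^bsub>M\<^esub> u') \<oplus>\<^bsub>M\<^esub> (v \<oplus>\<^bsub>M\<^esub> v')"
      unfolding uv(3) uv'(3) using uvc c by (simp add: M.a_ac)
    then show "a \<oplus>\<^bsub>M\<^esub> b \<in> U <+>\<^bsub>M\<^esub> V"
      using set_addI[OF submoduleE(5)[OF U uv(1) uv'(1)] submoduleE(5)[OF V uv(2) uv'(2)]] by simp }
  fix c assume c: "c \<in> carrier R"
  have "c \<odot>\<^bsub>M\<^esub> a = c \<odot>\<^bsub>M\<^esub> u \<oplus>\<^bsub>M\<^esub> c \<odot>\<^bsub>M\<^esub> v" using uv(3) uvc c smult_r_distr by simp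
  then show "c \<odot>\<^bsub>M\<^esub> a \<in> U <+>\<^bsub>M\<^esub> V"
    using set_addI[OF submoduleE(4)[OF U c uv(1)] submoduleE(4)[OF V c uv(2)]] by simp
qed

lemma set_add_upper:
  assumes U: "submodule U R M" and V: "submodule V R M"
  shows "U \<subseteq> U <+>\<^bsub>M\<^esub> V" "V \<subseteq> U <+>\<^bsub>M\<^esub> V"
proof -
  note E = submoduleE(1)[OF U] submoduleE(1)[OF V]
  show "U \<subseteq> U <+>\<^bsub>M\<^esub> V" using set_addI[OF _ submodule_zero[OF V]] E by fastforce
  show "V \<subseteq> U <+>\<^bsub>M\<^esub> V" using set_addI[OF submodule_zero[OF U]] E by fastforce
qed

lemma set_add_least:
  assumes "submodule W R M" "U \<subseteq> W" "V \<subseteq> W"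
  shows "U <+>\<^bsub>M\<^esub> V \<subseteq> W"
  using assms submoduleE(5)[OF assms(1)] by (auto elim!: set_addE)

lemma set_add_mono: "U \<subseteq> U' \<Longrightarrow> V \<subseteq> V' \<Longrightarrow> U <+>\<^bsub>M\<^esub> V \<subseteq> U' <+>\<^bsub>M\<^esub> V'"
  unfolding set_add_def' by blast

lemma modular_law:
  assumes U: "submodule U R M" and V: "submodule V R M" and W: "submodule W R M" and "U \<subseteq> W"
  shows "(U <+>\<^bsub>M\<^esub> V) \<inter> W = U <+>\<^bsub>M\<^esub> (V \<inter> W)"
proof
  show "(U <+>\<^bsub>M\<^esub> V) \<inter> W \<subseteq> U <+>\<^bsub>M\<^esub> (V \<inter> W)"
  proof
    fix w assume w: "w \<in> (U <+>\<^bsub>M\<^esub> V) \<inter> W"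
    then obtain u v where uv: "u \<in> U" "v \<in> V" "w = u \<oplus>\<^bsub>M\<^esub> v" by (auto elim: set_addE)
    have "u \<in> W" using uv assms by blast
    have c: "u \<in> carrier M" "v \<in> carrier M" using uv submoduleE(1)[OF U] submoduleE(1)[OF V] by auto
    have "v = \<ominus>\<^bsub>M\<^esub> u \<oplus>\<^bsub>M\<^esub> w" using uv c by (simp add: M.r_neg1)
    then have "v \<in> W" using \<open>u \<in> W\<close> w submoduleE[OF W] by auto
    then show "w \<in> U <+>\<^bsub>M\<^esub> (V \<inter> W)" using uv set_addI by auto
  qed
  show "U <+>\<^bsub>M\<^esub> (V \<inter> W) \<subseteq> (U <+>\<^bsub>M\<^esub> V) \<inter> W"
    using set_add_mono[of U U "V \<inter> W" V] set_add_least[OF W \<open>U \<subseteq> W\<close>, of "V \<inter> W"] by blast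
qed

text \<open>A consequence of the modular law. It is used in the contrapositive: a strict step of a chain remains
strict after intersecting with \<open>Q\<close> or after adding \<open>Q\<close>.\<close>

lemma submodule_eqI:
  assumes "submodule U R M" "submodule V R M" "submodule Q R M" "U \<subseteq> V"
    and int: "U \<inter> Q = V \<inter> Q" and sum: "U <+>\<^bsub>M\<^esub> Q = V <+>\<^bsub>M\<^esub> Q"
  shows "U = V"
proof -
  have "V \<subseteq> (U <+>\<^bsub>M\<^esub> Q) \<inter> V" using set_add_upper(1)[OF assms(2,3)] sum by blast
  also have "\<dots> = U <+>\<^bsub>M\<^esub> (Q \<inter> V)" by (rule modular_law) fact+
  also have "\<dots> = U <+>\<^bsub>M\<^esub> (U \<inter> Q)" using int by (simp add: Int_commute)
  also have "\<dots> \<subseteq> U" by (rule set_add_least) (use assms in auto)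
  finally show ?thesis using assms by blast
qed

text \<open>A chain between \<open>N\<close> and \<open>P\<close> has traces between \<open>N\<close> and \<open>Q\<close> and between \<open>Q\<close> and \<open>P\<close>, and by the
previous lemma the traces together have at least as many strict steps. Conversely, chains in the two
parts are concatenated.\<close>

lemma len_add:
  assumes N: "submodule N R M" and Q: "submodule Q R M" and P: "submodule P R M"
    and NQ: "N \<subseteq> Q" and QP: "Q \<subseteq> P"
  shows "len R M N P = len R M N Q + len R M Q P"
proof (rule enat_eqI)
  fix k
  have ne: "segment R M N P \<noteq> {}" "segment R M N Q \<noteq> {}" "segment R M Q P \<noteq> {}"
    using assms unfolding segment_def by blast+
  show "enat k \<le> len R M N P \<longleftrightarrow> enat k \<le> len R M N Q + len R M Q P"
  proof
    assume "enat k \<le> len R M N P"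
    then obtain f where f: "\<forall>i\<le>k. f i \<in> segment R M N P" "\<forall>i<k. f i \<subset> f (Suc i)"
      unfolding len_def chain_length_ge_iff[OF ne(1)] strict_chain_def by blast
    have sf: "submodule (f i) R M" "N \<subseteq> f i" "f i \<subseteq> P" if "i \<le> k" for i
      using f that unfolding segment_def by auto
    let ?g = "\<lambda>i. f i \<inter> Q" and ?h = "\<lambda>i. f i <+>\<^bsub>M\<^esub> Q"
    have g: "enat (card {i. i < k \<and> ?g i \<noteq> ?g (Suc i)}) \<le> len R M N Q"
      unfolding len_def
      by (rule chain_length_ge_card_strict)
        (use f NQ Q in \<open>auto simp: segment_def submodule_Int\<close>)
    have "?h i \<in> segment R M Q P" if "i \<le> k" for i
      using submodule_set_add[OF sf(1)[OF that] Q] set_add_upper(2)[OF sf(1)[OF that] Q]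
        set_add_least[OF P sf(3)[OF that] QP] by (simp add: segment_def)
    moreover have "?h i \<subseteq> ?h (Suc i)" if "i < k" for i
      by (rule set_add_mono) (use f(2) that in auto)
    ultimately have h: "enat (card {i. i < k \<and> ?h i \<noteq> ?h (Suc i)}) \<le> len R M Q P"
      unfolding len_def by (intro chain_length_ge_card_strict) auto
    have "?g i \<noteq> ?g (Suc i) \<or> ?h i \<noteq> ?h (Suc i)" if i: "i < k" for i
      using submodule_eqI[OF sf(1) sf(1) Q, of i "Suc i"] f(2) i by fastforce
    then have "{..<k} \<subseteq> {i. i < k \<and> ?g i \<noteq> ?g (Suc i)} \<union> {i. i < k \<and> ?h i \<noteq> ?h (Suc i)}"
      by blast
    then have "k \<le> card ({i. i < k \<and> ?g i \<noteq> ?g (Suc i)} \<union> {i. i < k \<and> ?h i \<noteq> ?h (Suc i)})"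
      using card_mono[of _ "{..<k}"] by fastforce
    also have "\<dots> \<le> card {i. i < k \<and> ?g i \<noteq> ?g (Suc i)} + card {i. i < k \<and> ?h i \<noteq> ?h (Suc i)}"
      by (rule card_Un_le)
    finally have "enat k \<le> enat (card {i. i < k \<and> ?g i \<noteq> ?g (Suc i)}) + enat (card {i. i < k \<and> ?h i \<noteq> ?h (Suc i)})"
      by simp
    also have "\<dots> \<le> len R M N Q + len R M Q P" using g h by (rule add_mono)
    finally show "enat k \<le> len R M N Q + len R M Q P" .
  next
    assume "enat k \<le> len R M N Q + len R M Q P"
    then obtain p q where k: "k = p + q" and "enat p \<le> len R M N Q" "enat q \<le> len R M Q P"
      unfolding enat_le_add_iff by blast
    then obtain f h where f: "\<forall>i\<le>p. f i \<in> segment R M N Q" "\<forall>i<p. f i \<subset> f (Suc i)"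
      and h: "\<forall>i\<le>q. h i \<in> segment R M Q P" "\<forall>i<q. h i \<subset> h (Suc i)"
      unfolding len_def chain_length_ge_iff[OF ne(2)] chain_length_ge_iff[OF ne(3)] strict_chain_def by blast
    \<comment> \<open>the step from \<open>f p\<close> to \<open>h 0\<close> may be trivial, as both can be \<open>Q\<close>; it is not counted\<close>
    define g where "g i = (if i \<le> p then f i else h (i - Suc p))" for i
    have "{..<p} \<union> {Suc p..<Suc (p + q)} \<subseteq> {i. i < Suc (p + q) \<and> g i \<noteq> g (Suc i)}"
    proof (intro subsetI CollectI)
      fix i assume "i \<in> {..<p} \<union> {Suc p..<Suc (p + q)}"
      then show "i < Suc (p + q) \<and> g i \<noteq> g (Suc i)"
      proof
        assume "i \<in> {..<p}" then show ?thesis using f by (auto simp: g_def)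
      next
        assume i: "i \<in> {Suc p..<Suc (p + q)}"
        then have "i - Suc p < q" by auto
        then have "h (i - Suc p) \<subset> h (Suc (i - Suc p))" using h(2) by blast
        moreover have "i - p = Suc (i - Suc p)" using i by auto
        ultimately show ?thesis using i by (auto simp: g_def)
      qed
    qed
    then have "card ({..<p} \<union> {Suc p..<Suc (p + q)}) \<le> card {i. i < Suc (p + q) \<and> g i \<noteq> g (Suc i)}"
      by (intro card_mono) auto
    moreover have "card ({..<p} \<union> {Suc p..<Suc (p + q)}) = k"
      using k by (subst card_Un_disjoint) auto
    moreover have "enat (card {i. i < Suc (p + q) \<and> g i \<noteq> g (Suc i)}) \<le> len R M N P"
      unfolding len_def
    proof (rule chain_length_ge_card_strict; intro allI impI)
      fix i assume "i \<le> Suc (p + q)"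
      then have "g i \<in> segment R M N Q \<or> g i \<in> segment R M Q P"
        unfolding g_def using f(1) h(1) by auto
      then show "g i \<in> segment R M N P" unfolding segment_def using NQ QP by blast
    next
      fix i assume i: "i < Suc (p + q)"
      consider "i < p" | "i = p" | "p < i" by linarith
      then show "g i \<subseteq> g (Suc i)"
      proof cases
        case 1 then show ?thesis using f by (auto simp: g_def)
      next
        case 2
        have "f p \<subseteq> Q" "Q \<subseteq> h 0" using f(1) h(1) by (auto simp: segment_def)
        then show ?thesis using 2 by (auto simp: g_def)
      next
        case 3
        then have "i - Suc p < q" using i by linarith
        then have "h (i - Suc p) \<subset> h (Suc (i - Suc p))" using h(2) by blast
        moreover have "i - p = Suc (i - Suc p)" using 3 by simp
        ultimately show ?thesis using 3 by (simp add: g_def less_imp_le)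
      qed
    qed
    ultimately show "enat k \<le> len R M N P" by (meson enat_ord_simps(1) order_trans)
  qed
qed

text \<open>The second isomorphism theorem: by the modular law \<open>W \<mapsto> U + W\<close> and \<open>W \<mapsto> W \<inter> V\<close> are mutually inverse
between the submodules from \<open>U \<inter> V\<close> to \<open>V\<close> and those from \<open>U\<close> to \<open>U + V\<close>.\<close>

lemma len_Int_eq_len_add:
  assumes U: "submodule U R M" and V: "submodule V R M"
  shows "len R M (U \<inter> V) V = len R M U (U <+>\<^bsub>M\<^esub> V)"
proof (rule antisym)
  show "len R M (U \<inter> V) V \<le> len R M U (U <+>\<^bsub>M\<^esub> V)" unfolding len_def
  proof (rule chain_length_mono_map[where \<Psi> = "\<lambda>W. U <+>\<^bsub>M\<^esub> W"])
    fix W assume "W \<in> segment R M (U \<inter> V) V"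
    then show "U <+>\<^bsub>M\<^esub> W \<in> segment R M U (U <+>\<^bsub>M\<^esub> V)"
      using set_add_mono[of U U W V] submodule_set_add[OF U] set_add_upper[OF U]
      by (auto simp: segment_def)
  next
    fix W W' assume W: "W \<in> segment R M (U \<inter> V) V" "W' \<in> segment R M (U \<inter> V) V" "W \<subset> W'"
    have recover: "(U <+>\<^bsub>M\<^esub> Y) \<inter> V = Y" if Y: "Y \<in> segment R M (U \<inter> V) V" for Y
    proof -
      have s: "submodule Y R M" "U \<inter> V \<subseteq> Y" "Y \<subseteq> V" using Y by (auto simp: segment_def)
      have "(Y <+>\<^bsub>M\<^esub> U) \<inter> V = Y <+>\<^bsub>M\<^esub> (U \<inter> V)" by (rule modular_law) fact+
      moreover have "Y <+>\<^bsub>M\<^esub> (U \<inter> V) = Y"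
        using set_add_least[OF s(1) _ s(2)] set_add_upper(1)[OF s(1) submodule_Int[OF U V]] by blast
      moreover have "Y <+>\<^bsub>M\<^esub> U = U <+>\<^bsub>M\<^esub> Y"
        by (rule antisym; rule set_add_least) (use s(1) U submodule_set_add set_add_upper in auto)
      ultimately show ?thesis by simp
    qed
    have "U <+>\<^bsub>M\<^esub> W \<noteq> U <+>\<^bsub>M\<^esub> W'" using recover[OF W(1)] recover[OF W(2)] W(3) by auto
    then show "U <+>\<^bsub>M\<^esub> W \<subset> U <+>\<^bsub>M\<^esub> W'" using W(3) set_add_mono[of U U W W'] by blast
  qed
  show "len R M U (U <+>\<^bsub>M\<^esub> V) \<le> len R M (U \<inter> V) V" unfolding len_def
  proof (rule chain_length_mono_map[where \<Psi> = "\<lambda>W. W \<inter> V"])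
    fix W assume "W \<in> segment R M U (U <+>\<^bsub>M\<^esub> V)"
    then show "W \<inter> V \<in> segment R M (U \<inter> V) V" using submodule_Int V by (auto simp: segment_def)
  next
    fix W W' assume W: "W \<in> segment R M U (U <+>\<^bsub>M\<^esub> V)" "W' \<in> segment R M U (U <+>\<^bsub>M\<^esub> V)" "W \<subset> W'"
    have recover: "U <+>\<^bsub>M\<^esub> (Y \<inter> V) = Y" if Y: "Y \<in> segment R M U (U <+>\<^bsub>M\<^esub> V)" for Y
      using modular_law[OF U V, of Y] Y by (auto simp: segment_def Int_commute)
    have "W \<inter> V \<noteq> W' \<inter> V"
    proof
      assume "W \<inter> V = W' \<inter> V"
      then have "U <+>\<^bsub>M\<^esub> (W \<inter> V) = U <+>\<^bsub>M\<^esub> (W' \<inter> V)" by (rule arg_cong)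
      then have "W = W'" unfolding recover[OF W(1)] recover[OF W(2)] .
      then show False using W(3) by simp
    qed
    then show "W \<inter> V \<subset> W' \<inter> V" using W(3) by blast
  qed
qed

lemma len_refl: "submodule N R M \<Longrightarrow> len R M N N = 0"
proof -
  assume "submodule N R M"
  then have s: "segment R M N N = {N}" by (auto simp: segment_def)
  have "\<not> enat 1 \<le> len R M N N"
  proof
    assume "enat 1 \<le> len R M N N"
    then obtain f where "\<forall>i\<le>1::nat. f i \<in> {N}" "\<forall>i<1::nat. f i \<subset> f (Suc i)"
      unfolding len_def s using chain_length_ge_iff[of "{N}" 1] unfolding strict_chain_def by blast
    then show False by auto
  qed
  then show ?thesis by (cases "len R M N N") (auto simp: zero_enat_def one_enat_def)
qed

lemma len_eq_0D:
  assumes "submodule N R M" "submodule P R M" "N \<subseteq> P" "len R M N P = 0"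
  shows "N = P"
proof (rule ccontr)
  assume "N \<noteq> P"
  have seg: "N \<in> segment R M N P" "P \<in> segment R M N P" "N \<subset> P"
    using assms \<open>N \<noteq> P\<close> by (auto simp: segment_def)
  define f where "f i = (if i = (0::nat) then N else P)" for i
  have "strict_chain (segment R M N P) 1 f"
    using seg by (simp add: f_def strict_chain_def)
  then have "enat 1 \<le> len R M N P"
    unfolding len_def by (rule chain_length_ge)
  then show False using assms(4) by (simp add: zero_enat_def)
qed

text \<open>The condition says that every element of \<open>P\<close> outside \<open>N\<close> generates \<open>P\<close> together with \<open>N\<close>: the quotient
  is simple.\<close>

lemma len_covering:
  assumes N: "submodule N R M" and P: "submodule P R M" and "N \<subset> P"
    and cov: "\<And>U u. submodule U R M \<Longrightarrow> N \<subseteq> U \<Longrightarrow> U \<subseteq> P \<Longrightarrow> u \<in> U \<Longrightarrow> u \<notin> N \<Longrightarrow> P \<subseteq> U"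
  shows "len R M N P = 1"
proof -
  have s: "segment R M N P = {N, P}"
    using assms(1-3) cov by (auto simp: segment_def)
  have "\<not> enat 2 \<le> len R M N P"
  proof
    assume "enat 2 \<le> len R M N P"
    then obtain f where f: "\<forall>i\<le>2. f i \<in> {N, P}" "\<forall>i<2. f i \<subset> f (Suc i)"
      unfolding len_def s using chain_length_ge_iff[of "{N, P}" 2] unfolding strict_chain_def by blast
    have "f 0 \<subset> f 1" "f 1 \<subset> f 2" using f(2)[rule_format, of 0] f(2)[rule_format, of 1] by (auto simp: numeral_2_eq_2)
    moreover have "f 0 \<in> {N, P}" "f 1 \<in> {N, P}" "f 2 \<in> {N, P}" using f(1) by auto
    ultimately show False using \<open>N \<subset> P\<close> by auto
  qed
  moreover have "len R M N P \<noteq> 0" using len_eq_0D[OF N P] assms(3) by blast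
  ultimately show ?thesis
    by (cases "len R M N P") (auto simp: zero_enat_def one_enat_def)
qed

end

section \<open>Lengths of quotients and images\<close>

context module
begin

lemma submoduleI':
  assumes "H \<subseteq> carrier M" "\<zero>\<^bsub>M\<^esub> \<in> H"
    and "\<And>a b. a \<in> H \<Longrightarrow> b \<in> H \<Longrightarrow> a \<oplus>\<^bsub>M\<^esub> b \<in> H"
    and sm: "\<And>a u. a \<in> carrier R \<Longrightarrow> u \<in> H \<Longrightarrow> a \<odot>\<^bsub>M\<^esub> u \<in> H"
  shows "submodule H R M"
proof (rule submoduleI)
  fix a assume a: "a \<in> H"
  then have "\<ominus>\<^bsub>M\<^esub> a = (\<ominus> \<one>) \<odot>\<^bsub>M\<^esub> a" using assms(1) smult_l_minus[of \<one> a] by auto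
  then show "\<ominus>\<^bsub>M\<^esub> a \<in> H" using sm[OF _ a] by simp
qed (use assms in auto)

lemma submodule_restrict_iff:
  assumes P: "submodule P R M"
  shows "submodule U R (M\<lparr>carrier := P\<rparr>) \<longleftrightarrow> submodule U R M \<and> U \<subseteq> P"
proof -
  interpret P: module R "M\<lparr>carrier := P\<rparr>" using P submodule.submodule_is_module module_axioms by blast
  have Pc: "P \<subseteq> carrier M" using P submoduleE(1) by auto
  show ?thesis
  proof
    assume U: "submodule U R (M\<lparr>carrier := P\<rparr>)"
    have "submodule U R M"
      by (rule submoduleI') (use P.submoduleE[OF U] P.submodule_zero[OF U] Pc in auto)
    then show "submodule U R M \<and> U \<subseteq> P" using P.submoduleE(1)[OF U] by simp
  next
    assume U: "submodule U R M \<and> U \<subseteq> P"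
    then show "submodule U R (M\<lparr>carrier := P\<rparr>)"
      by (intro P.submoduleI') (use submoduleE[of U] submodule_zero[of U] in auto)
  qed
qed

end

lemma a_r_cosetI: "h \<in> H \<Longrightarrow> h \<oplus>\<^bsub>M\<^esub> u \<in> H +>\<^bsub>M\<^esub> u"
  by (auto simp: a_r_coset_def r_coset_def)

lemma a_r_cosetE:
  assumes "v \<in> H +>\<^bsub>M\<^esub> u" obtains h where "h \<in> H" "v = h \<oplus>\<^bsub>M\<^esub> u"
  using assms by (auto simp: a_r_coset_def r_coset_def)

text \<open>The submodules of \<open>M / N\<close> correspond to the submodules of \<open>M\<close> above \<open>N\<close>, by images and preimages under
the residue map. The scalar multiplication of the quotient is a union over the representatives of a
coset and has to be seen to be single-valued first.\<close>

lemma module_length_quot_module: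
  fixes M :: "('r, 'a) module"
  assumes "module R M" and N: "submodule N R M"
  shows "module_length R (quot_module M N) = len R M N (carrier M)"
proof -
  interpret module R M by fact
  let ?Q = "quot_module M N" and ?F = "add_monoid M Mod N"
  have sub_iff: "subgroup V (add_monoid ?Q) \<longleftrightarrow> subgroup V ?F" for V
    unfolding subgroup_def m_inv_def
    by (simp add: quot_module_def FactGroup_def A_RCOSETS_def set_add_def)
  have Nsub: "subgroup N (add_monoid M)" using N submodule.axioms(1) by blast
  interpret N: normal N "add_monoid M"
    using M.add.subgroup_imp_normal[OF Nsub] .
  interpret h: group_hom "add_monoid M" ?F "\<lambda>a. N +>\<^bsub>M\<^esub> a"
    using N.r_coset_hom_Mod N.factorgroup_is_group M.add.is_group
    by (intro group_hom.intro group_hom_axioms.intro) (simp_all add: a_r_coset_def)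
  note Nc = submoduleE(1)[OF N]
  have rep: "N +>\<^bsub>M\<^esub> v = N +>\<^bsub>M\<^esub> u" if "v \<in> N +>\<^bsub>M\<^esub> u" "u \<in> carrier M" for u v
    using M.add.repr_independence[of v N u] that Nsub by (simp add: a_r_coset_def)
  have self: "u \<in> N +>\<^bsub>M\<^esub> u" if "u \<in> carrier M" for u
    using M.add.rcos_self[of u N] that Nsub by (simp add: a_r_coset_def)
  have smult: "a \<odot>\<^bsub>?Q\<^esub> (N +>\<^bsub>M\<^esub> u) = N +>\<^bsub>M\<^esub> (a \<odot>\<^bsub>M\<^esub> u)"
    if a: "a \<in> carrier R" and u: "u \<in> carrier M" for a u
  proof -
    have "N +>\<^bsub>M\<^esub> (a \<odot>\<^bsub>M\<^esub> v) = N +>\<^bsub>M\<^esub> (a \<odot>\<^bsub>M\<^esub> u)" if v: "v \<in> N +>\<^bsub>M\<^esub> u" for v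
    proof -
      obtain n where n: "n \<in> N" "v = n \<oplus>\<^bsub>M\<^esub> u"
        using v by (rule a_r_cosetE)
      have "n \<in> carrier M" using n Nc by blast
      then have "a \<odot>\<^bsub>M\<^esub> v = a \<odot>\<^bsub>M\<^esub> n \<oplus>\<^bsub>M\<^esub> a \<odot>\<^bsub>M\<^esub> u"
        unfolding n(2) using a u by (intro smult_r_distr)
      then have "a \<odot>\<^bsub>M\<^esub> v \<in> N +>\<^bsub>M\<^esub> (a \<odot>\<^bsub>M\<^esub> u)"
        using a_r_cosetI[OF submoduleE(4)[OF N a n(1)]] by (simp only:)
      then show ?thesis by (rule rep) (use a u in simp)
    qed
    then have "(\<Union>v\<in>N +>\<^bsub>M\<^esub> u. N +>\<^bsub>M\<^esub> (a \<odot>\<^bsub>M\<^esub> v)) = N +>\<^bsub>M\<^esub> (a \<odot>\<^bsub>M\<^esub> u)"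
      using self[OF u] by (intro SUP_eq_const) blast+
    then show ?thesis by (simp only: quot_module_def module.select_convs)
  qed
  have carQ: "carrier ?Q = (\<lambda>u. N +>\<^bsub>M\<^esub> u) ` carrier M"
    by (auto simp: quot_module_def A_RCOSETS_def RCOSETS_def a_r_coset_def)
  define S where "S = {V. submodule V R ?Q}"
  have img: "(\<lambda>u. N +>\<^bsub>M\<^esub> u) ` U \<in> S" if "U \<in> segment R M N (carrier M)" for U
  proof -
    have U: "submodule U R M" "N \<subseteq> U" using that by (auto simp: segment_def)
    note Uc = submoduleE(1)[OF U(1)]
    have "subgroup ((\<lambda>u. N +>\<^bsub>M\<^esub> u) ` U) (add_monoid ?Q)"
      unfolding sub_iff using h.subgroup_img_is_subgroup submodule.axioms(1)[OF U(1)] by blast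
    moreover have "a \<odot>\<^bsub>?Q\<^esub> C \<in> (\<lambda>u. N +>\<^bsub>M\<^esub> u) ` U"
      if "a \<in> carrier R" "C \<in> (\<lambda>u. N +>\<^bsub>M\<^esub> u) ` U" for a C
    proof -
      from that(2) obtain u where u: "u \<in> U" "C = N +>\<^bsub>M\<^esub> u" by (rule imageE)
      then have "a \<odot>\<^bsub>?Q\<^esub> C = N +>\<^bsub>M\<^esub> (a \<odot>\<^bsub>M\<^esub> u)" using smult[OF that(1), of u] Uc by blast
      then show ?thesis using submoduleE(4)[OF U(1) that(1) u(1)] by (simp only: imageI)
    qed
    ultimately show ?thesis by (simp add: S_def submodule_def submodule_axioms_def)
  qed
  have pre: "{u \<in> carrier M. N +>\<^bsub>M\<^esub> u \<in> V} \<in> segment R M N (carrier M)" if "V \<in> S" for V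
  proof -
    have V: "subgroup V ?F" and sm: "\<And>a C. a \<in> carrier R \<Longrightarrow> C \<in> V \<Longrightarrow> a \<odot>\<^bsub>?Q\<^esub> C \<in> V"
      using that sub_iff by (auto simp: S_def submodule_def submodule_axioms_def)
    have NV: "N \<in> V" using subgroup.one_closed[OF V] by (simp add: FactGroup_def)
    have Nn: "N +>\<^bsub>M\<^esub> n = N" if "n \<in> N" for n
      using rep[of n "\<zero>\<^bsub>M\<^esub>"] that Nc M.add.coset_mult_one[of N] by (simp add: a_r_coset_def)
    have "submodule {u \<in> carrier M. N +>\<^bsub>M\<^esub> u \<in> V} R M"
    proof (rule submoduleI')
      show "\<zero>\<^bsub>M\<^esub> \<in> {u \<in> carrier M. N +>\<^bsub>M\<^esub> u \<in> V}"
        using Nn[OF submodule_zero[OF N]] NV by simp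
      fix a b assume "a \<in> {u \<in> carrier M. N +>\<^bsub>M\<^esub> u \<in> V}" "b \<in> {u \<in> carrier M. N +>\<^bsub>M\<^esub> u \<in> V}"
      then show "a \<oplus>\<^bsub>M\<^esub> b \<in> {u \<in> carrier M. N +>\<^bsub>M\<^esub> u \<in> V}"
        using h.hom_mult[of a b] subgroup.m_closed[OF V, of "N +>\<^bsub>M\<^esub> a" "N +>\<^bsub>M\<^esub> b"] by simp
    next
      fix a u assume "a \<in> carrier R" "u \<in> {u \<in> carrier M. N +>\<^bsub>M\<^esub> u \<in> V}"
      then show "a \<odot>\<^bsub>M\<^esub> u \<in> {u \<in> carrier M. N +>\<^bsub>M\<^esub> u \<in> V}"
        using sm[of a "N +>\<^bsub>M\<^esub> u"] smult[of a u] by simp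
    qed auto
    then show ?thesis using Nn NV Nc by (auto simp: segment_def)
  qed
  have "chain_length S = chain_length (segment R M N (carrier M))"
  proof (rule antisym)
    show "chain_length S \<le> chain_length (segment R M N (carrier M))"
    proof (rule chain_length_mono_map[where \<Psi> = "\<lambda>V. {u \<in> carrier M. N +>\<^bsub>M\<^esub> u \<in> V}"])
      fix V V' assume V: "V \<in> S" "V' \<in> S" "V \<subset> V'"
      then obtain C where C: "C \<in> V'" "C \<notin> V" by blast
      have "V' \<subseteq> carrier ?Q"
        using V(2) subgroup.subset by (fastforce simp: S_def submodule_def)
      then obtain u where "u \<in> carrier M" "C = N +>\<^bsub>M\<^esub> u" using C carQ by auto
      then show "{u \<in> carrier M. N +>\<^bsub>M\<^esub> u \<in> V} \<subset> {u \<in> carrier M. N +>\<^bsub>M\<^esub> u \<in> V'}"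
        using C V(3) by blast
    qed (rule pre)
    show "chain_length (segment R M N (carrier M)) \<le> chain_length S"
    proof (rule chain_length_mono_map[where \<Psi> = "\<lambda>U. (\<lambda>u. N +>\<^bsub>M\<^esub> u) ` U"])
      fix U U' assume U: "U \<in> segment R M N (carrier M)" "U' \<in> segment R M N (carrier M)" "U \<subset> U'"
      then have s: "submodule U R M" "N \<subseteq> U" "U' \<subseteq> carrier M" by (auto simp: segment_def)
      obtain u where u: "u \<in> U'" "u \<notin> U" using U(3) by blast
      have "N +>\<^bsub>M\<^esub> u \<notin> (\<lambda>u. N +>\<^bsub>M\<^esub> u) ` U"
      proof
        assume "N +>\<^bsub>M\<^esub> u \<in> (\<lambda>u. N +>\<^bsub>M\<^esub> u) ` U"
        then obtain v where v: "v \<in> U" "N +>\<^bsub>M\<^esub> u = N +>\<^bsub>M\<^esub> v" by blast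
        then have "u \<in> N +>\<^bsub>M\<^esub> v" using self[of u] u s(3) by auto
        then obtain n where n: "n \<in> N" "u = n \<oplus>\<^bsub>M\<^esub> v" by (rule a_r_cosetE)
        then have "n \<oplus>\<^bsub>M\<^esub> v \<in> U" using submoduleE(5)[OF s(1)] v(1) s(2) by blast
        then show False using n u by simp
      qed
      then show "(\<lambda>u. N +>\<^bsub>M\<^esub> u) ` U \<subset> (\<lambda>u. N +>\<^bsub>M\<^esub> u) ` U'" using U(3) u by blast
    qed (rule img)
  qed
  then show ?thesis
    unfolding module_length_def len_def S_def chain_length_def strict_chain_def by simp
qed

lemma quot_length_eq:
  fixes M :: "('r, 'a) module"
  assumes "module R M" and N: "submodule N R M" and P: "submodule P R M" and NP: "N \<subseteq> P"
  shows "quot_length R M P N = the_enat (len R M N P)"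
proof -
  interpret module R M by fact
  interpret P: module R "M\<lparr>carrier := P\<rparr>" using P submodule.submodule_is_module module_axioms by blast
  have "segment R (M\<lparr>carrier := P\<rparr>) N P = segment R M N P"
    using submodule_restrict_iff[OF P] by (auto simp: segment_def)
  then have "len R (M\<lparr>carrier := P\<rparr>) N P = len R M N P" by (simp add: len_def)
  moreover have "submodule N R (M\<lparr>carrier := P\<rparr>)" using submodule_restrict_iff[OF P] N NP by simp
  ultimately show ?thesis
    unfolding quot_length_def using module_length_quot_module[OF P.module_axioms] by simp
qed

text \<open>An injective linear map is an isomorphism onto its image; it identifies the submodules between \<open>N\<close> and
\<open>P\<close> with those between the images.\<close>

lemma len_image:
  assumes M: "module R M" and M': "module R M'"
    and f: "f \<in> carrier M \<rightarrow> carrier M'" "inj_on f (carrier M)"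
    and add: "\<And>u v. u \<in> carrier M \<Longrightarrow> v \<in> carrier M \<Longrightarrow> f (u \<oplus>\<^bsub>M\<^esub> v) = f u \<oplus>\<^bsub>M'\<^esub> f v"
    and lin: "\<And>a u. a \<in> carrier R \<Longrightarrow> u \<in> carrier M \<Longrightarrow> f (a \<odot>\<^bsub>M\<^esub> u) = a \<odot>\<^bsub>M'\<^esub> f u"
    and P: "submodule P R M" and NP: "N \<subseteq> P"
  shows "len R M' (f ` N) (f ` P) = len R M N P"
    and "\<And>U. submodule U R M \<Longrightarrow> submodule (f ` U) R M'"
proof -
  interpret M: module R M by fact
  interpret M': module R M' by fact
  have z: "f \<zero>\<^bsub>M\<^esub> = \<zero>\<^bsub>M'\<^esub>"
    using lin[of "\<zero>\<^bsub>R\<^esub>" "\<zero>\<^bsub>M\<^esub>"] f(1) M'.smult_l_null[of "f \<zero>\<^bsub>M\<^esub>"] by auto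
  show img: "submodule (f ` U) R M'" if U: "submodule U R M" for U
  proof (rule M'.submoduleI')
    note E = M.submoduleE[OF U]
    show "f ` U \<subseteq> carrier M'" using E(1) f(1) by auto
    show "\<zero>\<^bsub>M'\<^esub> \<in> f ` U" using z M.submodule_zero[OF U] by force
    fix a b assume "a \<in> f ` U" "b \<in> f ` U"
    then obtain u v where uv: "u \<in> U" "v \<in> U" "a = f u" "b = f v" by blast
    then have "a \<oplus>\<^bsub>M'\<^esub> b = f (u \<oplus>\<^bsub>M\<^esub> v)" 
      using add[OF subsetD[OF E(1) uv(1)] subsetD[OF E(1) uv(2)]] uv by simp
    then show "a \<oplus>\<^bsub>M'\<^esub> b \<in> f ` U" using uv E(5) by blast
  next
    fix a b assume a: "a \<in> carrier R" and "b \<in> f ` U"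
    then obtain u where u: "u \<in> U" "b = f u" by blast
    then have "a \<odot>\<^bsub>M'\<^esub> b = f (a \<odot>\<^bsub>M\<^esub> u)" using lin[OF a subsetD[OF M.submoduleE(1)[OF U]]] by simp
    then show "a \<odot>\<^bsub>M'\<^esub> b \<in> f ` U" using u M.submoduleE(4)[OF U a] by blast
  qed
  have pre: "{u \<in> P. f u \<in> V} \<in> segment R M N P" if "V \<in> segment R M' (f ` N) (f ` P)" "N \<subseteq> P" for V
  proof -
    have V: "submodule V R M'" "f ` N \<subseteq> V" "V \<subseteq> f ` P" using that by (auto simp: segment_def)
    note E = M'.submoduleE[OF V(1)] and EP = M.submoduleE[OF P]
    have "submodule {u \<in> P. f u \<in> V} R M"
    proof (rule M.submoduleI')
      show "\<zero>\<^bsub>M\<^esub> \<in> {u \<in> P. f u \<in> V}" using z M.submodule_zero[OF P] M'.submodule_zero[OF V(1)] by simp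
      fix a b assume "a \<in> {u \<in> P. f u \<in> V}" "b \<in> {u \<in> P. f u \<in> V}"
      then show "a \<oplus>\<^bsub>M\<^esub> b \<in> {u \<in> P. f u \<in> V}"
        using EP(5) E(5)[of "f a" "f b"] add[OF subsetD[OF EP(1)] subsetD[OF EP(1)], of a b] by simp
    next
      fix a b assume "a \<in> carrier R" "b \<in> {u \<in> P. f u \<in> V}"
      then show "a \<odot>\<^bsub>M\<^esub> b \<in> {u \<in> P. f u \<in> V}" 
        using EP(4) E(4)[of a "f b"] lin[OF _ subsetD[OF EP(1)], of a b] by simp
    qed (use EP in auto)
    then show ?thesis using V(2) that(2) by (auto simp: segment_def)
  qed
  have inj: "U = U'" if "f ` U = f ` U'" "U \<subseteq> carrier M" "U' \<subseteq> carrier M" for U U'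
    using that f(2) by (simp add: inj_on_image_eq_iff)
  show "len R M' (f ` N) (f ` P) = len R M N P"
    unfolding len_def
  proof (rule antisym)
      show "chain_length (segment R M' (f ` N) (f ` P)) \<le> chain_length (segment R M N P)"
      proof (rule chain_length_mono_map[where \<Psi> = "\<lambda>V. {u \<in> P. f u \<in> V}"])
        fix V V' assume "V \<in> segment R M' (f ` N) (f ` P)" "V' \<in> segment R M' (f ` N) (f ` P)" "V \<subset> V'"
        then show "{u \<in> P. f u \<in> V} \<subset> {u \<in> P. f u \<in> V'}" unfolding segment_def by blast
      qed (use pre NP in auto)
      show "chain_length (segment R M N P) \<le> chain_length (segment R M' (f ` N) (f ` P))"
      proof (rule chain_length_mono_map[where \<Psi> = "\<lambda>U. f ` U"])
        fix U assume "U \<in> segment R M N P"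
        then show "f ` U \<in> segment R M' (f ` N) (f ` P)" using img by (auto simp: segment_def)
      next
        fix U U' assume U: "U \<in> segment R M N P" "U' \<in> segment R M N P" "U \<subset> U'"
        then have "U \<subseteq> carrier M" "U' \<subseteq> carrier M" using M.submoduleE(1) by (auto simp: segment_def)
        then show "f ` U \<subset> f ` U'" using inj U(3) by blast
      qed
    qed
qed

lemma module_scalars_along:
  assumes "cring R" "cring S" and \<phi>: "\<phi> \<in> ring_hom R S"
  shows "module R (scalars_along \<phi> S)"
proof -
  interpret R: cring R by fact
  interpret S: cring S by fact
  show ?thesis
  proof (rule moduleI)
    show "abelian_group (scalars_along \<phi> S)"
      by (rule abelian_groupI) (auto simp: scalars_along_def S.a_ac intro: S.add.l_inv_ex)
  qed (use assms ring_hom_closed[OF \<phi>] ring_hom_mult[OF \<phi>] ring_hom_add[OF \<phi>] ring_hom_one[OF \<phi>]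
      in \<open>auto simp: scalars_along_def S.l_distr S.r_distr S.m_assoc\<close>)
qed

lemma scalars_along_simps [simp]:
  "carrier (scalars_along \<phi> S) = carrier S" "add (scalars_along \<phi> S) = add S"
  "ring.zero (scalars_along \<phi> S) = ring.zero S" "smult (scalars_along \<phi> S) a s = \<phi> a \<otimes>\<^bsub>S\<^esub> s"
  "set_add (scalars_along \<phi> S) = set_add S"
  by (auto simp: scalars_along_def set_add_def set_mult_def fun_eq_iff)

lemma (in cring) self_module: "module R (scalars_along (\<lambda>a. a) R)"
  by (rule module_scalars_along) (auto intro!: ring_hom_memI is_cring)

lemma (in cring) submodule_self_iff: "submodule U R (scalars_along (\<lambda>a. a) R) \<longleftrightarrow> ideal U R"
proof -
  interpret M: module R "scalars_along (\<lambda>a. a) R" by (rule self_module)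
  show ?thesis
  proof
    assume U: "submodule U R (scalars_along (\<lambda>a. a) R)"
    have Uc: "U \<subseteq> carrier R" using M.submoduleE(1)[OF U] by simp
    have "additive_subgroup U R"
    proof (rule additive_subgroup.intro, rule add.subgroupI)
      fix a assume a: "a \<in> U"
      have "(\<ominus> \<one>) \<otimes> a \<in> U" using M.submoduleE(4)[OF U, of "\<ominus> \<one>" a] a by simp
      then show "\<ominus> a \<in> U" using a Uc l_minus[of \<one> a] by auto
    qed (use Uc M.submodule_zero[OF U] M.submoduleE(5)[OF U] in auto)
    then show "ideal U R"
    proof (intro idealI[OF ring_axioms])
      fix a u assume "a \<in> U" "u \<in> carrier R"
      then show "u \<otimes> a \<in> U" "a \<otimes> u \<in> U"
        using M.submoduleE(4)[OF U, of u a] m_comm[of u a] Uc by auto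
    qed (auto simp: additive_subgroup.a_subgroup)
  next
    assume "ideal U R"
    then interpret U: ideal U R .
    show "submodule U R (scalars_along (\<lambda>a. a) R)"
      by (rule M.submoduleI') (auto simp: U.I_l_closed intro: U.a_Hcarr)
  qed
qed

text \<open>In a commutative ring the additive inverse and multiplication from the right come for free.\<close>

lemma (in cring) idealI_cring:
  assumes "I \<subseteq> carrier R" "\<zero> \<in> I" "\<And>a b. a \<in> I \<Longrightarrow> b \<in> I \<Longrightarrow> a \<oplus> b \<in> I"
    "\<And>c a. c \<in> carrier R \<Longrightarrow> a \<in> I \<Longrightarrow> c \<otimes> a \<in> I"
  shows "ideal I R"
proof -
  interpret M: module R "scalars_along (\<lambda>a. a) R" by (rule self_module)
  have "submodule I R (scalars_along (\<lambda>a. a) R)" by (rule M.submoduleI') (use assms in auto)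
  then show ?thesis by (simp add: submodule_self_iff)
qed

section \<open>Powers of ideals and lengths between ideals\<close>

context cring
begin

lemma ideal_subset: "ideal I R \<Longrightarrow> I \<subseteq> carrier R"
  by (simp add: additive_subgroup.a_subset ideal.axioms(1))

lemma ideal_pow_ideal:
  assumes "ideal I R" shows "ideal (ideal_pow R I n) R"
proof -
  interpret S: comm_monoid "ideals_set R" by (rule ideals_set_is_comm_monoid)
  show ?thesis using S.nat_pow_closed[of I n] assms by (simp add: ideal_pow_def ideals_set_def)
qed

lemma ideal_pow_0 [simp]: "ideal_pow R I 0 = carrier R"
  by (simp add: ideal_pow_def ideals_set_def nat_pow_def)

lemma ideal_pow_add:
  assumes "ideal I R"
  shows "ideal_pow R I (i + j) = ideal_prod R (ideal_pow R I i) (ideal_pow R I j)"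
proof -
  interpret S: comm_monoid "ideals_set R" by (rule ideals_set_is_comm_monoid)
  show ?thesis using S.nat_pow_mult[of I i j] assms by (simp add: ideal_pow_def ideals_set_def)
qed

lemma ideal_pow_1:
  assumes "ideal I R" shows "ideal_pow R I (Suc 0) = I"
proof -
  interpret S: comm_monoid "ideals_set R" by (rule ideals_set_is_comm_monoid)
  show ?thesis using S.nat_pow_eone[of I] assms by (simp add: ideal_pow_def ideals_set_def)
qed

lemma ideal_pow_Suc:
  assumes "ideal I R" shows "ideal_pow R I (Suc n) = ideal_prod R (ideal_pow R I n) I"
  using ideal_pow_add[OF assms, of n "Suc 0"] ideal_pow_1[OF assms] by simp

lemma ideal_pow_mult:
  assumes "ideal I R" "a \<in> ideal_pow R I i" "b \<in> ideal_pow R I j"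
  shows "a \<otimes> b \<in> ideal_pow R I (i + j)"
  using assms by (simp add: ideal_pow_add ideal_prod.prod)

lemma ideal_pow_antimono:
  assumes "ideal I R" "i \<le> j" shows "ideal_pow R I j \<subseteq> ideal_pow R I i"
proof -
  have "ideal_pow R I (i + (j - i)) \<subseteq> ideal_pow R I i"
    using ideal_prod_inter[OF ideal_pow_ideal ideal_pow_ideal, OF assms(1) assms(1)]
    by (subst ideal_pow_add[OF assms(1)]) blast
  then show ?thesis using assms(2) by simp
qed

lemma nat_pow_in_ideal_pow:
  assumes "ideal I R" "y \<in> I" shows "y [^] n \<in> ideal_pow R I n"
proof (induction n)
  case 0 show ?case by simp
next
  case (Suc n) then show ?case using assms(2) by (simp add: ideal_pow_Suc[OF assms(1)] ideal_prod.prod)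
qed

lemma l_cosetI: "a \<in> I \<Longrightarrow> y \<otimes> a \<in> y <# I"
  by (auto simp: l_coset_def)

lemma l_cosetE: "u \<in> y <# I \<Longrightarrow> (\<And>a. a \<in> I \<Longrightarrow> u = y \<otimes> a \<Longrightarrow> thesis) \<Longrightarrow> thesis"
  by (auto simp: l_coset_def)

lemma ideal_l_coset:
  assumes "ideal I R" "y \<in> carrier R" shows "ideal (y <# I) R"
proof -
  interpret I: ideal I R by fact
  show ?thesis
  proof (rule idealI_cring)
    show "y <# I \<subseteq> carrier R" using assms by (auto elim!: l_cosetE intro: I.a_Hcarr)
    show "\<zero> \<in> y <# I" using l_cosetI[of \<zero> I y] assms by simp
    fix a b assume "a \<in> y <# I" "b \<in> y <# I"
    then obtain c d where cd: "c \<in> I" "d \<in> I" "a = y \<otimes> c" "b = y \<otimes> d" by (auto elim!: l_cosetE)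
    then have "a \<oplus> b = y \<otimes> (c \<oplus> d)" using assms by (simp add: r_distr I.a_Hcarr)
    then show "a \<oplus> b \<in> y <# I" using l_cosetI[of "c \<oplus> d" I y] cd by simp
  next
    fix a b assume a: "a \<in> carrier R" and "b \<in> y <# I"
    then obtain c where c: "c \<in> I" "b = y \<otimes> c" by (auto elim!: l_cosetE)
    then have "a \<otimes> b = y \<otimes> (a \<otimes> c)" using assms a by (simp add: m_lcomm I.a_Hcarr)
    then show "a \<otimes> b \<in> y <# I" using l_cosetI[of "a \<otimes> c" I y] c I.I_l_closed a by simp
  qed
qed

lemma l_coset_l_coset:
  assumes "I \<subseteq> carrier R" "y \<in> carrier R" "z \<in> carrier R"
  shows "y <# (z <# I) = (y \<otimes> z) <# I"
  using assms by (fastforce simp: l_coset_def m_assoc subset_eq)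

lemma ideal_prod_l_coset:
  assumes I: "ideal I R" and J: "ideal J R" and y: "y \<in> carrier R"
  shows "ideal_prod R (y <# I) J = y <# ideal_prod R I J"
proof
  interpret I: ideal I R by fact
  interpret J: ideal J R by fact
  have c: "ideal_prod R I J \<subseteq> carrier R" by (rule ideal_prod_in_carrier[OF I J])
  show "ideal_prod R (y <# I) J \<subseteq> y <# ideal_prod R I J"
  proof
    fix u assume "u \<in> ideal_prod R (y <# I) J"
    then show "u \<in> y <# ideal_prod R I J"
    proof induction
      case (prod i j)
      then obtain a where a: "a \<in> I" "i = y \<otimes> a" by (auto elim: l_cosetE)
      have "i \<otimes> j = y \<otimes> (a \<otimes> j)" using a prod y by (simp add: m_assoc I.a_Hcarr J.a_Hcarr)
      then show ?case using l_cosetI[OF ideal_prod.prod[OF a(1) prod(2), of R], of y] by simp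
    next
      case (sum s1 s2)
      then obtain a b where ab: "a \<in> ideal_prod R I J" "b \<in> ideal_prod R I J" "s1 = y \<otimes> a" "s2 = y \<otimes> b"
        by (auto elim!: l_cosetE)
      have "s1 \<oplus> s2 = y \<otimes> (a \<oplus> b)" using ab c y by (simp add: r_distr subset_eq)
      then show ?case using l_cosetI[OF ideal_prod.sum[OF ab(1,2)], of y] by simp
    qed
  qed
  show "y <# ideal_prod R I J \<subseteq> ideal_prod R (y <# I) J"
  proof
    fix u assume "u \<in> y <# ideal_prod R I J"
    then obtain a where a: "a \<in> ideal_prod R I J" "u = y \<otimes> a" by (auto elim: l_cosetE)
    from a(1) have "y \<otimes> a \<in> ideal_prod R (y <# I) J"
    proof induction
      case (prod i j)
      have "y \<otimes> (i \<otimes> j) = (y \<otimes> i) \<otimes> j" using prod y by (simp add: m_assoc I.a_Hcarr J.a_Hcarr)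
      then show ?case using ideal_prod.prod[OF l_cosetI[OF prod(1), of y] prod(2), of R] by simp
    next
      case (sum s1 s2)
      have "y \<otimes> (s1 \<oplus> s2) = y \<otimes> s1 \<oplus> y \<otimes> s2" using sum(1,2) c y by (simp add: r_distr subset_eq)
      then show ?case using ideal_prod.sum[OF sum(3,4)] by simp
    qed
    then show "u \<in> ideal_prod R (y <# I) J" using a by simp
  qed
qed

text \<open>Multiplication by \<open>I\<close> carries the equation \<open>I\<^sup>k\<^sup>+\<^sup>1 = y I\<^sup>k\<close> from one exponent to the next.\<close>

lemma ideal_pow_reduction_mono:
  assumes "ideal I R" "y \<in> carrier R" and n: "ideal_pow R I (Suc n) = y <# ideal_pow R I n" and "n \<le> k"
  shows "ideal_pow R I (Suc k) = y <# ideal_pow R I k"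
  using \<open>n \<le> k\<close>
proof (induction k rule: dec_induct)
  case base show ?case by (rule n)
next
  case (step k)
  have "ideal_pow R I (Suc (Suc k)) = ideal_prod R (y <# ideal_pow R I k) I"
    using step.IH ideal_pow_Suc[OF assms(1), of "Suc k"] by simp
  also have "\<dots> = y <# ideal_prod R (ideal_pow R I k) I"
    by (rule ideal_prod_l_coset) (use assms ideal_pow_ideal in auto)
  finally show ?case by (simp add: ideal_pow_Suc[OF assms(1), of k])
qed

definition ilen :: "'a set \<Rightarrow> 'a set \<Rightarrow> enat" where
  "ilen N P = len R (scalars_along (\<lambda>a. a) R) N P"

lemma ilen_add:
  assumes "ideal N R" "ideal Q R" "ideal P R" "N \<subseteq> Q" "Q \<subseteq> P"
  shows "ilen N P = ilen N Q + ilen Q P"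
  unfolding ilen_def
  by (rule module.len_add[OF self_module]) (simp_all add: submodule_self_iff assms)

lemma ilen_Int:
  assumes "ideal U R" "ideal V R"
  shows "ilen (U \<inter> V) V = ilen U (U <+>\<^bsub>R\<^esub> V)"
  unfolding ilen_def
  by (rule module.len_Int_eq_len_add[OF self_module, unfolded scalars_along_simps])
    (simp_all add: submodule_self_iff assms)

lemma ilen_refl: "ideal N R \<Longrightarrow> ilen N N = 0"
  unfolding ilen_def by (rule module.len_refl[OF self_module]) (simp add: submodule_self_iff)

lemma ilen_eq_0D: "ideal N R \<Longrightarrow> ideal P R \<Longrightarrow> N \<subseteq> P \<Longrightarrow> ilen N P = 0 \<Longrightarrow> N = P"
  unfolding ilen_def by (erule (3) module.len_eq_0D[OF self_module, unfolded submodule_self_iff])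

lemma ilen_covering:
  assumes "ideal N R" "ideal P R" "N \<subset> P"
    and "\<And>U u. ideal U R \<Longrightarrow> N \<subseteq> U \<Longrightarrow> U \<subseteq> P \<Longrightarrow> u \<in> U \<Longrightarrow> u \<notin> N \<Longrightarrow> P \<subseteq> U"
  shows "ilen N P = 1"
  unfolding ilen_def
  by (rule module.len_covering[OF self_module, unfolded submodule_self_iff]) (fact assms)+

lemma ilen_l_coset:
  assumes y: "y \<in> carrier R" and nzd: "\<And>a. a \<in> carrier R \<Longrightarrow> y \<otimes> a = \<zero> \<Longrightarrow> a = \<zero>"
    and N: "ideal N R" and P: "ideal P R" and "N \<subseteq> P"
  shows "ilen (y <# N) (y <# P) = ilen N P"
proof -
  let ?M = "scalars_along (\<lambda>a. a) R"
  have "inj_on (\<lambda>a. y \<otimes> a) (carrier R)"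
  proof (rule inj_onI)
    fix a b assume ab: "a \<in> carrier R" "b \<in> carrier R" "y \<otimes> a = y \<otimes> b"
    then have "y \<otimes> (a \<ominus> b) = \<zero>" using y by (simp add: minus_eq r_distr r_minus r_neg)
    then have "a \<ominus> b = \<zero>" by (rule nzd[rotated]) (simp add: ab)
    then show "a = b" using ab r_right_minus_eq[of a b] by simp
  qed
  then have "len R ?M ((\<lambda>a. y \<otimes> a) ` N) ((\<lambda>a. y \<otimes> a) ` P) = len R ?M N P"
    by (intro len_image(1)[OF self_module self_module])
      (use assms in \<open>auto simp: r_distr m_lcomm submodule_self_iff\<close>)
  moreover have "y <# I = (\<lambda>a. y \<otimes> a) ` I" for I by (auto simp: l_coset_def)
  ultimately show ?thesis by (simp add: ilen_def)
qed

lemma quot_length_ideal: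
  assumes "ideal N R" "ideal P R" "N \<subseteq> P"
  shows "quot_length R (scalars_along (\<lambda>a. a) R) P N = the_enat (ilen N P)"
  unfolding ilen_def by (rule quot_length_eq[OF self_module]) (use assms in \<open>simp_all add: submodule_self_iff\<close>)

lemma set_add_ideal_upper:
  assumes "ideal U R" "ideal V R" shows "U \<subseteq> U <+>\<^bsub>R\<^esub> V" "V \<subseteq> U <+>\<^bsub>R\<^esub> V"
  using module.set_add_upper[OF self_module, unfolded submodule_self_iff scalars_along_simps, OF assms] .

lemma set_add_ideal_least:
  assumes "ideal W R" "U \<subseteq> W" "V \<subseteq> W" shows "U <+>\<^bsub>R\<^esub> V \<subseteq> W"
  using module.set_add_least[OF self_module, unfolded submodule_self_iff scalars_along_simps, OF assms] .

lemma ideal_diff_mem: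
  assumes "ideal U R" "a \<in> carrier R" "k \<in> U" "k \<oplus> a \<in> U" shows "a \<in> U"
proof -
  interpret ideal U R by fact
  have "a = \<ominus> k \<oplus> (k \<oplus> a)" using assms(2) a_Hcarr[OF assms(3)] by (simp add: r_neg1)
  moreover have "\<ominus> k \<oplus> (k \<oplus> a) \<in> U" using a_closed[OF a_inv_closed[OF assms(3)] assms(4)] .
  ultimately show ?thesis by simp
qed

lemma PIdl_eq_l_coset: "a \<in> carrier R \<Longrightarrow> PIdl a = a <# carrier R"
  by (auto simp: cgenideal_def l_coset_def m_comm)

end

section \<open>Local rings with a principal reduction of the maximal ideal\<close>

text \<open>The consequences of the hypotheses of the theorem on which everything else rests. That \<open>m\<close> is the only
maximal ideal enters as the invertibility of the elements outside \<open>m\<close>, and the dimension and the depth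
of the ring enter through the regularity of \<open>x\<close>.\<close>

locale reduction_ring = cring A for A (structure) +
  fixes m :: "'a set" and x :: 'a and r :: nat
  assumes noetherian: "noetherian_ring A"
    and m_max: "maximalideal m A"
    and unitsI: "a \<in> carrier A \<Longrightarrow> a \<notin> m \<Longrightarrow> a \<in> Units A"
    and x_in_m: "x \<in> m"
    and x_nzd: "a \<in> carrier A \<Longrightarrow> x \<otimes> a = \<zero> \<Longrightarrow> a = \<zero>"
    and reduction: "r \<le> n \<Longrightarrow> ideal_pow A m (Suc n) = x <# ideal_pow A m n"
begin

abbreviation pow :: "nat \<Rightarrow> 'a set" where "pow n \<equiv> ideal_pow A m n"

sublocale m: maximalideal m A by (rule m_max)

lemma m_ideal: "ideal m A" ..

lemmas pow_ideal = ideal_pow_ideal[OF m_ideal]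
lemmas pow_1 = ideal_pow_1[OF m_ideal]
lemmas pow_mult = ideal_pow_mult[OF m_ideal]
lemmas pow_antimono = ideal_pow_antimono[OF m_ideal]

lemma pow_carrier: "a \<in> pow n \<Longrightarrow> a \<in> carrier A"
  by (rule subsetD[OF ideal_subset[OF pow_ideal]])

lemma pow_Suc_subset: "pow (Suc n) \<subseteq> pow n" by (rule pow_antimono) simp

lemma m_mult_pow: "c \<in> m \<Longrightarrow> a \<in> pow n \<Longrightarrow> c \<otimes> a \<in> pow (Suc n)"
  using pow_mult[of c "Suc 0" a n] pow_1 by simp

lemma x_carrier [simp]: "x \<in> carrier A" by (rule m.Icarr[OF x_in_m])

lemma x_pow_carrier [simp]: "x [^] (k::nat) \<in> carrier A" by simp

lemma x_pow_in_pow: "x [^] k \<in> pow k"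
  by (rule nat_pow_in_ideal_pow[OF m_ideal x_in_m])

lemma x_pow_nzd: "a \<in> carrier A \<Longrightarrow> x [^] (k::nat) \<otimes> a = \<zero> \<Longrightarrow> a = \<zero>"
proof (induction k arbitrary: a)
  case (Suc k)
  then have "x [^] k \<otimes> (x \<otimes> a) = \<zero>" by (simp add: m_assoc)
  then have "x \<otimes> a = \<zero>" by (rule Suc.IH[rotated]) (simp add: Suc.prems(1))
  then show ?case by (rule x_nzd[OF Suc.prems(1)])
qed simp

lemma x_pow_cancel:
  assumes "a \<in> carrier A" "b \<in> carrier A" "x [^] (k::nat) \<otimes> a = x [^] k \<otimes> b"
  shows "a = b"
proof -
  have "x [^] k \<otimes> (a \<ominus> b) = \<zero>" using assms by (simp add: minus_eq r_distr r_minus r_neg)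
  then have "a \<ominus> b = \<zero>" by (rule x_pow_nzd[rotated]) (simp add: assms)
  then show ?thesis using assms r_right_minus_eq[of a b] by simp
qed

lemma pow_shift: "r \<le> n \<Longrightarrow> pow (n + k) = x [^] k <# pow n"
proof (induction k)
  case 0
  have "pow n \<subseteq> carrier A" by (rule ideal_subset[OF pow_ideal])
  then show ?case by (auto simp: l_coset_def subset_eq)
next
  case (Suc k)
  have "pow n \<subseteq> carrier A" by (rule ideal_subset[OF pow_ideal])
  then have "x <# (x [^] k <# pow n) = (x \<otimes> x [^] k) <# pow n" by (rule l_coset_l_coset) auto
  then show ?case using Suc reduction[of "n + k"] by (simp add: m_comm)
qed

lemma one_notin_m: "\<one> \<notin> m" using m.one_imp_carrier m.I_notcarr by auto

text \<open>The initial form of \<open>x\<close> is not nilpotent. This is what makes \<open>F(x)\<close> a polynomial ring.\<close>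

lemma x_pow_notin_pow: "x [^] k \<notin> pow (Suc k)"
proof
  assume "x [^] k \<in> pow (Suc k)"
  \<comment> \<open>then \<open>m\<^sup>r\<close> lies in all powers of \<open>m\<close>, hence \<open>x\<^sup>r \<in> x\<^sup>r\<^sup>+\<^sup>1 A\<close> and \<open>x\<close> is a unit\<close>
  have stable: "pow r \<subseteq> pow (Suc r)"
  proof
    fix a assume a: "a \<in> pow r"
    have "x [^] k \<otimes> a \<in> pow (Suc k + r)" by (rule pow_mult) fact+
    also have "Suc k + r = Suc r + k" by simp
    finally have "x [^] k \<otimes> a \<in> x [^] k <# pow (Suc r)" using pow_shift[of "Suc r" k] by simp
    then obtain b where "b \<in> pow (Suc r)" "x [^] k \<otimes> a = x [^] k \<otimes> b" by (rule l_cosetE)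
    then show "a \<in> pow (Suc r)" using x_pow_cancel a pow_carrier by metis
  qed
  have "pow r \<subseteq> pow (r + j)" for j
  proof (induction j)
    case (Suc j)
    have "pow (r + j) \<subseteq> pow (r + Suc j)"
      using stable pow_shift[of r j] pow_shift[of "Suc r" j] by (auto simp: l_coset_def)
    then show ?case using Suc by blast
  qed simp
  then have "x [^] r \<in> pow (r + Suc r)" using x_pow_in_pow by blast
  then have "x [^] r \<in> x [^] Suc r <# pow r" by (simp only: pow_shift[OF order_refl])
  then obtain c where c: "c \<in> pow r" "x [^] r = x [^] Suc r \<otimes> c" by (rule l_cosetE)
  then have "x [^] r \<otimes> \<one> = x [^] r \<otimes> (x \<otimes> c)" using pow_carrier by (simp add: m_assoc)
  then have "\<one> = x \<otimes> c" using x_pow_cancel pow_carrier c by (metis m_closed one_closed x_carrier)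
  then show False using one_notin_m m.I_r_closed[OF x_in_m] pow_carrier c by metis
qed

lemma x_pow_mult_in_powD:
  assumes "a \<in> carrier A" "x [^] k \<otimes> a \<in> pow (Suc k)" shows "a \<in> m"
proof (rule ccontr)
  assume "a \<notin> m"
  then have "a \<in> Units A" using assms unitsI by blast
  then have "x [^] k = (x [^] k \<otimes> a) \<otimes> inv a" using assms by (simp add: m_assoc)
  also have "\<dots> \<in> pow (Suc k)"
    using ideal.I_r_closed[OF pow_ideal assms(2)] \<open>a \<in> Units A\<close> by simp
  finally show False using x_pow_notin_pow by blast
qed

text \<open>The added element is killed by \<open>m\<close> modulo \<open>K\<close>, so modulo \<open>K\<close> it spans zero or a copy of the
residue field. Together with the next lemma this bounds \<open>\<lambda>(m\<^sup>n/m\<^sup>n\<^sup>+\<^sup>1)\<close> by the number of generators of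
\<open>m\<^sup>n\<close>.\<close>

lemma ilen_add_principal_le:
  assumes K: "ideal K A" and s: "s \<in> carrier A" and ms: "\<And>c. c \<in> m \<Longrightarrow> c \<otimes> s \<in> K"
  shows "ilen K (K <+>\<^bsub>A\<^esub> PIdl s) \<le> 1"
proof (cases "s \<in> K")
  case True
  then have "K <+>\<^bsub>A\<^esub> PIdl s = K"
    using set_add_ideal_least[OF K _ cgenideal_minimal[OF K]] set_add_ideal_upper(1)[OF K cgenideal_ideal[OF s]] by blast
  then show ?thesis using ilen_refl[OF K] by simp
next
  case False
  have P: "ideal (K <+>\<^bsub>A\<^esub> PIdl s) A" by (rule add_ideals[OF K cgenideal_ideal[OF s]])
  have "s \<in> K <+>\<^bsub>A\<^esub> PIdl s"
    using set_add_ideal_upper(2)[OF K cgenideal_ideal[OF s]] cgenideal_self[OF s] by blast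
  moreover have "K \<subseteq> K <+>\<^bsub>A\<^esub> PIdl s" by (rule set_add_ideal_upper(1)[OF K cgenideal_ideal[OF s]])
  ultimately have "K \<subset> K <+>\<^bsub>A\<^esub> PIdl s" using False by blast
  then have "ilen K (K <+>\<^bsub>A\<^esub> PIdl s) = 1"
  proof (rule ilen_covering[OF K P])
    fix U u assume U: "ideal U A" "K \<subseteq> U" "U \<subseteq> K <+>\<^bsub>A\<^esub> PIdl s" and u: "u \<in> U" "u \<notin> K"
    then obtain k p where kp: "k \<in> K" "p \<in> PIdl s" "u = k \<oplus> p" unfolding set_add_def' by blast
    \<comment> \<open>as \<open>u\<close> is not in \<open>K\<close>, the coefficient \<open>a\<close> of \<open>s\<close> is a unit\<close>
    then obtain a where a: "a \<in> carrier A" "p = a \<otimes> s" unfolding cgenideal_def by blast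
    have "a \<notin> m" using ms[of a] kp a u(2) additive_subgroup.a_closed[OF ideal.axioms(1)[OF K]] by metis
    then have unit: "a \<in> Units A" using a unitsI by blast
    have "a \<otimes> s \<in> U" using ideal_diff_mem[OF U(1) _ _ u(1)[unfolded kp(3) a(2)]] kp(1) U(2) a s by auto
    then have "inv a \<otimes> (a \<otimes> s) \<in> U" using ideal.I_l_closed[OF U(1)] unit by simp
    then have "s \<in> U" using unit s a by (simp add: m_assoc[symmetric])
    then show "K <+>\<^bsub>A\<^esub> PIdl s \<subseteq> U" using set_add_ideal_least[OF U(1,2) cgenideal_minimal[OF U(1)]] by blast
  qed
  then show ?thesis by simp
qed

lemma ilen_add_generated_le:
  assumes "finite S" and J: "ideal J A" and S: "S \<subseteq> carrier A"
    and mS: "\<And>c s. c \<in> m \<Longrightarrow> s \<in> S \<Longrightarrow> c \<otimes> s \<in> J"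
  shows "ilen J (Idl (J \<union> S)) \<le> enat (card S)"
  using assms(1) S mS
proof (induction S rule: finite_induct)
  case empty
  have "Idl J = J" using genideal_minimal[OF J order_refl] genideal_self[OF ideal_subset[OF J]] by blast
  then show ?case using ilen_refl[OF J] by simp
next
  case (insert s S)
  have Jc: "J \<subseteq> carrier A" by (rule ideal_subset[OF J])
  let ?K = "Idl (J \<union> S)"
  have JS: "J \<union> S \<subseteq> carrier A" and s: "s \<in> carrier A" using Jc insert.prems by auto
  have K: "ideal ?K A" by (rule genideal_ideal[OF JS])
  have JK: "J \<union> S \<subseteq> ?K" by (rule genideal_self[OF JS])
  have P: "ideal (?K <+>\<^bsub>A\<^esub> PIdl s) A" by (rule add_ideals[OF K cgenideal_ideal[OF s]])
  note up = set_add_ideal_upper[OF K cgenideal_ideal[OF s]]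
  have eq: "Idl (J \<union> insert s S) = ?K <+>\<^bsub>A\<^esub> PIdl s"
  proof
    show "Idl (J \<union> insert s S) \<subseteq> ?K <+>\<^bsub>A\<^esub> PIdl s"
      by (rule genideal_minimal[OF P]) (use up JK cgenideal_self[OF s] in blast)
    have sub: "J \<union> insert s S \<subseteq> Idl (J \<union> insert s S)" by (rule genideal_self) (use JS s in auto)
    have L: "ideal (Idl (J \<union> insert s S)) A" by (rule genideal_ideal) (use JS s in auto)
    show "?K <+>\<^bsub>A\<^esub> PIdl s \<subseteq> Idl (J \<union> insert s S)"
      by (rule set_add_ideal_least[OF L genideal_minimal[OF L] cgenideal_minimal[OF L]]) (use sub in auto)
  qed
  have "ilen J (Idl (J \<union> insert s S)) = ilen J ?K + ilen ?K (?K <+>\<^bsub>A\<^esub> PIdl s)"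
    unfolding eq by (rule ilen_add) (use J K P JK up in auto)
  also have "\<dots> \<le> enat (card S) + 1"
    using insert.IH insert.prems ilen_add_principal_le[OF K s] JK by (intro add_mono) auto
  also have "\<dots> = enat (card (insert s S))" using insert.hyps by (simp add: one_enat_def)
  finally show ?case .
qed

lemma ilen_pow_Suc_finite: "ilen (pow (Suc n)) (pow n) \<noteq> \<infinity>"
proof -
  obtain S where S: "S \<subseteq> carrier A" "finite S" "pow n = Idl S"
    using noetherian_ring.finetely_gen[OF noetherian pow_ideal] by metis
  have Sn: "S \<subseteq> pow n" using genideal_self[OF S(1)] S(3) by simp
  have sub: "pow (Suc n) \<union> S \<subseteq> carrier A" using ideal_subset[OF pow_ideal] S(1) by simp
  have "Idl (pow (Suc n) \<union> S) = pow n"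
  proof
    show "Idl (pow (Suc n) \<union> S) \<subseteq> pow n"
      by (rule genideal_minimal[OF pow_ideal]) (use Sn pow_Suc_subset in blast)
    show "pow n \<subseteq> Idl (pow (Suc n) \<union> S)"
      unfolding S(3) by (rule genideal_minimal[OF genideal_ideal[OF sub]]) (use genideal_self[OF sub] in blast)
  qed
  moreover have "ilen (pow (Suc n)) (Idl (pow (Suc n) \<union> S)) \<le> enat (card S)"
    by (rule ilen_add_generated_le[OF S(2) pow_ideal S(1)]) (rule m_mult_pow, use Sn in auto)
  ultimately have "ilen (pow (Suc n)) (pow n) \<le> enat (card S)" by (simp only:)
  then show ?thesis by (cases "ilen (pow (Suc n)) (pow n)") simp_all
qed

lemma ilen_pow_finite: "ilen (pow n) (carrier A) \<noteq> \<infinity>"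
proof (induction n)
  case 0 then show ?case using ilen_refl[OF oneideal] by simp
next
  case (Suc n)
  have "ilen (pow (Suc n)) (carrier A) = ilen (pow (Suc n)) (pow n) + ilen (pow n) (carrier A)"
    by (rule ilen_add) (use pow_ideal oneideal pow_Suc_subset pow_carrier in auto)
  then show ?case using Suc ilen_pow_Suc_finite by (metis plus_eq_infty_iff_enat)
qed

text \<open>Ideals that contain a power of \<open>m\<close>, that is, ideals of finite colength.\<close>

definition cofinite_ideal :: "'a set \<Rightarrow> bool" where
  "cofinite_ideal N \<longleftrightarrow> ideal N A \<and> (\<exists>k. pow k \<subseteq> N)"

lemma cofinite_idealD: "cofinite_ideal N \<Longrightarrow> ideal N A" by (simp add: cofinite_ideal_def)

lemma ilen_finite:
  assumes N: "cofinite_ideal N" and P: "ideal P A" and NP: "N \<subseteq> P"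
  shows "ilen N P \<noteq> \<infinity>"
proof -
  obtain k where k: "ideal N A" "pow k \<subseteq> N" using N by (auto simp: cofinite_ideal_def)
  have Pc: "P \<subseteq> carrier A" by (rule ideal_subset[OF P])
  have "ilen (pow k) (carrier A) = ilen (pow k) N + ilen N (carrier A)"
    by (rule ilen_add) (use pow_ideal oneideal k NP Pc in auto)
  moreover have "ilen N (carrier A) = ilen N P + ilen P (carrier A)"
    by (rule ilen_add) (use P oneideal k NP Pc in auto)
  ultimately show ?thesis using ilen_pow_finite[of k] by (metis plus_eq_infty_iff_enat)
qed

text \<open>A natural number for subtraction and multiplication; it is the true length if \<open>N\<close> has finite colength.\<close>

definition ell :: "'a set \<Rightarrow> 'a set \<Rightarrow> nat" where
  "ell N P = the_enat (ilen N P)"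

lemma enat_ell:
  "cofinite_ideal N \<Longrightarrow> ideal P A \<Longrightarrow> N \<subseteq> P \<Longrightarrow> enat (ell N P) = ilen N P"
  using ilen_finite[of N P] unfolding ell_def by (cases "ilen N P") simp_all

lemma cofinite_mono: "cofinite_ideal N \<Longrightarrow> N \<subseteq> P \<Longrightarrow> ideal P A \<Longrightarrow> cofinite_ideal P"
  unfolding cofinite_ideal_def by blast

lemma cofinite_pow: "cofinite_ideal (pow n)"
  unfolding cofinite_ideal_def using pow_ideal[of n] by auto

lemma ell_add:
  assumes "cofinite_ideal N" "ideal Q A" "ideal P A" "N \<subseteq> Q" "Q \<subseteq> P"
  shows "ell N P = ell N Q + ell Q P"
proof -
  have "enat (ell N P) = enat (ell N Q) + enat (ell Q P)"
    using ilen_add[OF cofinite_idealD[OF assms(1)] assms(2-5)] enat_ell assms cofinite_mono by auto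
  then show ?thesis by simp
qed

lemma ell_refl: "ideal N A \<Longrightarrow> ell N N = 0"
  by (simp add: ell_def ilen_refl zero_enat_def)

lemma ell_eq_0D:
  assumes "cofinite_ideal N" "ideal P A" "N \<subseteq> P" "ell N P = 0" shows "N = P"
proof -
  have "ilen N P = 0" using enat_ell[OF assms(1-3)] assms(4) by (simp add: zero_enat_def)
  then show ?thesis using ilen_eq_0D[OF cofinite_idealD[OF assms(1)] assms(2,3)] by simp
qed

lemma ell_Int: "ideal U A \<Longrightarrow> ideal V A \<Longrightarrow> ell (U \<inter> V) V = ell U (U <+>\<^bsub>A\<^esub> V)"
  by (simp add: ell_def ilen_Int)

text \<open>Since \<open>x\<close> is a nonzerodivisor, multiplication by a power of \<open>x\<close> is an isomorphism onto its image.\<close>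

lemma ell_x_pow:
  "ideal N A \<Longrightarrow> ideal P A \<Longrightarrow> N \<subseteq> P \<Longrightarrow> ell (x [^] (k::nat) <# N) (x [^] k <# P) = ell N P"
  unfolding ell_def by (subst ilen_l_coset) (auto intro: x_pow_nzd)

text \<open>The ideal \<open>J : x\<^sup>k\<close>.\<close>

definition colon :: "'a set \<Rightarrow> nat \<Rightarrow> 'a set" where
  "colon J k = {a \<in> carrier A. x [^] k \<otimes> a \<in> J}"

lemma colon_ideal:
  assumes "ideal J A" shows "ideal (colon J k) A"
proof -
  interpret J: ideal J A by fact
  show ?thesis by (rule idealI_cring) (auto simp: colon_def r_distr m_lcomm J.I_l_closed)
qed

lemma cofinite_x_pow: "cofinite_ideal (x [^] (k::nat) <# carrier A)"
proof -
  have "pow (r + k) \<subseteq> x [^] k <# carrier A"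
    using pow_shift[of r k] pow_carrier by (auto simp: l_coset_def)
  then show ?thesis unfolding cofinite_ideal_def using ideal_l_coset[OF oneideal] by auto
qed

text \<open>Multiplication by \<open>x\<^sup>k\<close> induces an isomorphism of \<open>A / (J : x\<^sup>k)\<close> with \<open>(J + x\<^sup>k A) / J\<close>. All
  invariants are computed from this equation for powers \<open>J\<close> of \<open>m\<close>.\<close>

lemma ell_add_x_pow:
  assumes J: "cofinite_ideal J"
  shows "ell (J <+>\<^bsub>A\<^esub> (x [^] k <# carrier A)) (carrier A) + ell (colon J k) (carrier A) = ell J (carrier A)"
proof -
  let ?X = "x [^] k <# carrier A"
  note Ji = cofinite_idealD[OF J]
  have X: "ideal ?X A" by (rule cofinite_idealD[OF cofinite_x_pow])
  have JX: "ideal (J <+>\<^bsub>A\<^esub> ?X) A" by (rule add_ideals[OF Ji X])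
  have JXc: "J <+>\<^bsub>A\<^esub> ?X \<subseteq> carrier A" by (rule ideal_subset[OF JX])
  have "x [^] k <# colon J k = J \<inter> ?X"
    by (auto simp: colon_def l_coset_def)
  then have "ell J (J <+>\<^bsub>A\<^esub> ?X) = ell (x [^] k <# colon J k) ?X" using ell_Int[OF Ji X] by simp
  also have "\<dots> = ell (colon J k) (carrier A)"
    by (rule ell_x_pow) (use colon_ideal[OF Ji] oneideal in \<open>auto simp: colon_def\<close>)
  finally have "ell J (J <+>\<^bsub>A\<^esub> ?X) = ell (colon J k) (carrier A)" .
  moreover have "ell J (carrier A) = ell J (J <+>\<^bsub>A\<^esub> ?X) + ell (J <+>\<^bsub>A\<^esub> ?X) (carrier A)"
    by (rule ell_add[OF J JX oneideal set_add_ideal_upper(1)[OF Ji X] JXc])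
  ultimately show ?thesis by simp
qed

text \<open>The Hilbert function of the tangent cone.\<close>

abbreviation hilb :: "nat \<Rightarrow> nat" where "hilb n \<equiv> ell (pow (Suc n)) (pow n)"

lemma ell_pow_Suc: "ell (pow (Suc n)) (carrier A) = hilb n + ell (pow n) (carrier A)"
  by (rule ell_add) (use cofinite_pow pow_ideal oneideal pow_Suc_subset pow_carrier in auto)

lemma ell_pow_eq_sum: "ell (pow n) (carrier A) = (\<Sum>i<n. hilb i)"
  by (induction n) (use ell_pow_Suc ell_refl[OF oneideal] in auto)

lemma hilb_const: "r \<le> n \<Longrightarrow> hilb n = hilb r"
proof (induction n rule: dec_induct)
  case (step n)
  have "hilb (Suc n) = ell (x [^] (Suc 0) <# pow (Suc n)) (x [^] (Suc 0) <# pow n)"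
    using reduction[of n] reduction[of "Suc n"] step by simp
  also have "\<dots> = hilb n" by (rule ell_x_pow) (use pow_ideal pow_Suc_subset in auto)
  finally show ?case using step by simp
qed simp

text \<open>The multiplicity: \<open>m\<^sup>r\<^sup>+\<^sup>1 = x m\<^sup>r\<close> has colength \<open>\<lambda>(A/xA) + \<lambda>(xA/x m\<^sup>r) = \<lambda>(A/xA) + \<lambda>(A/m\<^sup>r)\<close>.\<close>

lemma ell_x: "ell (x <# carrier A) (carrier A) = hilb r"
proof -
  have X: "ideal (x <# carrier A) A" by (rule ideal_l_coset[OF oneideal]) simp
  have c: "pow (Suc r) \<subseteq> x <# carrier A" using reduction[of r] pow_carrier by (auto simp: l_coset_def)
  have "ell (pow (Suc r)) (carrier A) = ell (pow (Suc r)) (x <# carrier A) + ell (x <# carrier A) (carrier A)"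
    by (rule ell_add[OF cofinite_pow X oneideal c]) (rule ideal_subset[OF X])
  moreover have "ell (pow (Suc r)) (x <# carrier A) = ell (pow r) (carrier A)"
    using ell_x_pow[of "pow r" "carrier A" "Suc 0"] pow_ideal oneideal reduction[of r] pow_carrier
    by (simp add: subset_eq)
  ultimately show ?thesis using ell_pow_Suc[of r] by simp
qed

lemma ell_x_pow_carrier: "ell (x [^] (k::nat) <# carrier A) (carrier A) = k * hilb r"
proof (induction k)
  case 0
  have "\<one> <# carrier A = carrier A" by (auto simp: l_coset_def)
  then show ?case using ell_refl[OF oneideal] by simp
next
  case (Suc k)
  have X: "ideal (x <# carrier A) A" by (rule ideal_l_coset[OF oneideal]) simp
  have Xk: "ideal (x [^] k <# carrier A) A" by (rule ideal_l_coset[OF oneideal]) simp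
  have eq: "x <# (x [^] k <# carrier A) = x [^] Suc k <# carrier A"
    by (subst l_coset_l_coset) (auto simp: m_comm)
  have c: "x [^] k <# carrier A \<subseteq> carrier A" by (rule ideal_subset[OF Xk])
  have sub: "x [^] Suc k <# carrier A \<subseteq> x <# carrier A"
    unfolding eq[symmetric] using c by (auto elim!: l_cosetE intro!: l_cosetI)
  have "ell (x [^] Suc k <# carrier A) (carrier A)
      = ell (x [^] Suc k <# carrier A) (x <# carrier A) + ell (x <# carrier A) (carrier A)"
    by (rule ell_add[OF cofinite_x_pow X oneideal sub]) (rule ideal_subset[OF X])
  moreover have "ell (x [^] Suc k <# carrier A) (x <# carrier A) = ell (x [^] k <# carrier A) (carrier A)"
    unfolding eq[symmetric]
    using ell_x_pow[OF Xk oneideal c, of "Suc 0"] by simp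
  ultimately show ?case using Suc ell_x by simp
qed

end

section \<open>Regularity of the initial form\<close>

context reduction_ring
begin

lemma colon_of_large: "r \<le> n \<Longrightarrow> colon (pow (Suc n)) (Suc 0) = pow n"
proof (rule antisym)
  assume "r \<le> n"
  show "colon (pow (Suc n)) (Suc 0) \<subseteq> pow n"
  proof
    fix a assume "a \<in> colon (pow (Suc n)) (Suc 0)"
    then have a: "a \<in> carrier A" "x \<otimes> a \<in> x <# pow n"
      using reduction[OF \<open>r \<le> n\<close>] by (auto simp: colon_def)
    from a(2) obtain b where b: "b \<in> pow n" "x \<otimes> a = x \<otimes> b" by (rule l_cosetE)
    then have "a = b" using x_pow_cancel[of a b "Suc 0"] a(1) pow_carrier by simp
    then show "a \<in> pow n" using b by simp
  qed
  show "pow n \<subseteq> colon (pow (Suc n)) (Suc 0)"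
    using m_mult_pow[OF x_in_m] pow_carrier by (auto simp: colon_def)
qed

lemma pow_subset_colon: "pow n \<subseteq> colon (pow (n + k)) k"
proof
  fix a assume a: "a \<in> pow n"
  have "x [^] k \<otimes> a \<in> pow (k + n)" by (rule pow_mult[OF x_pow_in_pow a])
  then show "a \<in> colon (pow (n + k)) k" using pow_carrier[OF a] by (simp add: colon_def add.commute)
qed

text \<open>Regularity of the initial form of \<open>x\<close> on the tangent cone, in terms of the powers of \<open>m\<close>. The lemma
  \<open>regular_initial_form_iff\<close> below gives the meaning in the tangent cone.\<close>

definition regular_initial_form :: bool where
  "regular_initial_form \<longleftrightarrow> (\<forall>n. colon (pow (Suc n)) (Suc 0) = pow n)"

lemma regular_initial_formI:
  assumes "\<And>n. n < r \<Longrightarrow> ell (pow n) (colon (pow (Suc n)) (Suc 0)) = 0"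
  shows regular_initial_form
  unfolding regular_initial_form_def
proof
  fix n
  show "colon (pow (Suc n)) (Suc 0) = pow n"
  proof (cases "r \<le> n")
    case False
    then have "ell (pow n) (colon (pow (Suc n)) (Suc 0)) = 0" using assms by simp
    then have "pow n = colon (pow (Suc n)) (Suc 0)"
      using ell_eq_0D[OF cofinite_pow colon_ideal[OF pow_ideal]] pow_subset_colon[of n "Suc 0"] by simp
    then show ?thesis by simp
  qed (rule colon_of_large)
qed

lemma regular_colon_pow:
  assumes regular_initial_form shows "colon (pow (n + k)) k = pow n"
proof (induction k)
  case 0 show ?case using pow_carrier by (auto simp: colon_def)
next
  case (Suc k)
  have "colon (pow (n + Suc k)) (Suc k) \<subseteq> pow n"
  proof
    fix a assume "a \<in> colon (pow (n + Suc k)) (Suc k)"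
    then have a: "a \<in> carrier A" "x [^] k \<otimes> x \<otimes> a \<in> pow (Suc (n + k))" by (auto simp: colon_def)
    then have "x [^] k \<otimes> a \<in> colon (pow (Suc (n + k))) (Suc 0)"
      by (simp add: colon_def m_assoc m_lcomm)
    then have "x [^] k \<otimes> a \<in> pow (n + k)" using assms by (simp add: regular_initial_form_def)
    then show "a \<in> pow n" using Suc a(1) by (auto simp: colon_def)
  qed
  then show ?case using pow_subset_colon[of n "Suc k"] by blast
qed

section \<open>The Apery invariants\<close>

abbreviation pow_x :: "nat \<Rightarrow> nat \<Rightarrow> 'a set" where
  "pow_x n k \<equiv> pow n <+>\<^bsub>A\<^esub> (x [^] k <# carrier A)"

lemma pow_x_ideal: "ideal (pow_x n k) A"
  by (rule add_ideals[OF pow_ideal ideal_l_coset[OF oneideal]]) simp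

lemma cofinite_pow_x: "cofinite_ideal (pow_x n k)"
  by (rule cofinite_mono[OF cofinite_pow set_add_ideal_upper(1)[OF pow_ideal ideal_l_coset[OF oneideal x_pow_carrier]] pow_x_ideal])

lemma pow_x_Suc_subset: "pow_x (Suc n) k \<subseteq> pow_x n k"
  using module.set_add_mono[OF self_module, unfolded scalars_along_simps, OF pow_Suc_subset order_refl] .

text \<open>For \<open>k = 1\<close> the differences of consecutive values are the Apery invariants. For \<open>k = r\<close> and \<open>n \<ge> r\<close> they are
the lengths in the definition of the micro-invariants.\<close>

definition colen :: "nat \<Rightarrow> nat \<Rightarrow> nat" where
  "colen k n = ell (pow_x n k) (carrier A)"

lemma colen_Suc:
  "colen k (Suc n) = ell (pow_x (Suc n) k) (pow_x n k) + colen k n"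
  unfolding colen_def
  by (rule ell_add[OF cofinite_pow_x pow_x_ideal oneideal pow_x_Suc_subset ideal_subset[OF pow_x_ideal]])

lemma colen_eq: "colen k n + ell (colon (pow n) k) (carrier A) = ell (pow n) (carrier A)"
  unfolding colen_def by (rule ell_add_x_pow[OF cofinite_pow])

lemma apery_invariant_eq: "apery_invariant A m x n + colen (Suc 0) n = colen (Suc 0) (Suc n)"
proof -
  have "apery_invariant A m x n = ell (pow_x (Suc n) (Suc 0)) (pow_x n (Suc 0))"
    unfolding apery_invariant_def ell_def
    using quot_length_ideal[OF pow_x_ideal pow_x_ideal pow_x_Suc_subset, of n "Suc 0"] by (simp add: PIdl_eq_l_coset)
  then show ?thesis using colen_Suc[of "Suc 0" n] by simp
qed

lemma colen_0: "colen k 0 = 0"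
proof -
  have "pow_x 0 k = carrier A"
    using set_add_ideal_upper(1)[OF pow_ideal ideal_l_coset[OF oneideal x_pow_carrier], of 0 k]
      ideal_subset[OF pow_x_ideal, of 0 k] by simp
  then show ?thesis unfolding colen_def by (simp only: ell_refl[OF oneideal])
qed

lemma sum_apery_eq_colen: "(\<Sum>i\<le>n. apery_invariant A m x i) = colen (Suc 0) (Suc n)"
proof (induction n)
  case 0 show ?case using apery_invariant_eq[of 0] colen_0 by simp
next
  case (Suc n) then show ?case using apery_invariant_eq[of "Suc n"] by simp
qed

text \<open>The sum telescopes to \<open>\<lambda>(A/(m\<^sup>n\<^sup>+\<^sup>1 + xA)) = \<lambda>(A/m\<^sup>n\<^sup>+\<^sup>1) - \<lambda>(A/(m\<^sup>n\<^sup>+\<^sup>1 : x))\<close>. The second summand on the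
right vanishes exactly if \<open>m\<^sup>n\<^sup>+\<^sup>1 : x = m\<^sup>n\<close>.\<close>

theorem sum_apery_invariants:
  "(\<Sum>i\<le>n. apery_invariant A m x i) = hilb n + ell (pow n) (colon (pow (Suc n)) (Suc 0))"
proof -
  let ?C = "colon (pow (Suc n)) (Suc 0)"
  have "ell (pow n) (carrier A) = ell (pow n) ?C + ell ?C (carrier A)"
    using pow_subset_colon[of n "Suc 0"]
    by (intro ell_add[OF cofinite_pow colon_ideal[OF pow_ideal] oneideal _ ideal_subset[OF colon_ideal[OF pow_ideal]]]) simp
  then show ?thesis
    using sum_apery_eq_colen[of n] colen_eq[of "Suc 0" "Suc n"] ell_pow_Suc[of n] by simp
qed

section \<open>Lengths for the micro-invariants\<close>

text \<open>The length of \<open>(A + m\<^sup>i A') / (A + m\<^sup>i\<^sup>+\<^sup>1 A')\<close>, transported to \<open>A\<close> by multiplication with \<open>x\<^sup>r\<close>; see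
\<open>micro_quot_length\<close>.\<close>

definition micro_len :: "nat \<Rightarrow> nat" where
  "micro_len i = ell (pow_x (Suc (r + i)) r) (pow_x (r + i) r)"

lemma micro_len_colen: "colen r (Suc (r + i)) = micro_len i + colen r (r + i)"
  unfolding micro_len_def by (rule colen_Suc)

lemma sum_micro_len: "colen r (r + n) = (\<Sum>i<n. micro_len i) + colen r r"
  by (induction n) (use micro_len_colen in auto)

lemma ell_m: "ell m (carrier A) = Suc 0"
proof -
  have "ilen m (carrier A) = 1"
  proof (rule ilen_covering[OF m_ideal oneideal])
    show "m \<subset> carrier A" using ideal_subset[OF m_ideal] m.I_notcarr by blast
    fix U u assume U: "ideal U A" "m \<subseteq> U" "U \<subseteq> carrier A" "u \<in> U" "u \<notin> m"
    then have "U = m \<or> U = carrier A" using m.I_maximal[OF U(1-3)] by blast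
    then show "carrier A \<subseteq> U" using U by blast
  qed
  then show ?thesis by (simp add: ell_def one_enat_def)
qed

lemma x_pow_l_coset_subset: "x [^] n <# carrier A \<subseteq> pow n"
  using ideal.I_r_closed[OF pow_ideal x_pow_in_pow] by (auto elim!: l_cosetE)

lemma colen_r_r: "colen r r = ell (pow r) (carrier A)"
proof -
  have "pow_x r r = pow r"
    using set_add_ideal_least[OF pow_ideal order_refl x_pow_l_coset_subset] set_add_ideal_upper(1)[OF pow_ideal ideal_l_coset[OF oneideal x_pow_carrier]]
    by (rule subset_antisym)
  then show ?thesis by (simp add: colen_def)
qed

text \<open>This is where \<open>\<beta>\<^sub>0 = 1\<close> fits in: \<open>m\<^sup>r\<^sup>+\<^sup>1 : x\<^sup>r = m\<close>, as no unit multiple of \<open>x\<^sup>r\<close> lies in \<open>m\<^sup>r\<^sup>+\<^sup>1\<close>.\<close>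

lemma micro_len_0: "Suc (micro_len 0) = hilb r"
proof -
  have "colon (pow (Suc r)) r = m"
  proof
    show "colon (pow (Suc r)) r \<subseteq> m" using x_pow_mult_in_powD by (auto simp: colon_def)
    show "m \<subseteq> colon (pow (Suc r)) r"
      using m_mult_pow[OF _ x_pow_in_pow] m.Icarr m_comm by (auto simp: colon_def)
  qed
  then show ?thesis
    using colen_eq[of r "Suc r"] ell_m ell_pow_Suc[of r] colen_r_r micro_len_colen[of 0] by simp
qed

lemma colen_r_2r: "colen r (r + r) = r * hilb r"
proof -
  have X: "ideal (x [^] r <# carrier A) A" by (rule ideal_l_coset[OF oneideal]) simp
  have "pow (r + r) \<subseteq> x [^] r <# carrier A"
    using pow_shift[of r r] pow_carrier by (auto elim!: l_cosetE intro!: l_cosetI)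
  then have "pow_x (r + r) r = (x [^] r <# carrier A)"
    using set_add_ideal_least[OF X _ order_refl] set_add_ideal_upper(2)[OF pow_ideal X] by blast
  then show ?thesis by (simp add: colen_def ell_x_pow_carrier)
qed

text \<open>The lengths add up to \<open>\<lambda>(A/(m\<^sup>2\<^sup>r + x\<^sup>r A)) - \<lambda>(A/(m\<^sup>r + x\<^sup>r A))\<close>. Here \<open>m\<^sup>2\<^sup>r = x\<^sup>r m\<^sup>r\<close> is contained in
\<open>x\<^sup>r A\<close>, which is contained in \<open>m\<^sup>r\<close>, and \<open>\<lambda>(A/x\<^sup>r A)\<close> is \<open>r\<close> times the multiplicity.\<close>

lemma sum_sum_micro: "(\<Sum>i<r. int (hilb r) - int (micro_len i)) = (\<Sum>i<r. int (hilb i))"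
proof -
  have "(\<Sum>i<r. micro_len i) + (\<Sum>i<r. hilb i) = r * hilb r"
    using sum_micro_len[of r] colen_r_r colen_r_2r ell_pow_eq_sum[of r] by simp
  from arg_cong[OF this, of int]
  have "(\<Sum>i<r. int (micro_len i)) + (\<Sum>i<r. int (hilb i)) = int r * int (hilb r)" by simp
  then show ?thesis by (simp add: sum_subtractf)
qed

text \<open>If the initial form is regular, then \<open>m\<^sup>r\<^sup>+\<^sup>n : x\<^sup>r = m\<^sup>n\<close>, and the colengths of the ideals \<open>m\<^sup>r\<^sup>+\<^sup>n + x\<^sup>r A\<close>
are differences of values \<open>\<lambda>(A/m\<^sup>k)\<close>.\<close>

lemma regular_micro_len:
  assumes regular_initial_form
  shows "int (micro_len i) = int (hilb r) - int (hilb i)"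
proof -
  have "colon (pow (r + n)) r = pow n" for n
    using regular_colon_pow[OF assms, of n r] by (simp add: add.commute)
  then have C: "colen r (r + n) + ell (pow n) (carrier A) = ell (pow (r + n)) (carrier A)" for n
    using colen_eq[of r "r + n"] by simp
  have "hilb (r + i) = hilb r" by (rule hilb_const) simp
  then show ?thesis
    using C[of i] C[of "Suc i"] micro_len_colen[of i] ell_pow_Suc[of i] ell_pow_Suc[of "r + i"] by simp
qed

end

section \<open>The total ring of fractions\<close>

context cring
begin

abbreviation NZD :: "'a set" where "NZD \<equiv> nonzerodivisors R"

abbreviation Q :: "('a \<times> 'a) set ring" where "Q \<equiv> total_frac R"

lemma NZD_carrier [simp]: "s \<in> NZD \<Longrightarrow> s \<in> carrier R" by (simp add: nonzerodivisors_def)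

lemma NZD_D: "s \<in> NZD \<Longrightarrow> a \<in> carrier R \<Longrightarrow> s \<otimes> a = \<zero> \<Longrightarrow> a = \<zero>"
  unfolding nonzerodivisors_def by blast

lemma NZD_one [simp]: "\<one> \<in> NZD" unfolding nonzerodivisors_def by auto

lemma NZD_mult [simp]:
  assumes "s \<in> NZD" "t \<in> NZD" shows "s \<otimes> t \<in> NZD"
  unfolding nonzerodivisors_def
proof (intro CollectI conjI ballI impI)
  fix a assume a: "a \<in> carrier R" "s \<otimes> t \<otimes> a = \<zero>"
  then have "s \<otimes> (t \<otimes> a) = \<zero>" using assms by (simp add: m_assoc)
  then have "t \<otimes> a = \<zero>" by (rule NZD_D[OF assms(1), rotated]) (use a assms in simp)
  then show "a = \<zero>" by (rule NZD_D[OF assms(2) a(1)])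
qed (use assms in simp)

lemma NZD_cancel:
  assumes "s \<in> NZD" "a \<in> carrier R" "b \<in> carrier R" "s \<otimes> a = s \<otimes> b"
  shows "a = b"
proof -
  have "s \<otimes> (a \<ominus> b) = \<zero>" using assms by (simp add: minus_eq r_distr r_minus r_neg)
  then have "a \<ominus> b = \<zero>" by (rule NZD_D[OF assms(1), rotated]) (use assms in simp)
  then show ?thesis using assms r_right_minus_eq[of a b] by simp
qed

lemma equiv_frac_rel: "equiv (carrier R \<times> NZD) (frac_rel R)"
proof (rule equivI)
  show "frac_rel R \<subseteq> (carrier R \<times> NZD) \<times> (carrier R \<times> NZD)" by (auto simp: frac_rel_def)
  show "refl_on (carrier R \<times> NZD) (frac_rel R)" by (auto simp: refl_on_def frac_rel_def)
  show "sym (frac_rel R)" by (auto simp: sym_def frac_rel_def)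
  show "trans (frac_rel R)"
  proof (rule transI)
    fix p q w assume "(p, q) \<in> frac_rel R" "(q, w) \<in> frac_rel R"
    then obtain a s b t c u where e: "p = (a, s)" "q = (b, t)" "w = (c, u)"
      and c: "a \<in> carrier R" "b \<in> carrier R" "c \<in> carrier R" "s \<in> NZD" "t \<in> NZD" "u \<in> NZD"
      and eq: "a \<otimes> t = b \<otimes> s" "b \<otimes> u = c \<otimes> t" by (auto simp: frac_rel_def)
    have "t \<otimes> (a \<otimes> u) = (a \<otimes> t) \<otimes> u" using c by (simp add: m_ac)
    also have "\<dots> = (b \<otimes> u) \<otimes> s" unfolding eq(1) using c by (simp add: m_ac)
    also have "\<dots> = t \<otimes> (c \<otimes> s)" unfolding eq(2) using c by (simp add: m_ac)
    finally have "a \<otimes> u = c \<otimes> s" by (rule NZD_cancel[OF c(5), rotated 2]) (use c in auto)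
    then show "(p, w) \<in> frac_rel R" unfolding e frac_rel_def using c by simp
  qed
qed

lemma frac_eq_iff:
  assumes "a \<in> carrier R" "b \<in> carrier R" "s \<in> NZD" "t \<in> NZD"
  shows "frac R a s = frac R b t \<longleftrightarrow> a \<otimes> t = b \<otimes> s"
  unfolding frac_def
  by (subst eq_equiv_class_iff[OF equiv_frac_rel]) (use assms in \<open>auto simp: frac_rel_def\<close>)

lemma in_frac_iff:
  assumes "a \<in> carrier R" "s \<in> NZD"
  shows "p \<in> frac R a s \<longleftrightarrow> fst p \<in> carrier R \<and> snd p \<in> NZD \<and> a \<otimes> snd p = fst p \<otimes> s"
  using assms unfolding frac_def frac_rel_def by auto

lemma frac_closed [simp]: "a \<in> carrier R \<Longrightarrow> s \<in> NZD \<Longrightarrow> frac R a s \<in> carrier Q"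
  by (auto simp: total_frac_def frac_def quotient_def)

lemma fracE:
  assumes "q \<in> carrier Q"
  obtains a s where "a \<in> carrier R" "s \<in> NZD" "q = frac R a s"
  using assms by (auto simp: total_frac_def frac_def quotient_def)

text \<open>The product is defined as a union over all representatives, which are seen to give the same fraction.\<close>

lemma frac_mult:
  assumes c: "a \<in> carrier R" "b \<in> carrier R" "s \<in> NZD" "t \<in> NZD"
  shows "frac R a s \<otimes>\<^bsub>Q\<^esub> frac R b t = frac R (a \<otimes> b) (s \<otimes> t)"
proof -
  have inner: "(\<Union>q\<in>frac R b t. frac R (fst p \<otimes> fst q) (snd p \<otimes> snd q)) = frac R (a \<otimes> b) (s \<otimes> t)"
    if p: "p \<in> frac R a s" for p
  proof (rule SUP_eq_const)
    show "frac R b t \<noteq> {}" using in_frac_iff[OF c(2,4), of "(b, t)"] c by auto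
    fix q assume q: "q \<in> frac R b t"
    have P: "fst p \<in> carrier R" "snd p \<in> NZD" and Pe: "a \<otimes> snd p = fst p \<otimes> s"
      using p[unfolded in_frac_iff[OF c(1,3)]] by auto
    have QQ: "fst q \<in> carrier R" "snd q \<in> NZD" and Qe: "b \<otimes> snd q = fst q \<otimes> t"
      using q[unfolded in_frac_iff[OF c(2,4)]] by auto
    have "(fst p \<otimes> fst q) \<otimes> (s \<otimes> t) = (fst p \<otimes> s) \<otimes> (fst q \<otimes> t)" using P QQ c by (simp add: m_ac)
    also have "\<dots> = (a \<otimes> snd p) \<otimes> (b \<otimes> snd q)" unfolding Pe Qe ..
    also have "\<dots> = (a \<otimes> b) \<otimes> (snd p \<otimes> snd q)" using P QQ c by (simp add: m_ac)
    finally show "frac R (fst p \<otimes> fst q) (snd p \<otimes> snd q) = frac R (a \<otimes> b) (s \<otimes> t)"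
      using P QQ c by (subst frac_eq_iff) simp_all
  qed
  have ne: "frac R a s \<noteq> {}" using in_frac_iff[OF c(1,3), of "(a, s)"] c by auto
  have "(\<Union>p\<in>frac R a s. \<Union>q\<in>frac R b t. frac R (fst p \<otimes> fst q) (snd p \<otimes> snd q)) = frac R (a \<otimes> b) (s \<otimes> t)"
    by (rule SUP_eq_const[OF ne inner])
  then show ?thesis by (simp add: total_frac_def case_prod_beta)
qed

lemma frac_add:
  assumes c: "a \<in> carrier R" "b \<in> carrier R" "s \<in> NZD" "t \<in> NZD"
  shows "frac R a s \<oplus>\<^bsub>Q\<^esub> frac R b t = frac R (a \<otimes> t \<oplus> b \<otimes> s) (s \<otimes> t)"
proof -
  have inner: "(\<Union>q\<in>frac R b t. frac R (fst p \<otimes> snd q \<oplus> fst q \<otimes> snd p) (snd p \<otimes> snd q)) = frac R (a \<otimes> t \<oplus> b \<otimes> s) (s \<otimes> t)"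
    if p: "p \<in> frac R a s" for p
  proof (rule SUP_eq_const)
    show "frac R b t \<noteq> {}" using in_frac_iff[OF c(2,4), of "(b, t)"] c by auto
    fix q assume q: "q \<in> frac R b t"
    have P: "fst p \<in> carrier R" "snd p \<in> NZD" and Pe: "a \<otimes> snd p = fst p \<otimes> s"
      using p[unfolded in_frac_iff[OF c(1,3)]] by auto
    have QQ: "fst q \<in> carrier R" "snd q \<in> NZD" and Qe: "b \<otimes> snd q = fst q \<otimes> t"
      using q[unfolded in_frac_iff[OF c(2,4)]] by auto
    have "(fst p \<otimes> snd q \<oplus> fst q \<otimes> snd p) \<otimes> (s \<otimes> t)
        = (fst p \<otimes> s) \<otimes> (snd q \<otimes> t) \<oplus> (fst q \<otimes> t) \<otimes> (snd p \<otimes> s)"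
      using P QQ c by (simp add: l_distr r_distr m_ac)
    also have "\<dots> = (a \<otimes> snd p) \<otimes> (snd q \<otimes> t) \<oplus> (b \<otimes> snd q) \<otimes> (snd p \<otimes> s)" unfolding Pe Qe ..
    also have "\<dots> = (a \<otimes> t \<oplus> b \<otimes> s) \<otimes> (snd p \<otimes> snd q)" using P QQ c by (simp add: l_distr r_distr m_ac)
    finally show "frac R (fst p \<otimes> snd q \<oplus> fst q \<otimes> snd p) (snd p \<otimes> snd q) = frac R (a \<otimes> t \<oplus> b \<otimes> s) (s \<otimes> t)"
      using P QQ c by (subst frac_eq_iff) simp_all
  qed
  have ne: "frac R a s \<noteq> {}" using in_frac_iff[OF c(1,3), of "(a, s)"] c by auto
  have "(\<Union>p\<in>frac R a s. \<Union>q\<in>frac R b t. frac R (fst p \<otimes> snd q \<oplus> fst q \<otimes> snd p) (snd p \<otimes> snd q))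
      = frac R (a \<otimes> t \<oplus> b \<otimes> s) (s \<otimes> t)"
    by (rule SUP_eq_const[OF ne inner])
  then show ?thesis by (simp add: total_frac_def case_prod_beta)
qed

lemma frac_zero: "\<zero>\<^bsub>Q\<^esub> = frac R \<zero> \<one>" and frac_one: "\<one>\<^bsub>Q\<^esub> = frac R \<one> \<one>"
  by (simp_all add: total_frac_def)

lemma total_frac_cring: "cring Q"
proof (rule cringI)
  show "abelian_group Q"
  proof (rule abelian_groupI)
    fix p q w assume p: "p \<in> carrier Q" and q: "q \<in> carrier Q" and w: "w \<in> carrier Q"
    obtain a s where a: "a \<in> carrier R" "s \<in> NZD" "p = frac R a s" using p by (rule fracE)
    obtain b t where b: "b \<in> carrier R" "t \<in> NZD" "q = frac R b t" using q by (rule fracE)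
    obtain c u where c: "c \<in> carrier R" "u \<in> NZD" "w = frac R c u" using w by (rule fracE)
    show "p \<oplus>\<^bsub>Q\<^esub> q \<oplus>\<^bsub>Q\<^esub> w = p \<oplus>\<^bsub>Q\<^esub> (q \<oplus>\<^bsub>Q\<^esub> w)"
      unfolding a b c using a(1,2) b(1,2) c(1,2) by (simp add: frac_add l_distr r_distr m_ac a_assoc)
  next
    fix p q assume p: "p \<in> carrier Q" and q: "q \<in> carrier Q"
    obtain a s where a: "a \<in> carrier R" "s \<in> NZD" "p = frac R a s" using p by (rule fracE)
    obtain b t where b: "b \<in> carrier R" "t \<in> NZD" "q = frac R b t" using q by (rule fracE)
    show "p \<oplus>\<^bsub>Q\<^esub> q \<in> carrier Q" unfolding a b using a(1,2) b(1,2) by (simp add: frac_add)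
    show "p \<oplus>\<^bsub>Q\<^esub> q = q \<oplus>\<^bsub>Q\<^esub> p"
      unfolding a b using a(1,2) b(1,2) by (simp add: frac_add m_comm a_comm)
  next
    fix p assume p: "p \<in> carrier Q"
    obtain a s where a: "a \<in> carrier R" "s \<in> NZD" "p = frac R a s" using p by (rule fracE)
    show "\<zero>\<^bsub>Q\<^esub> \<oplus>\<^bsub>Q\<^esub> p = p" unfolding a frac_zero using a(1,2) by (simp add: frac_add)
    have "frac R (\<ominus> a) s \<oplus>\<^bsub>Q\<^esub> p = \<zero>\<^bsub>Q\<^esub>"
      unfolding a frac_zero using a(1,2) by (simp add: frac_add frac_eq_iff l_minus l_neg)
    then show "\<exists>q\<in>carrier Q. q \<oplus>\<^bsub>Q\<^esub> p = \<zero>\<^bsub>Q\<^esub>" using frac_closed[of "\<ominus> a" s] a(1,2) by blast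
  qed (simp add: frac_zero)
  show "comm_monoid Q"
  proof (rule comm_monoidI)
    fix p q w assume p: "p \<in> carrier Q" and q: "q \<in> carrier Q" and w: "w \<in> carrier Q"
    obtain a s where a: "a \<in> carrier R" "s \<in> NZD" "p = frac R a s" using p by (rule fracE)
    obtain b t where b: "b \<in> carrier R" "t \<in> NZD" "q = frac R b t" using q by (rule fracE)
    obtain c u where c: "c \<in> carrier R" "u \<in> NZD" "w = frac R c u" using w by (rule fracE)
    show "p \<otimes>\<^bsub>Q\<^esub> q \<otimes>\<^bsub>Q\<^esub> w = p \<otimes>\<^bsub>Q\<^esub> (q \<otimes>\<^bsub>Q\<^esub> w)"
      unfolding a b c using a(1,2) b(1,2) c(1,2) by (simp add: frac_mult m_ac)
  next
    fix p q assume p: "p \<in> carrier Q" and q: "q \<in> carrier Q"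
    obtain a s where a: "a \<in> carrier R" "s \<in> NZD" "p = frac R a s" using p by (rule fracE)
    obtain b t where b: "b \<in> carrier R" "t \<in> NZD" "q = frac R b t" using q by (rule fracE)
    show "p \<otimes>\<^bsub>Q\<^esub> q \<in> carrier Q" unfolding a b using a(1,2) b(1,2) by (simp add: frac_mult)
    show "p \<otimes>\<^bsub>Q\<^esub> q = q \<otimes>\<^bsub>Q\<^esub> p"
      unfolding a b using a(1,2) b(1,2) by (simp add: frac_mult m_ac)
  next
    fix p assume p: "p \<in> carrier Q"
    obtain a s where a: "a \<in> carrier R" "s \<in> NZD" "p = frac R a s" using p by (rule fracE)
    show "\<one>\<^bsub>Q\<^esub> \<otimes>\<^bsub>Q\<^esub> p = p" unfolding a frac_one using a(1,2) by (simp add: frac_mult)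
  qed (simp add: frac_one)
  fix p q w assume p: "p \<in> carrier Q" and q: "q \<in> carrier Q" and w: "w \<in> carrier Q"
  obtain a s where a: "a \<in> carrier R" "s \<in> NZD" "p = frac R a s" using p by (rule fracE)
  obtain b t where b: "b \<in> carrier R" "t \<in> NZD" "q = frac R b t" using q by (rule fracE)
  obtain c u where c: "c \<in> carrier R" "u \<in> NZD" "w = frac R c u" using w by (rule fracE)
  show "(p \<oplus>\<^bsub>Q\<^esub> q) \<otimes>\<^bsub>Q\<^esub> w = p \<otimes>\<^bsub>Q\<^esub> w \<oplus>\<^bsub>Q\<^esub> q \<otimes>\<^bsub>Q\<^esub> w"
    unfolding a b c using a(1,2) b(1,2) c(1,2)
    by (simp add: frac_add frac_mult frac_eq_iff l_distr r_distr m_ac)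
qed

lemma frac_embed_ring_hom: "frac_embed R \<in> ring_hom R Q"
  by (rule ring_hom_memI) (simp_all add: frac_embed_def frac_mult frac_add frac_one)

lemma frac_add_same:
  assumes "a \<in> carrier R" "b \<in> carrier R" "s \<in> NZD"
  shows "frac R a s \<oplus>\<^bsub>Q\<^esub> frac R b s = frac R (a \<oplus> b) s"
  using assms by (simp add: frac_add frac_eq_iff l_distr r_distr m_ac)

lemma frac_embed_mult:
  "a \<in> carrier R \<Longrightarrow> b \<in> carrier R \<Longrightarrow> s \<in> NZD \<Longrightarrow> frac_embed R a \<otimes>\<^bsub>Q\<^esub> frac R b s = frac R (a \<otimes> b) s"
  by (simp add: frac_embed_def frac_mult)

lemma frac_cancel:
  "a \<in> carrier R \<Longrightarrow> s \<in> NZD \<Longrightarrow> t \<in> NZD \<Longrightarrow> frac R (t \<otimes> a) (t \<otimes> s) = frac R a s"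
  by (simp add: frac_eq_iff m_ac)

end

section \<open>The first neighborhood ring\<close>

lemma (in cring) a_inv_frac:
  assumes "a \<in> carrier R" "s \<in> NZD" shows "\<ominus>\<^bsub>Q\<^esub> frac R a s = frac R (\<ominus> a) s"
proof -
  interpret Q: cring Q by (rule total_frac_cring)
  have "frac R (\<ominus> a) s \<oplus>\<^bsub>Q\<^esub> frac R a s = \<zero>\<^bsub>Q\<^esub>"
    using assms by (simp add: frac_add_same l_neg frac_zero frac_eq_iff)
  then show ?thesis using assms by (intro Q.minus_equality) auto
qed

context reduction_ring
begin

lemma x_pow_NZD [simp]: "x [^] (k::nat) \<in> NZD"
  unfolding nonzerodivisors_def by (intro CollectI conjI ballI impI x_pow_carrier) (rule x_pow_nzd)

lemma x_NZD [simp]: "x \<in> NZD"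
  unfolding nonzerodivisors_def by (intro CollectI conjI ballI impI x_carrier) (rule x_nzd)

text \<open>With the denominator \<open>x\<^sup>r\<close> all computations in the first neighborhood ring become computations with
numerators in \<open>A\<close>.\<close>

abbreviation over_xr :: "'a \<Rightarrow> ('a \<times> 'a) set" where "over_xr a \<equiv> frac A a (x [^] r)"

lemma pow_r_split:
  assumes "a \<in> pow (r + (r + i))"
  obtains c where "c \<in> pow (r + i)" "a = x [^] r \<otimes> c"
proof -
  have "a \<in> x [^] r <# pow (r + i)" using assms pow_shift[of "r + i" r] by (simp add: add_ac)
  then show thesis using that by (rule l_cosetE)
qed

text \<open>Products stay over the denominator \<open>x\<^sup>r\<close> because \<open>m\<^sup>2\<^sup>r\<^sup>+\<^sup>i = x\<^sup>r m\<^sup>r\<^sup>+\<^sup>i\<close>.\<close>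

lemma over_xr_mult:
  assumes a: "a \<in> pow (r + i)" and b: "b \<in> pow r"
  obtains c where "c \<in> pow (r + i)" "over_xr a \<otimes>\<^bsub>Q\<^esub> over_xr b = over_xr c"
proof -
  have "a \<otimes> b \<in> pow (r + (r + i))" using pow_mult[OF a b] by (simp add: add_ac)
  then obtain c where c: "c \<in> pow (r + i)" "a \<otimes> b = x [^] r \<otimes> c" by (rule pow_r_split)
  have "over_xr a \<otimes>\<^bsub>Q\<^esub> over_xr b = frac A (x [^] r \<otimes> c) (x [^] r \<otimes> x [^] r)"
    using pow_carrier[OF a] pow_carrier[OF b] c(2) by (simp add: frac_mult)
  also have "\<dots> = over_xr c" by (rule frac_cancel) (use pow_carrier[OF c(1)] in auto)
  finally show thesis using that c(1) by blast
qed

lemma pow_add_closed: "a \<in> pow n \<Longrightarrow> b \<in> pow n \<Longrightarrow> a \<oplus> b \<in> pow n"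
  using additive_subgroup.a_closed[OF ideal.axioms(1)[OF pow_ideal]] .

lemma pow_a_inv_closed: "a \<in> pow n \<Longrightarrow> \<ominus> a \<in> pow n"
  using additive_subgroup.a_inv_closed[OF ideal.axioms(1)[OF pow_ideal]] .

lemma pow_zero_closed: "\<zero> \<in> pow n"
  using additive_subgroup.zero_closed[OF ideal.axioms(1)[OF pow_ideal]] .

lemma frac_pow_in_neighborhood:
  assumes "a \<in> pow n" shows "frac A a (x [^] n) \<in> first_neighborhood A m x"
  using assms
proof (induction n arbitrary: a)
  case 0
  then show ?case unfolding first_neighborhood_def
    by (intro generate_ring.incl) (simp add: frac_embed_def)
next
  case (Suc n)
  from Suc.prems have "a \<in> ideal_prod A (pow n) m" by (simp add: ideal_pow_Suc[OF m_ideal])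
  then show ?case
  proof induction
    case (prod i j)
    have "frac A j x \<in> first_neighborhood A m x"
      unfolding first_neighborhood_def using prod(2) by (intro generate_ring.incl) blast
    then have "frac A i (x [^] n) \<otimes>\<^bsub>Q\<^esub> frac A j x \<in> first_neighborhood A m x"
      using Suc.IH[OF prod(1)] unfolding first_neighborhood_def by (intro generate_ring.eng_mult)
    then show ?case using pow_carrier[OF prod(1)] m.Icarr[OF prod(2)] by (simp add: frac_mult)
  next
    case (sum s1 s2)
    have "s1 \<in> carrier A" "s2 \<in> carrier A"
      using sum(1,2) ideal_prod_in_carrier[OF pow_ideal m_ideal] by auto
    then show ?case using generate_ring.eng_add[OF sum(3,4)[unfolded first_neighborhood_def]]
      by (simp add: frac_add_same first_neighborhood_def del: nat_pow_Suc)
  qed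
qed

text \<open>The set \<open>x\<^sup>-\<^sup>r m\<^sup>r\<close> is a ring by the previous lemma. It contains \<open>A\<close>, as \<open>x\<^sup>r\<close> lies in \<open>m\<^sup>r\<close>, and \<open>b / x\<close>
  for \<open>b \<in> m\<close>, as \<open>b x\<^sup>r\<close> lies in \<open>m\<^sup>r\<^sup>+\<^sup>1 = x m\<^sup>r\<close>.\<close>

lemma first_neighborhood_eq: "first_neighborhood A m x = over_xr ` pow r"
proof
  show "over_xr ` pow r \<subseteq> first_neighborhood A m x" using frac_pow_in_neighborhood by blast
  show "first_neighborhood A m x \<subseteq> over_xr ` pow r"
  proof
    fix q assume "q \<in> first_neighborhood A m x"
    then have "q \<in> generate_ring Q (frac_embed A ` carrier A \<union> (\<lambda>b. frac A b x) ` m)"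
      by (simp add: first_neighborhood_def)
    then show "q \<in> over_xr ` pow r"
    proof induction
      case one
      have "\<one>\<^bsub>Q\<^esub> = over_xr (x [^] r)" by (simp add: frac_one frac_eq_iff)
      then show ?case using x_pow_in_pow by blast
    next
      case (incl h)
      then show ?case
      proof
        assume "h \<in> frac_embed A ` carrier A"
        then obtain a where a: "a \<in> carrier A" "h = frac A a \<one>" by (auto simp: frac_embed_def)
        then have "h = over_xr (x [^] r \<otimes> a)" by (simp add: frac_eq_iff m_ac)
        then show ?thesis using ideal.I_r_closed[OF pow_ideal x_pow_in_pow a(1)] by blast
      next
        assume "h \<in> (\<lambda>b. frac A b x) ` m"
        then obtain b where b: "b \<in> m" "h = frac A b x" by blast
        have "b \<otimes> x [^] r \<in> x <# pow r"
          using m_mult_pow[OF b(1) x_pow_in_pow[of r]] unfolding reduction[OF order_refl] .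
        then obtain c where c: "c \<in> pow r" "b \<otimes> x [^] r = x \<otimes> c" by (rule l_cosetE)
        then have "h = over_xr c"
          unfolding b(2) using m.Icarr[OF b(1)] pow_carrier[OF c(1)] by (simp add: frac_eq_iff m_comm)
        then show ?thesis using c by blast
      qed
    next
      case (a_inv h)
      then obtain a where a: "a \<in> pow r" "h = over_xr a" by blast
      have "\<ominus>\<^bsub>Q\<^esub> h = over_xr (\<ominus> a)"
        unfolding a(2) by (rule a_inv_frac[OF pow_carrier[OF a(1)] x_pow_NZD])
      then show ?case using pow_a_inv_closed[OF a(1)] by blast
    next
      case (eng_add h1 h2)
      then obtain a b where ab: "a \<in> pow r" "b \<in> pow r" "h1 = over_xr a" "h2 = over_xr b" by blast
      then have "h1 \<oplus>\<^bsub>Q\<^esub> h2 = over_xr (a \<oplus> b)" by (simp add: frac_add_same pow_carrier)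
      then show ?case using pow_add_closed[OF ab(1,2)] by blast
    next
      case (eng_mult h1 h2)
      then obtain a b where ab': "a \<in> pow r" and ab: "b \<in> pow r" "h1 = over_xr a" "h2 = over_xr b" by blast
      then have a0: "a \<in> pow (r + 0)" by simp
      obtain c where "c \<in> pow (r + 0)" "over_xr a \<otimes>\<^bsub>Q\<^esub> over_xr b = over_xr c"
        by (rule over_xr_mult[OF a0 ab(1)])
      then show ?case unfolding ab by simp
    qed
  qed
qed

text \<open>The ideal \<open>m\<^sup>i A'\<close> is generated by \<open>x\<^sup>i\<close>, since \<open>m\<^sup>r\<^sup>+\<^sup>i = x\<^sup>i m\<^sup>r\<close>.\<close>

lemma neighborhood_ideal_eq:
  "Idl\<^bsub>Q\<lparr>carrier := first_neighborhood A m x\<rparr>\<^esub> (frac_embed A ` pow i) = over_xr ` pow (r + i)"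
proof -
  interpret Q: cring Q by (rule total_frac_cring)
  let ?H = "frac_embed A ` carrier A \<union> (\<lambda>b. frac A b x) ` m"
  have H: "?H \<subseteq> carrier Q" using m.Icarr by (auto simp: frac_embed_def)
  let ?B = "Q\<lparr>carrier := first_neighborhood A m x\<rparr>"
  have "subring (first_neighborhood A m x) Q"
    unfolding first_neighborhood_def by (rule Q.generate_ring_is_subring[OF H])
  then have "subcring (first_neighborhood A m x) Q" by (rule Q.subcringI')
  moreover have "first_neighborhood A m x \<subseteq> carrier Q"
    unfolding first_neighborhood_def by (rule Q.generate_ring_incl[OF H])
  ultimately interpret B: cring ?B using Q.subcring_iff by simp
  have carB: "carrier ?B = over_xr ` pow r" by (simp add: first_neighborhood_eq)
  have sub: "pow (r + i) \<subseteq> pow r" by (rule pow_antimono) simp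
  have id: "ideal (over_xr ` pow (r + i)) ?B"
  proof (rule B.idealI_cring)
    show "over_xr ` pow (r + i) \<subseteq> carrier ?B" using sub by (auto simp: first_neighborhood_eq)
    have "\<zero>\<^bsub>Q\<^esub> = over_xr \<zero>" by (simp add: frac_zero frac_eq_iff)
    then show "\<zero>\<^bsub>?B\<^esub> \<in> over_xr ` pow (r + i)" using pow_zero_closed by auto
    fix p q assume "p \<in> over_xr ` pow (r + i)" "q \<in> over_xr ` pow (r + i)"
    then obtain a b where ab: "a \<in> pow (r + i)" "b \<in> pow (r + i)" "p = over_xr a" "q = over_xr b" by blast
    then have "p \<oplus>\<^bsub>Q\<^esub> q = over_xr (a \<oplus> b)" by (simp add: frac_add_same pow_carrier)
    then show "p \<oplus>\<^bsub>?B\<^esub> q \<in> over_xr ` pow (r + i)"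
      using pow_add_closed[OF ab(1,2)] by simp
  next
    fix p q assume "p \<in> carrier ?B" "q \<in> over_xr ` pow (r + i)"
    then obtain a b where ab: "a \<in> pow r" "b \<in> pow (r + i)" "p = over_xr a" "q = over_xr b"
      unfolding carB by blast
    obtain c where c: "c \<in> pow (r + i)" "over_xr b \<otimes>\<^bsub>Q\<^esub> over_xr a = over_xr c"
      by (rule over_xr_mult[OF ab(2,1)])
    have "p \<otimes>\<^bsub>Q\<^esub> q = over_xr c" unfolding ab(3,4) c(2)[symmetric]
      by (rule Q.m_comm) (use ab pow_carrier in auto)
    then show "p \<otimes>\<^bsub>?B\<^esub> q \<in> over_xr ` pow (r + i)" using c(1) by simp
  qed
  have emb_sub: "frac_embed A ` pow i \<subseteq> over_xr ` pow (r + i)"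
  proof
    fix q assume "q \<in> frac_embed A ` pow i"
    then obtain a where a: "a \<in> pow i" "q = frac A a \<one>" by (auto simp: frac_embed_def)
    then have "q = over_xr (x [^] r \<otimes> a)" using pow_carrier[OF a(1)] by (simp add: frac_eq_iff m_ac)
    then show "q \<in> over_xr ` pow (r + i)" using pow_mult[OF x_pow_in_pow a(1)] by blast
  qed
  have emb_B: "frac_embed A ` pow i \<subseteq> carrier ?B" using emb_sub sub unfolding carB by blast
  show ?thesis
  proof
    show "Idl\<^bsub>?B\<^esub> (frac_embed A ` pow i) \<subseteq> over_xr ` pow (r + i)"
      by (rule B.genideal_minimal[OF id emb_sub])
    show "over_xr ` pow (r + i) \<subseteq> Idl\<^bsub>?B\<^esub> (frac_embed A ` pow i)"
    proof
      fix q assume "q \<in> over_xr ` pow (r + i)"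
      then obtain a where a: "a \<in> pow (r + i)" "q = over_xr a" by blast
      have "a \<in> x [^] i <# pow r" using a(1) pow_shift[of r i] by simp
      then obtain b where b: "b \<in> pow r" "a = x [^] i \<otimes> b" by (rule l_cosetE)
      have q: "q = frac_embed A (x [^] i) \<otimes>\<^bsub>?B\<^esub> over_xr b"
        unfolding a b using pow_carrier[OF b(1)] by (simp add: frac_embed_mult)
      have "frac_embed A (x [^] i) \<in> Idl\<^bsub>?B\<^esub> (frac_embed A ` pow i)"
        using B.genideal_self[OF emb_B] x_pow_in_pow by blast
      then show "q \<in> Idl\<^bsub>?B\<^esub> (frac_embed A ` pow i)"
        unfolding q by (rule ideal.I_r_closed[OF B.genideal_ideal[OF emb_B]]) (use b carB in blast)
    qed
  qed
qed

lemma micro_module_eq: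
  "micro_module A m x i = over_xr ` (pow_x (r + i) r)"
proof -
  interpret Q: cring Q by (rule total_frac_cring)
  have eq: "frac_embed A a \<oplus>\<^bsub>Q\<^esub> over_xr b = over_xr (b \<oplus> x [^] r \<otimes> a)"
    if "a \<in> carrier A" "b \<in> carrier A" for a b
  proof -
    have "frac_embed A a = over_xr (x [^] r \<otimes> a)" using that by (simp add: frac_embed_def frac_eq_iff m_ac)
    then show ?thesis using that by (simp add: frac_add_same a_comm)
  qed
  show ?thesis
  proof (rule Set.set_eqI)
    fix q
    have "q \<in> micro_module A m x i \<longleftrightarrow> (\<exists>a\<in>carrier A. \<exists>b\<in>pow (r + i). q = frac_embed A a \<oplus>\<^bsub>Q\<^esub> over_xr b)"
      unfolding micro_module_def Let_def neighborhood_ideal_eq set_add_def' by blast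
    also have "\<dots> \<longleftrightarrow> (\<exists>a\<in>carrier A. \<exists>b\<in>pow (r + i). q = over_xr (b \<oplus> x [^] r \<otimes> a))"
      by (intro bex_cong refl) (simp only: eq pow_carrier)
    also have "\<dots> \<longleftrightarrow> q \<in> over_xr ` (pow_x (r + i) r)"
      unfolding set_add_def' l_coset_def by blast
    finally show "q \<in> micro_module A m x i \<longleftrightarrow> q \<in> over_xr ` (pow_x (r + i) r)" .
  qed
qed

lemma micro_quot_length:
  "quot_length A (scalars_along (frac_embed A) Q) (micro_module A m x i) (micro_module A m x (Suc i)) = micro_len i"
proof -
  let ?M = "scalars_along (frac_embed A) Q" and ?A = "scalars_along (\<lambda>a. a) A"
  let ?P = "pow_x (r + i) r"
  let ?N = "pow_x (Suc (r + i)) r"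
  have M: "module A ?M" by (rule module_scalars_along[OF is_cring total_frac_cring frac_embed_ring_hom])
  have inj: "inj_on over_xr (carrier ?A)"
  proof (rule inj_onI)
    fix a b assume ab: "a \<in> carrier ?A" "b \<in> carrier ?A" "over_xr a = over_xr b"
    then have "x [^] r \<otimes> a = x [^] r \<otimes> b" by (simp add: frac_eq_iff m_comm)
    then show "a = b" using ab x_pow_cancel[of a b r] by simp
  qed
  have N: "submodule ?N A ?A" and P: "submodule ?P A ?A"
    using pow_x_ideal[of "Suc (r + i)" r] pow_x_ideal[of "r + i" r] by (simp_all only: submodule_self_iff)
  have f: "over_xr \<in> carrier ?A \<rightarrow> carrier ?M" by simp
  have add: "over_xr (u \<oplus>\<^bsub>?A\<^esub> v) = over_xr u \<oplus>\<^bsub>?M\<^esub> over_xr v" if "u \<in> carrier ?A" "v \<in> carrier ?A" for u v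
    using that by (simp add: frac_add_same)
  have lin: "over_xr (a \<odot>\<^bsub>?A\<^esub> u) = a \<odot>\<^bsub>?M\<^esub> over_xr u" if "a \<in> carrier A" "u \<in> carrier ?A" for a u
    using that by (simp add: frac_embed_mult)
  have img: "submodule (over_xr ` U) A ?M" if U: "submodule U A ?A" for U
    by (rule len_image(2)[OF self_module M f inj _ _ P pow_x_Suc_subset U]) (fact add, fact lin)
  have "len A ?M (over_xr ` ?N) (over_xr ` ?P) = len A ?A ?N ?P"
    by (rule len_image(1)[OF self_module M f inj _ _ P pow_x_Suc_subset]) (fact add, fact lin)
  moreover have "quot_length A ?M (over_xr ` ?P) (over_xr ` ?N) = the_enat (len A ?M (over_xr ` ?N) (over_xr ` ?P))"
    by (rule quot_length_eq[OF M img[OF N] img[OF P] image_mono[OF pow_x_Suc_subset]])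
  ultimately show ?thesis
    by (simp add: micro_module_eq micro_len_def ell_def ilen_def)
qed

theorem micro_invariant_eq:
  "micro_invariant A m x i = (if i = 0 then 1 else int (micro_len (i - 1)) - int (micro_len i))"
  using micro_quot_length[of "i - 1"] micro_quot_length[of i]
  by (cases i) (simp_all add: micro_invariant_def Let_def)

lemma sum_micro_invariant: "(\<Sum>i\<le>n. micro_invariant A m x i) = int (hilb r) - int (micro_len n)"
proof (induction n)
  case 0
  show ?case using micro_len_0 by (simp add: micro_invariant_eq)
next
  case (Suc n) then show ?case by (simp add: micro_invariant_eq)
qed

end

section \<open>The tangent cone as a ring\<close>

context cring
begin

lemma coset_absorb:
  assumes "ideal I R" "t \<in> I" "u \<in> carrier R" shows "I +> (t \<oplus> u) = I +> u"
proof -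
  interpret I: ideal I R by fact
  have t: "t \<in> carrier R" using assms(2) by (rule I.Icarr)
  have "(t \<oplus> u) \<ominus> u = t" using t assms(3) by (simp add: minus_eq a_assoc r_neg)
  then have "(t \<oplus> u) \<ominus> u \<in> I" using assms(2) by simp
  then show ?thesis by (subst quotient_eq_iff_same_a_r_cos[symmetric]) (use assms t in simp_all)
qed

lemma coset_zero_iff:
  assumes "ideal I R" "u \<in> carrier R" shows "I +> u = I \<longleftrightarrow> u \<in> I"
proof
  show "I +> u = I \<Longrightarrow> u \<in> I" by (rule ideal.rcos_const_imp_mem[OF assms(1)]) (use assms in auto)
  show "u \<in> I \<Longrightarrow> I +> u = I" by (rule a_rcos_zero[OF assms(1)])
qed

lemma finsum_in_ideal:
  assumes "ideal I R" "finite S" "\<And>s. s \<in> S \<Longrightarrow> f s \<in> I"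
  shows "finsum R f S \<in> I"
proof -
  interpret I: ideal I R by fact
  show ?thesis using assms(2,3)
  proof (induction S rule: finite_induct)
    case (insert s S)
    then have "finsum R f (insert s S) = f s \<oplus> finsum R f S"
      by (intro finsum_insert) (auto intro: I.Icarr)
    then show ?case using insert by simp
  qed simp
qed

end

lemma UP_carrier: "carrier (UP R) = up R"
  by (simp add: UP_def)

lemma UP_add: "p \<in> up R \<Longrightarrow> q \<in> up R \<Longrightarrow> p \<oplus>\<^bsub>UP R\<^esub> q = (\<lambda>n. p n \<oplus>\<^bsub>R\<^esub> q n)"
  by (simp add: UP_def)

lemma UP_mult: "p \<in> up R \<Longrightarrow> q \<in> up R \<Longrightarrow> p \<otimes>\<^bsub>UP R\<^esub> q = (\<lambda>n. \<Oplus>\<^bsub>R\<^esub>i\<in>{..n}. p i \<otimes>\<^bsub>R\<^esub> q (n - i))"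
  by (simp add: UP_def)

lemma UP_one: "\<one>\<^bsub>UP R\<^esub> = (\<lambda>i. if i = 0 then \<one>\<^bsub>R\<^esub> else \<zero>\<^bsub>R\<^esub>)"
  by (simp add: UP_def)

context reduction_ring
begin

abbreviation G :: "(nat \<Rightarrow> 'a set) ring" where "G \<equiv> tangent_cone A m"

text \<open>The Rees algebra, as a set of polynomials: the \<open>n\<close>-th coefficient lies in \<open>m\<^sup>n\<close>. The tangent cone is
  its image under \<open>form\<close>, which is compatible with sums and products; so the ring laws of the tangent
  cone are inherited from the polynomial ring.\<close>

definition rees :: "(nat \<Rightarrow> 'a) set" where
  "rees = {p \<in> up A. \<forall>n. p n \<in> pow n}"

definition form :: "(nat \<Rightarrow> 'a) \<Rightarrow> nat \<Rightarrow> 'a set" where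
  "form p = (\<lambda>n. pow (Suc n) +> p n)"

sublocale UP: UP_cring A "UP A" by unfold_locales

lemma rees_pow: "p \<in> rees \<Longrightarrow> p n \<in> pow n" by (simp add: rees_def)

lemma rees_carrier: "p \<in> rees \<Longrightarrow> p n \<in> carrier A" by (rule pow_carrier[OF rees_pow])

lemma rees_up: "p \<in> rees \<Longrightarrow> p \<in> up A" by (simp add: rees_def)

lemma reesI: "(\<And>n. p n \<in> pow n) \<Longrightarrow> finite {n. p n \<noteq> \<zero>} \<Longrightarrow> p \<in> rees"
proof -
  assume p: "\<And>n. p n \<in> pow n" and fin: "finite {n. p n \<noteq> \<zero>}"
  obtain k where "\<forall>n\<in>{n. p n \<noteq> \<zero>}. n \<le> k" using fin finite_nat_set_iff_bounded_le by blast
  then have "bound \<zero> k p" by (force simp: bound_def)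
  moreover have "p n \<in> carrier A" for n by (rule pow_carrier[OF p])
  ultimately have "p \<in> up A" by (intro mem_upI) blast+
  then show ?thesis using p unfolding rees_def by blast
qed

lemma rees_finite: "p \<in> rees \<Longrightarrow> finite {n. p n \<noteq> \<zero>}"
proof -
  assume "p \<in> rees"
  then obtain k where "bound \<zero> k p" using bound_upD[OF rees_up] by blast
  then have "{n. p n \<noteq> \<zero>} \<subseteq> {..k}" using bound_below[of \<zero> k p] by auto
  then show ?thesis by (rule finite_subset) simp
qed

lemma rees_add: "p \<in> rees \<Longrightarrow> q \<in> rees \<Longrightarrow> p \<oplus>\<^bsub>UP A\<^esub> q = (\<lambda>n. p n \<oplus> q n)"
  by (rule UP_add[OF rees_up rees_up])

lemma rees_mult: "p \<in> rees \<Longrightarrow> q \<in> rees \<Longrightarrow> p \<otimes>\<^bsub>UP A\<^esub> q = (\<lambda>n. \<Oplus>i\<in>{..n}. p i \<otimes> q (n - i))"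
  by (rule UP_mult[OF rees_up rees_up])

lemma rees_carrier_UP: "p \<in> rees \<Longrightarrow> p \<in> carrier (UP A)"
  by (simp add: rees_def UP_carrier)

lemma rees_add_closed: assumes "p \<in> rees" "q \<in> rees" shows "p \<oplus>\<^bsub>UP A\<^esub> q \<in> rees"
proof -
  have "p \<oplus>\<^bsub>UP A\<^esub> q \<in> up A"
    using UP.a_closed[OF rees_carrier_UP[OF assms(1)] rees_carrier_UP[OF assms(2)]] by (simp add: UP_carrier)
  moreover have "p n \<oplus> q n \<in> pow n" for n by (rule pow_add_closed) (rule rees_pow[OF assms(1)] rees_pow[OF assms(2)])+
  ultimately show ?thesis unfolding rees_def rees_add[OF assms] by blast
qed

lemma rees_mult_term: "p \<in> rees \<Longrightarrow> q \<in> rees \<Longrightarrow> i \<le> n \<Longrightarrow> p i \<otimes> q (n - i) \<in> pow n"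
  using pow_mult[OF rees_pow[of p i] rees_pow[of q "n - i"]] by simp

lemma rees_mult_closed: assumes "p \<in> rees" "q \<in> rees" shows "p \<otimes>\<^bsub>UP A\<^esub> q \<in> rees"
proof -
  have "p \<otimes>\<^bsub>UP A\<^esub> q \<in> up A"
    using UP.m_closed[OF rees_carrier_UP[OF assms(1)] rees_carrier_UP[OF assms(2)]] by (simp add: UP_carrier)
  moreover have "(\<Oplus>i\<in>{..n}. p i \<otimes> q (n - i)) \<in> pow n" for n
    by (rule finsum_in_ideal[OF pow_ideal]) (use rees_mult_term[OF assms] in auto)
  ultimately show ?thesis unfolding rees_def rees_mult[OF assms] by blast
qed

lemma rees_uminus:
  assumes "p \<in> rees" shows "(\<lambda>n. \<ominus> p n) \<in> rees"
proof (rule reesI)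
  show "\<ominus> p n \<in> pow n" for n by (rule pow_a_inv_closed[OF rees_pow[OF assms]])
  have "{n. \<ominus> p n \<noteq> \<zero>} \<subseteq> {n. p n \<noteq> \<zero>}" by auto
  then show "finite {n. \<ominus> p n \<noteq> \<zero>}" by (rule finite_subset[OF _ rees_finite[OF assms]])
qed

lemma form_zero_iff: "p \<in> rees \<Longrightarrow> form p n = pow (Suc n) \<longleftrightarrow> p n \<in> pow (Suc n)"
  unfolding form_def by (rule coset_zero_iff[OF pow_ideal rees_carrier])

lemma form_in_G: assumes "p \<in> rees" shows "form p \<in> carrier G"
proof -
  have "{n. form p n \<noteq> pow (Suc n)} \<subseteq> {n. p n \<noteq> \<zero>}"
    using form_zero_iff[OF assms] pow_zero_closed by auto
  then have "finite {n. form p n \<noteq> pow (Suc n)}" by (rule finite_subset[OF _ rees_finite[OF assms]])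
  then show ?thesis using rees_pow[OF assms] by (auto simp: tangent_cone_def form_def)
qed

text \<open>Choosing the representative zero for every zero component keeps the support of the polynomial finite.
  The sets \<open>B n\<close> from which the coefficients are taken are \<open>m\<^sup>n\<close> for the tangent cone and \<open>x\<^sup>n A\<close> for the
  fiber cone.\<close>

lemma form_of_cosets:
  assumes f: "f \<in> carrier G" and B: "\<And>n. f n \<in> (\<lambda>a. pow (Suc n) +> a) ` B n" "\<And>n. B n \<subseteq> pow n" "\<And>n. \<zero> \<in> B n"
  obtains p where "p \<in> rees" "f = form p" "\<And>n. p n \<in> B n" "\<And>n. f n = pow (Suc n) \<Longrightarrow> p n = \<zero>"
proof -
  have "\<exists>a. a \<in> B n \<and> f n = pow (Suc n) +> a \<and> (f n = pow (Suc n) \<longrightarrow> a = \<zero>)" for n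
  proof (cases "f n = pow (Suc n)")
    case True
    have "pow (Suc n) +> \<zero> = pow (Suc n)" by (rule a_rcos_zero[OF pow_ideal pow_zero_closed])
    then show ?thesis using True B(3)[of n] by (intro HOL.exI[of _ \<zero>]) simp
  next
    case False then show ?thesis using B(1)[of n] by blast
  qed
  then obtain p where p: "\<And>n. p n \<in> B n" "\<And>n. f n = pow (Suc n) +> p n" "\<And>n. f n = pow (Suc n) \<Longrightarrow> p n = \<zero>"
    by metis
  have "finite {n. f n \<noteq> pow (Suc n)}" using f by (simp add: tangent_cone_def)
  moreover have "{n. p n \<noteq> \<zero>} \<subseteq> {n. f n \<noteq> pow (Suc n)}" using p(3) by auto
  ultimately have "finite {n. p n \<noteq> \<zero>}" by (rule rev_finite_subset)
  moreover have "p n \<in> pow n" for n using p(1) B(2) by (rule subsetD[rotated])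
  ultimately have "p \<in> rees" by (intro reesI)
  moreover have "f = form p" unfolding form_def using p(2) by (rule HOL.ext)
  ultimately show thesis using that p(1,3) by blast
qed

lemma formE:
  assumes "f \<in> carrier G"
  obtains p where "p \<in> rees" "f = form p" "\<And>n. f n = pow (Suc n) \<Longrightarrow> p n = \<zero>"
proof (rule form_of_cosets[OF assms, of pow])
  show "f n \<in> (\<lambda>a. pow (Suc n) +> a) ` pow n" for n using assms by (simp add: tangent_cone_def)
qed (auto simp: pow_zero_closed)

text \<open>Changing the representatives of cosets of \<open>m\<^sup>i\<^sup>+\<^sup>1\<close> and \<open>m\<^sup>j\<^sup>+\<^sup>1\<close> changes the product by an element of
\<open>m\<^sup>i\<^sup>+\<^sup>j\<^sup>+\<^sup>1\<close>, although these cosets are multiplied as cosets of different ideals.\<close>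

lemma rcoset_mult_pow:
  assumes a: "a \<in> pow i" and b: "b \<in> pow j"
  shows "rcoset_mult A (pow (Suc (i + j))) (pow (Suc i) +> a) (pow (Suc j) +> b) = pow (Suc (i + j)) +> (a \<otimes> b)"
proof -
  let ?J = "pow (Suc (i + j))"
  note ca = pow_carrier[OF a] and cb = pow_carrier[OF b]
  have self: "u \<in> pow n +> u" if "u \<in> carrier A" for u n
    using a_r_cosetI[OF pow_zero_closed, of A u n] that by simp
  have const: "?J +> (a' \<otimes> b') = ?J +> (a \<otimes> b)"
    if a': "a' \<in> pow (Suc i) +> a" and b': "b' \<in> pow (Suc j) +> b" for a' b'
  proof -
    obtain h where h: "h \<in> pow (Suc i)" "a' = h \<oplus> a" using a' by (rule a_r_cosetE)
    obtain k where k: "k \<in> pow (Suc j)" "b' = k \<oplus> b" using b' by (rule a_r_cosetE)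
    note ch = pow_carrier[OF h(1)] and ck = pow_carrier[OF k(1)]
    have k': "k \<in> pow j" using k(1) pow_Suc_subset by blast
    have "h \<otimes> k \<in> ?J" using pow_mult[OF h(1) k'] by simp
    moreover have "h \<otimes> b \<in> ?J" using pow_mult[OF h(1) b] by simp
    moreover have "a \<otimes> k \<in> ?J" using pow_mult[OF a k(1)] by simp
    ultimately have t: "h \<otimes> k \<oplus> h \<otimes> b \<oplus> a \<otimes> k \<in> ?J" by (intro pow_add_closed)
    have "a' \<otimes> b' = (h \<otimes> k \<oplus> h \<otimes> b \<oplus> a \<otimes> k) \<oplus> a \<otimes> b"
      unfolding h k using ch ck ca cb by (simp add: l_distr r_distr a_ac)
    then show ?thesis using coset_absorb[OF pow_ideal t, of "a \<otimes> b"] ca cb by simp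
  qed
  have inner: "(\<Union>b'\<in>pow (Suc j) +> b. ?J +> (a' \<otimes> b')) = ?J +> (a \<otimes> b)" if "a' \<in> pow (Suc i) +> a" for a'
    by (rule SUP_eq_const) (use self[OF cb, of "Suc j"] const[OF that] in auto)
  have ne: "pow (Suc i) +> a \<noteq> {}" using self[OF ca, of "Suc i"] by blast
  show ?thesis unfolding rcoset_mult_def by (rule SUP_eq_const[OF ne inner])
qed

lemma form_mult:
  assumes p: "p \<in> rees" and q: "q \<in> rees"
  shows "form p \<otimes>\<^bsub>G\<^esub> form q = form (p \<otimes>\<^bsub>UP A\<^esub> q)"
proof
  fix n
  let ?J = "pow (Suc n)"
  interpret h: ring_hom_cring A "A Quot ?J" "\<lambda>a. ?J +> a"
    using ideal.rcos_ring_hom_cring[OF pow_ideal is_cring] by simp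
  have "(form p \<otimes>\<^bsub>G\<^esub> form q) n
      = (\<Oplus>\<^bsub>A Quot ?J\<^esub>i\<in>{..n}. rcoset_mult A ?J (form p i) (form q (n - i)))"
    by (simp add: tangent_cone_def)
  also have "\<dots> = (\<Oplus>\<^bsub>A Quot ?J\<^esub>i\<in>{..n}. ?J +> (p i \<otimes> q (n - i)))"
  proof (rule h.S.finsum_cong')
    show "rcoset_mult A ?J (form p i) (form q (n - i)) = ?J +> (p i \<otimes> q (n - i))" if "i \<in> {..n}" for i
      using rcoset_mult_pow[OF rees_pow[OF p] rees_pow[OF q], of i "n - i"] that by (simp add: form_def)
    show "(\<lambda>i. ?J +> (p i \<otimes> q (n - i))) \<in> {..n} \<rightarrow> carrier (A Quot ?J)"
      using rees_carrier[OF p] rees_carrier[OF q] by simp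
  qed simp
  also have "\<dots> = ?J +> (\<Oplus>i\<in>{..n}. p i \<otimes> q (n - i))"
    using h.hom_finsum[of "\<lambda>i. p i \<otimes> q (n - i)" "{..n}"] rees_carrier[OF p] rees_carrier[OF q]
    by (simp add: comp_def)
  finally show "(form p \<otimes>\<^bsub>G\<^esub> form q) n = form (p \<otimes>\<^bsub>UP A\<^esub> q) n"
    by (simp add: rees_mult[OF p q] form_def)
qed

lemma form_add:
  assumes p: "p \<in> rees" and q: "q \<in> rees"
  shows "form p \<oplus>\<^bsub>G\<^esub> form q = form (p \<oplus>\<^bsub>UP A\<^esub> q)"
  unfolding rees_add[OF p q] form_def tangent_cone_def
  by (simp add: ideal.a_rcos_sum[OF pow_ideal] rees_carrier[OF p] rees_carrier[OF q])

lemma zero_G: "\<zero>\<^bsub>G\<^esub> = (\<lambda>n. pow (Suc n))" by (simp add: tangent_cone_def)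

lemma rees_zero: "(\<lambda>n. \<zero>) \<in> rees" by (rule reesI) (simp_all add: pow_zero_closed)

lemma form_zero: "form (\<lambda>n. \<zero>) = \<zero>\<^bsub>G\<^esub>"
  unfolding zero_G form_def using a_rcos_zero[OF pow_ideal pow_zero_closed] by simp

lemma rees_one: "\<one>\<^bsub>UP A\<^esub> \<in> rees"
proof -
  have "(\<lambda>i. if i = 0 then \<one> else \<zero>) \<in> rees" by (rule reesI) (simp_all add: pow_zero_closed)
  then show ?thesis by (simp only: UP_one)
qed

lemma form_one: "form \<one>\<^bsub>UP A\<^esub> = \<one>\<^bsub>G\<^esub>"
  unfolding form_def tangent_cone_def UP_one
  using a_rcos_zero[OF pow_ideal pow_zero_closed] by (simp add: fun_eq_iff)

lemma tangent_cone_cring: "cring G"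
proof (rule cringI)
  show "abelian_group G"
  proof (rule abelian_groupI)
    fix f g h assume f: "f \<in> carrier G" and g: "g \<in> carrier G" and h: "h \<in> carrier G"
    obtain p where p: "p \<in> rees" "f = form p" using formE[OF f] by metis
    obtain q where q: "q \<in> rees" "g = form q" using formE[OF g] by metis
    obtain s where s: "s \<in> rees" "h = form s" using formE[OF h] by metis
    show "f \<oplus>\<^bsub>G\<^esub> g \<oplus>\<^bsub>G\<^esub> h = f \<oplus>\<^bsub>G\<^esub> (g \<oplus>\<^bsub>G\<^esub> h)"
      unfolding p(2) q(2) s(2) using p(1) q(1) s(1)
      by (simp add: form_add rees_add_closed UP.a_assoc rees_carrier_UP)
  next
    fix f g assume f: "f \<in> carrier G" and g: "g \<in> carrier G"
    obtain p where p: "p \<in> rees" "f = form p" using formE[OF f] by metis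
    obtain q where q: "q \<in> rees" "g = form q" using formE[OF g] by metis
    show "f \<oplus>\<^bsub>G\<^esub> g \<in> carrier G"
      unfolding p(2) q(2) using p(1) q(1) by (simp add: form_add rees_add_closed form_in_G)
    show "f \<oplus>\<^bsub>G\<^esub> g = g \<oplus>\<^bsub>G\<^esub> f"
      unfolding p(2) q(2) using p(1) q(1) UP.a_comm[of p q] by (simp add: form_add rees_carrier_UP)
  next
    show "\<zero>\<^bsub>G\<^esub> \<in> carrier G" using form_in_G[OF rees_zero] form_zero by simp
    fix f assume f: "f \<in> carrier G"
    obtain p where p: "p \<in> rees" "f = form p" using formE[OF f] by metis
    show "\<zero>\<^bsub>G\<^esub> \<oplus>\<^bsub>G\<^esub> f = f"
      unfolding p(2) form_zero[symmetric] using form_add[OF rees_zero p(1)] rees_add[OF rees_zero p(1)] rees_carrier[OF p(1)]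
      by simp
    have "(\<lambda>n. \<ominus> p n) \<oplus>\<^bsub>UP A\<^esub> p = (\<lambda>n. \<zero>)"
      using rees_add[OF rees_uminus[OF p(1)] p(1)] rees_carrier[OF p(1)] by (simp add: l_neg)
    then have "form (\<lambda>n. \<ominus> p n) \<oplus>\<^bsub>G\<^esub> f = \<zero>\<^bsub>G\<^esub>"
      unfolding p(2) form_add[OF rees_uminus[OF p(1)] p(1)] form_zero[symmetric] by (rule arg_cong)
    then show "\<exists>g\<in>carrier G. g \<oplus>\<^bsub>G\<^esub> f = \<zero>\<^bsub>G\<^esub>" using form_in_G[OF rees_uminus[OF p(1)]] by blast
  qed
  show "comm_monoid G"
  proof (rule comm_monoidI)
    fix f g h assume f: "f \<in> carrier G" and g: "g \<in> carrier G" and h: "h \<in> carrier G"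
    obtain p where p: "p \<in> rees" "f = form p" using formE[OF f] by metis
    obtain q where q: "q \<in> rees" "g = form q" using formE[OF g] by metis
    obtain s where s: "s \<in> rees" "h = form s" using formE[OF h] by metis
    show "f \<otimes>\<^bsub>G\<^esub> g \<otimes>\<^bsub>G\<^esub> h = f \<otimes>\<^bsub>G\<^esub> (g \<otimes>\<^bsub>G\<^esub> h)"
      unfolding p(2) q(2) s(2) using p(1) q(1) s(1)
      by (simp add: form_mult rees_mult_closed UP.UP_m_assoc rees_carrier_UP)
  next
    fix f g assume f: "f \<in> carrier G" and g: "g \<in> carrier G"
    obtain p where p: "p \<in> rees" "f = form p" using formE[OF f] by metis
    obtain q where q: "q \<in> rees" "g = form q" using formE[OF g] by metis
    show "f \<otimes>\<^bsub>G\<^esub> g \<in> carrier G"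
      unfolding p(2) q(2) using p(1) q(1) by (simp add: form_mult rees_mult_closed form_in_G)
    show "f \<otimes>\<^bsub>G\<^esub> g = g \<otimes>\<^bsub>G\<^esub> f"
      unfolding p(2) q(2) using p(1) q(1) UP.UP_m_comm[of p q] by (simp add: form_mult rees_carrier_UP)
  next
    show "\<one>\<^bsub>G\<^esub> \<in> carrier G" using form_in_G[OF rees_one] form_one by simp
    fix f assume f: "f \<in> carrier G"
    obtain p where p: "p \<in> rees" "f = form p" using formE[OF f] by metis
    show "\<one>\<^bsub>G\<^esub> \<otimes>\<^bsub>G\<^esub> f = f"
      unfolding p(2) form_one[symmetric] form_mult[OF rees_one p(1)] using UP.UP_l_one rees_carrier_UP[OF p(1)] by simp
  qed
  fix f g h assume f: "f \<in> carrier G" and g: "g \<in> carrier G" and h: "h \<in> carrier G"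
  obtain p where p: "p \<in> rees" "f = form p" using formE[OF f] by metis
  obtain q where q: "q \<in> rees" "g = form q" using formE[OF g] by metis
  obtain s where s: "s \<in> rees" "h = form s" using formE[OF h] by metis
  show "(f \<oplus>\<^bsub>G\<^esub> g) \<otimes>\<^bsub>G\<^esub> h = f \<otimes>\<^bsub>G\<^esub> h \<oplus>\<^bsub>G\<^esub> g \<otimes>\<^bsub>G\<^esub> h"
    unfolding p(2) q(2) s(2) using p(1) q(1) s(1)
    by (simp add: form_mult form_add rees_mult_closed rees_add_closed UP.UP_l_distr rees_carrier_UP)
qed

sublocale G: cring G by (rule tangent_cone_cring)

text \<open>For \<open>a \<in> m\<^sup>n\<close> outside \<open>m\<^sup>n\<^sup>+\<^sup>1\<close> this is the initial form of \<open>a\<close>.\<close>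

definition cls :: "nat \<Rightarrow> 'a \<Rightarrow> nat \<Rightarrow> 'a set" where
  "cls n a = (\<lambda>k. if k = n then pow (Suc n) +> a else pow (Suc k))"

definition monomial :: "nat \<Rightarrow> 'a \<Rightarrow> nat \<Rightarrow> 'a" where
  "monomial n a = (\<lambda>k. if k = n then a else \<zero>)"

lemma monomial_rees: "a \<in> pow n \<Longrightarrow> monomial n a \<in> rees"
proof (rule reesI)
  assume a: "a \<in> pow n"
  then show "monomial n a k \<in> pow k" for k by (simp add: monomial_def pow_zero_closed)
  have "{k. monomial n a k \<noteq> \<zero>} \<subseteq> {n}" by (auto simp: monomial_def)
  then show "finite {k. monomial n a k \<noteq> \<zero>}" by (rule finite_subset) simp
qed

lemma cls_eq_form: "cls n a = form (monomial n a)"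
proof (rule HOL.ext)
  fix k show "cls n a k = form (monomial n a) k"
    using a_rcos_zero[OF pow_ideal pow_zero_closed, of "Suc k"]
    by (simp add: cls_def form_def monomial_def)
qed

lemma cls_closed [simp]: "a \<in> pow n \<Longrightarrow> cls n a \<in> carrier G"
  unfolding cls_eq_form by (rule form_in_G[OF monomial_rees])

lemma monomial_mult:
  assumes a: "a \<in> pow i" and p: "p \<in> rees"
  shows "monomial i a \<otimes>\<^bsub>UP A\<^esub> p = (\<lambda>n. if i \<le> n then a \<otimes> p (n - i) else \<zero>)"
proof -
  have "(\<Oplus>k\<in>{..n}. monomial i a k \<otimes> p (n - k)) = (if i \<le> n then a \<otimes> p (n - i) else \<zero>)" for n
  proof -
    note c = pow_carrier[OF a] rees_carrier[OF p]
    have "(\<Oplus>k\<in>{..n}. monomial i a k \<otimes> p (n - k)) = (\<Oplus>k\<in>{..n}. if i = k then a \<otimes> p (n - k) else \<zero>)"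
      by (rule finsum_cong') (use c in \<open>auto simp: monomial_def\<close>)
    also have "\<dots> = (if i \<le> n then a \<otimes> p (n - i) else \<zero>)"
    proof (cases "i \<le> n")
      case True
      then show ?thesis using finsum_singleton[of i "{..n}" "\<lambda>k. a \<otimes> p (n - k)"] c by simp
    next
      case False
      have "(\<Oplus>k\<in>{..n}. if i = k then a \<otimes> p (n - k) else \<zero>) = (\<Oplus>k\<in>{..n}. \<zero>)"
        by (rule finsum_cong') (use False in auto)
      then show ?thesis using False by simp
    qed
    finally show ?thesis .
  qed
  then show ?thesis unfolding rees_mult[OF monomial_rees[OF a] p] by auto
qed

lemma cls_mult_form:
  "a \<in> pow i \<Longrightarrow> p \<in> rees \<Longrightarrow> cls i a \<otimes>\<^bsub>G\<^esub> form p = form (\<lambda>n. if i \<le> n then a \<otimes> p (n - i) else \<zero>)"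
  by (simp add: cls_eq_form form_mult monomial_rees monomial_mult)

lemma cls_mult:
  assumes "a \<in> pow i" "b \<in> pow j"
  shows "cls i a \<otimes>\<^bsub>G\<^esub> cls j b = cls (i + j) (a \<otimes> b)"
proof -
  have "(\<lambda>n. if i \<le> n then a \<otimes> monomial j b (n - i) else \<zero>) = monomial (i + j) (a \<otimes> b)"
    using pow_carrier[OF assms(1)] by (auto simp: monomial_def fun_eq_iff)
  then show ?thesis using cls_mult_form[OF assms(1) monomial_rees[OF assms(2)]] by (simp add: cls_eq_form)
qed

lemma cls_add:
  assumes "a \<in> pow n" "b \<in> pow n" shows "cls n a \<oplus>\<^bsub>G\<^esub> cls n b = cls n (a \<oplus> b)"
proof -
  have "monomial n a \<oplus>\<^bsub>UP A\<^esub> monomial n b = monomial n (a \<oplus> b)"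
    unfolding rees_add[OF monomial_rees[OF assms(1)] monomial_rees[OF assms(2)]] by (rule HOL.ext) (simp add: monomial_def)
  then show ?thesis by (simp add: cls_eq_form form_add monomial_rees assms)
qed

lemma cls_eq_zero_iff: "a \<in> pow n \<Longrightarrow> cls n a = \<zero>\<^bsub>G\<^esub> \<longleftrightarrow> a \<in> pow (Suc n)"
proof -
  assume "a \<in> pow n"
  have "cls n a = \<zero>\<^bsub>G\<^esub> \<longleftrightarrow> pow (Suc n) +> a = pow (Suc n)"
    unfolding zero_G cls_def fun_eq_iff by auto
  then show ?thesis using coset_zero_iff[OF pow_ideal pow_carrier[OF \<open>a \<in> pow n\<close>]] by simp
qed

lemma cls_one: "cls 0 \<one> = \<one>\<^bsub>G\<^esub>" by (rule HOL.ext) (simp add: cls_def tangent_cone_def)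

abbreviation xs :: "nat \<Rightarrow> 'a set" where "xs \<equiv> initial_form A m x"

lemma x_in_pow: "x \<in> pow (Suc 0)" using x_in_m by (simp add: pow_1)

lemma initial_form_eq: "xs = cls (Suc 0) x"
  unfolding initial_form_def cls_def by (rule HOL.ext) (simp add: numeral_2_eq_2)

lemma xs_closed [simp]: "xs \<in> carrier G" unfolding initial_form_eq by (rule cls_closed[OF x_in_pow])

lemma xs_pow: "xs [^]\<^bsub>G\<^esub> k = cls k (x [^] k)"
proof (induction k)
  case 0 then show ?case by (simp add: cls_one)
next
  case (Suc k)
  then show ?case using cls_mult[OF x_pow_in_pow[of k] x_in_pow] by (simp add: initial_form_eq)
qed

text \<open>The filtration of the tangent cone by order, and below the filtration by degree. The former consists of
  ideals, the latter only of \<open>A\<close>-submodules.\<close>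

definition above :: "nat \<Rightarrow> (nat \<Rightarrow> 'a set) set" where
  "above k = {f \<in> carrier G. \<forall>n<k. f n = pow (Suc n)}"

definition below :: "nat \<Rightarrow> (nat \<Rightarrow> 'a set) set" where
  "below n = {f \<in> carrier G. \<forall>k\<ge>n. f k = pow (Suc k)}"

lemma below_Suc_eq: "below (Suc d) = {f \<in> carrier G. \<forall>n>d. f n = pow (Suc n)}"
  by (auto simp: below_def Suc_le_eq)

lemma form_mult_vanish:
  assumes p: "p \<in> rees" and q: "q \<in> rees" and v: "\<And>i. i \<le> n \<Longrightarrow> p i = \<zero> \<or> q (n - i) = \<zero>"
  shows "(form p \<otimes>\<^bsub>G\<^esub> form q) n = pow (Suc n)"
proof -
  have "(\<Oplus>i\<in>{..n}. p i \<otimes> q (n - i)) = (\<Oplus>i\<in>{..n}. \<zero>)"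
    by (rule finsum_cong') (use v rees_carrier[OF p] rees_carrier[OF q] in force)+
  then have "(p \<otimes>\<^bsub>UP A\<^esub> q) n = \<zero>" by (simp add: rees_mult[OF p q])
  then show ?thesis
    unfolding form_mult[OF p q] using a_rcos_zero[OF pow_ideal pow_zero_closed] by (simp add: form_def)
qed

lemma above_mult:
  assumes "f \<in> above k" "g \<in> above l" shows "f \<otimes>\<^bsub>G\<^esub> g \<in> above (k + l)"
proof -
  have f: "f \<in> carrier G" and g: "g \<in> carrier G" using assms by (auto simp: above_def)
  obtain p where p: "p \<in> rees" "f = form p" "\<And>n. f n = pow (Suc n) \<Longrightarrow> p n = \<zero>" using formE[OF f] by metis
  obtain q where q: "q \<in> rees" "g = form q" "\<And>n. g n = pow (Suc n) \<Longrightarrow> q n = \<zero>" using formE[OF g] by metis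
  have "(f \<otimes>\<^bsub>G\<^esub> g) n = pow (Suc n)" if n: "n < k + l" for n
    unfolding p(2) q(2)
  proof (rule form_mult_vanish[OF p(1) q(1)])
    fix i assume "i \<le> n"
    then have "i < k \<or> n - i < l" using n by linarith
    then show "p i = \<zero> \<or> q (n - i) = \<zero>" using assms p(3)[of i] q(3)[of "n - i"] by (auto simp: above_def)
  qed
  then show ?thesis using f g by (simp add: above_def)
qed

lemma below_mult:
  assumes "f \<in> below (Suc d)" "g \<in> below n" shows "f \<otimes>\<^bsub>G\<^esub> g \<in> below (n + d)"
proof -
  have f: "f \<in> carrier G" and g: "g \<in> carrier G" using assms by (auto simp: below_def)
  obtain p where p: "p \<in> rees" "f = form p" "\<And>n. f n = pow (Suc n) \<Longrightarrow> p n = \<zero>" using formE[OF f] by metis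
  obtain q where q: "q \<in> rees" "g = form q" "\<And>n. g n = pow (Suc n) \<Longrightarrow> q n = \<zero>" using formE[OF g] by metis
  have "(f \<otimes>\<^bsub>G\<^esub> g) k = pow (Suc k)" if k: "n + d \<le> k" for k
    unfolding p(2) q(2)
  proof (rule form_mult_vanish[OF p(1) q(1)])
    fix i assume "i \<le> k"
    then have "Suc d \<le> i \<or> n \<le> k - i" using k by linarith
    then show "p i = \<zero> \<or> q (k - i) = \<zero>" using assms p(3)[of i] q(3)[of "k - i"] by (auto simp: below_def)
  qed
  then show ?thesis using f g by (simp add: below_def)
qed

lemma below_exists: assumes "f \<in> carrier G" obtains n where "f \<in> below (Suc n)"
proof -
  have "finite {n. f n \<noteq> pow (Suc n)}" using assms by (simp add: tangent_cone_def)
  then obtain d where "\<forall>n\<in>{n. f n \<noteq> pow (Suc n)}. n \<le> d" using finite_nat_set_iff_bounded_le by blast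
  then have "f \<in> below (Suc d)" using assms by (force simp: below_Suc_eq)
  then show thesis by (rule that)
qed

lemma above_all_zero: assumes "\<And>n. f \<in> above n" shows "f = \<zero>\<^bsub>G\<^esub>"
proof
  fix n show "f n = \<zero>\<^bsub>G\<^esub> n" using assms[of "Suc n"] by (simp add: above_def zero_G)
qed

lemma above_0: "above 0 = carrier G" by (auto simp: above_def)

text \<open>Above degree \<open>r\<close> the equation \<open>m\<^sup>n\<^sup>+\<^sup>1 = x m\<^sup>n\<close> allows dividing the coefficients by \<open>x\<close>.\<close>

lemma above_dvd:
  assumes "f \<in> above (Suc r)" obtains g where "g \<in> carrier G" "f = xs \<otimes>\<^bsub>G\<^esub> g"
proof -
  have f: "f \<in> carrier G" using assms by (auto simp: above_def)
  obtain p where p: "p \<in> rees" "f = form p" "\<And>n. f n = pow (Suc n) \<Longrightarrow> p n = \<zero>" using formE[OF f] by metis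
  have "\<exists>b. b \<in> pow n \<and> p (Suc n) = x \<otimes> b \<and> (p (Suc n) = \<zero> \<longrightarrow> b = \<zero>)" for n
  proof (cases "p (Suc n) = \<zero>")
    case True
    then show ?thesis using pow_zero_closed[of n] r_null[OF x_carrier] by metis
  next
    case False
    then have "\<not> Suc n < Suc r" using p(3)[of "Suc n"] assms by (auto simp: above_def)
    then have "p (Suc n) \<in> x <# pow n" using rees_pow[OF p(1), of "Suc n"] reduction[of n] by simp
    then obtain b where "b \<in> pow n" "p (Suc n) = x \<otimes> b" by (rule l_cosetE)
    then show ?thesis using False by blast
  qed
  then obtain q where q: "\<And>n. q n \<in> pow n" "\<And>n. p (Suc n) = x \<otimes> q n" "\<And>n. p (Suc n) = \<zero> \<Longrightarrow> q n = \<zero>"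
    by metis
  have "Suc ` {n. q n \<noteq> \<zero>} \<subseteq> {n. p n \<noteq> \<zero>}" using q(3) by blast
  then have "finite (Suc ` {n. q n \<noteq> \<zero>})" by (rule finite_subset[OF _ rees_finite[OF p(1)]])
  then have "finite {n. q n \<noteq> \<zero>}" by (rule finite_imageD) simp
  then have qr: "q \<in> rees" using q(1) by (intro reesI)
  have "p 0 = \<zero>" using p(3)[of 0] assms by (auto simp: above_def)
  then have "(\<lambda>n. if Suc 0 \<le> n then x \<otimes> q (n - Suc 0) else \<zero>) = p"
  proof (intro HOL.ext)
    fix n show "(if Suc 0 \<le> n then x \<otimes> q (n - Suc 0) else \<zero>) = p n"
      using q(2)[of "n - Suc 0"] \<open>p 0 = \<zero>\<close> by (cases n) simp_all
  qed
  then have "xs \<otimes>\<^bsub>G\<^esub> form q = f"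
    unfolding initial_form_eq using cls_mult_form[OF x_in_pow qr] p(2) by simp
  then show thesis using that form_in_G[OF qr] by metis
qed

text \<open>An annihilator of the initial form has homogeneous components \<open>a \<in> m\<^sup>n\<close> with \<open>x a \<in> m\<^sup>n\<^sup>+\<^sup>2\<close>. For the
  converse one starts from \<open>a \<in> A\<close> with \<open>x a \<in> m\<^sup>n\<^sup>+\<^sup>1\<close> and moves \<open>a\<close> from \<open>m\<^sup>k\<close> to \<open>m\<^sup>k\<^sup>+\<^sup>1\<close>, for all \<open>k < n\<close>.\<close>

lemma regular_initial_form_iff:
  "regular_initial_form \<longleftrightarrow> (\<forall>f\<in>carrier G. xs \<otimes>\<^bsub>G\<^esub> f = \<zero>\<^bsub>G\<^esub> \<longrightarrow> f = \<zero>\<^bsub>G\<^esub>)"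
proof
  assume reg: regular_initial_form
  show "\<forall>f\<in>carrier G. xs \<otimes>\<^bsub>G\<^esub> f = \<zero>\<^bsub>G\<^esub> \<longrightarrow> f = \<zero>\<^bsub>G\<^esub>"
  proof (intro ballI impI)
    fix f assume f: "f \<in> carrier G" and z: "xs \<otimes>\<^bsub>G\<^esub> f = \<zero>\<^bsub>G\<^esub>"
    obtain p where p: "p \<in> rees" "f = form p" using formE[OF f] by metis
    have z': "form (\<lambda>n. if Suc 0 \<le> n then x \<otimes> p (n - Suc 0) else \<zero>) = \<zero>\<^bsub>G\<^esub>"
      using z cls_mult_form[OF x_in_pow p(1)] by (simp add: initial_form_eq p(2))
    have "p n \<in> pow (Suc n)" for n
    proof -
      have "pow (Suc (Suc n)) +> (x \<otimes> p n) = pow (Suc (Suc n))"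
        using fun_cong[OF z', of "Suc n"] by (simp add: form_def zero_G)
      then have "x \<otimes> p n \<in> pow (Suc (Suc n))"
        using coset_zero_iff[OF pow_ideal] rees_carrier[OF p(1)] by simp
      then have "p n \<in> colon (pow (Suc (Suc n))) (Suc 0)" using rees_carrier[OF p(1)] by (simp add: colon_def)
      then show ?thesis using reg unfolding regular_initial_form_def by blast
    qed
    then show "f = \<zero>\<^bsub>G\<^esub>" unfolding p(2) zero_G using form_zero_iff[OF p(1)] by auto
  qed
next
  assume nz: "\<forall>f\<in>carrier G. xs \<otimes>\<^bsub>G\<^esub> f = \<zero>\<^bsub>G\<^esub> \<longrightarrow> f = \<zero>\<^bsub>G\<^esub>"
  have "a \<in> pow n \<Longrightarrow> x \<otimes> a \<in> pow (Suc (Suc n)) \<Longrightarrow> a \<in> pow (Suc n)" for a n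
  proof -
    assume a: "a \<in> pow n" "x \<otimes> a \<in> pow (Suc (Suc n))"
    have "xs \<otimes>\<^bsub>G\<^esub> cls n a = cls (Suc n) (x \<otimes> a)"
      using cls_mult[OF x_in_pow a(1)] by (simp add: initial_form_eq)
    also have "\<dots> = \<zero>\<^bsub>G\<^esub>" using cls_eq_zero_iff[of "x \<otimes> a" "Suc n"] a pow_Suc_subset by blast
    finally have "cls n a = \<zero>\<^bsub>G\<^esub>" using nz cls_closed[OF a(1)] by blast
    then show ?thesis using cls_eq_zero_iff a(1) by blast
  qed
  then have step: "colon (pow (Suc (Suc n))) (Suc 0) \<inter> pow n \<subseteq> pow (Suc n)" for n
    by (auto simp: colon_def)
  have "colon (pow (Suc n)) (Suc 0) \<subseteq> pow n" for n
  proof (induction n)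
    case 0 show ?case by (auto simp: colon_def)
  next
    case (Suc n)
    have "colon (pow (Suc (Suc n))) (Suc 0) \<subseteq> colon (pow (Suc n)) (Suc 0)"
      using pow_Suc_subset[of "Suc n"] by (auto simp: colon_def)
    then show ?case using Suc step[of n] by blast
  qed
  then show regular_initial_form
    unfolding regular_initial_form_def using pow_subset_colon[of _ "Suc 0"] by (simp add: set_eq_subset)
qed

end

section \<open>Depth and height in dimension one\<close>

context cring
begin

lemma Idl_empty: "Idl {} = {\<zero>}"
proof
  show "Idl {} \<subseteq> {\<zero>}" by (rule genideal_minimal[OF zeroideal]) simp
  have "ideal (Idl {}) R" by (rule genideal_ideal) simp
  then show "{\<zero>} \<subseteq> Idl {}" using additive_subgroup.zero_closed[OF ideal.axioms(1)] by simp
qed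

lemma regular_seq_nzd:
  assumes reg: "regular_seq R xs" and ne: "xs \<noteq> []" and a: "a \<in> carrier R" and z: "xs ! 0 \<otimes> a = \<zero>"
  shows "a = \<zero>"
proof -
  have "xs ! 0 \<otimes> a \<in> Idl (set (take 0 xs)) \<longrightarrow> a \<in> Idl (set (take 0 xs))"
    using reg ne a unfolding regular_seq_def by blast
  then show ?thesis using z by (simp add: Idl_empty)
qed

lemma nzd_of_depth:
  assumes "1 \<le> ideal_depth R P"
  obtains y where "y \<in> P" "y \<in> nonzerodivisors R"
proof -
  have "(0::enat) < 1" by simp
  then have "0 < ideal_depth R P" using assms by (rule order_less_le_trans)
  then obtain e where "e \<in> {enat (length xs) | xs. regular_seq R xs \<and> set xs \<subseteq> P}" "0 < e"
    unfolding ideal_depth_def less_Sup_iff by blast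
  then obtain xs where xs: "regular_seq R xs" "set xs \<subseteq> P" "xs \<noteq> []" by (auto simp: zero_enat_def)
  have "xs ! 0 \<in> set xs" using xs(3) by simp
  then have "xs ! 0 \<in> P" "xs ! 0 \<in> carrier R" using xs(1,2) unfolding regular_seq_def by blast+
  moreover have "\<forall>a\<in>carrier R. xs ! 0 \<otimes> a = \<zero> \<longrightarrow> a = \<zero>"
    using regular_seq_nzd[OF xs(1,3)] by blast
  ultimately show thesis using that unfolding nonzerodivisors_def by blast
qed

lemma depth_ge_1:
  assumes P: "ideal P R" "P \<noteq> carrier R" and y: "y \<in> P" "y \<in> nonzerodivisors R"
  shows "1 \<le> ideal_depth R P"
proof -
  have yc: "y \<in> carrier R" by (rule NZD_carrier[OF y(2)])
  have "Idl {y} \<subseteq> P" by (rule genideal_minimal[OF P(1)]) (use y in simp)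
  then have "Idl {y} \<noteq> carrier R" using P ideal_subset[OF P(1)] by blast
  moreover have "y \<otimes> a \<in> Idl {} \<longrightarrow> a \<in> Idl {}" if "a \<in> carrier R" for a
    unfolding Idl_empty using NZD_D[OF y(2) that] by blast
  ultimately have "regular_seq R [y]" unfolding regular_seq_def using yc by simp
  then have "enat (length [y]) \<in> {enat (length xs) | xs. regular_seq R xs \<and> set xs \<subseteq> P}"
    using y(1) by (intro CollectI HOL.exI[of _ "[y]"]) simp
  then have "enat (length [y]) \<le> ideal_depth R P" unfolding ideal_depth_def by (rule Sup_upper)
  then show ?thesis by (simp add: one_enat_def)
qed

lemma height_ge_1:
  assumes "primeideal P R" "primeideal P0 R" "P0 \<subset> P" shows "1 \<le> height R P"
proof -
  have "prime_chain R 1 (\<lambda>i. if i = 0 then P0 else P)"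
    using assms unfolding prime_chain_def by auto
  then have "enat 1 \<in> {enat n | n. \<exists>Q. prime_chain R n Q \<and> Q n = P}"
    by (intro CollectI HOL.exI[of _ 1] conjI refl HOL.exI[of _ "\<lambda>i. if i = 0 then P0 else P"]) simp_all
  then have "enat 1 \<le> height R P" unfolding height_def by (rule Sup_upper)
  then show ?thesis by (simp add: one_enat_def)
qed

text \<open>Chains of ideals of a noetherian ring contain their union.\<close>

lemma noetherian_maximal_element:
  assumes noeth: "noetherian_ring R" and F: "F \<noteq> {}" "\<And>I. I \<in> F \<Longrightarrow> ideal I R"
  shows "\<exists>M\<in>F. \<forall>J\<in>F. M \<subseteq> J \<longrightarrow> J = M"
proof (rule subset_Zorn)
  fix C assume C: "subset.chain F C"
  show "\<exists>U\<in>F. \<forall>Y\<in>C. Y \<subseteq> U"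
  proof (cases "C = {}")
    case True then show ?thesis using F(1) by blast
  next
    case False
    have "subset.chain {I. ideal I R} C" using C F(2) unfolding pred_on.chain_def by blast
    then have "\<Union>C \<in> C" by (rule noetherian_ring.ideal_chain_is_trivial[OF noeth False])
    moreover have "C \<subseteq> F" using C by (simp add: pred_on.chain_def)
    ultimately have "\<Union>C \<in> F" by (rule rev_subsetD)
    then show ?thesis by (rule bexI[rotated]) (simp add: Union_upper)
  qed
qed

lemma exists_maximalideal:
  assumes noeth: "noetherian_ring R" and I: "ideal I R" "I \<noteq> carrier R"
  obtains M where "maximalideal M R" "I \<subseteq> M"
proof -
  define F where "F = {J. ideal J R \<and> I \<subseteq> J \<and> J \<noteq> carrier R}"
  have F: "F \<noteq> {}" "\<And>J. J \<in> F \<Longrightarrow> ideal J R" unfolding F_def using I by auto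
  obtain M where M: "M \<in> F" and max: "\<forall>J\<in>F. M \<subseteq> J \<longrightarrow> J = M"
    using noetherian_maximal_element[OF noeth F] by (rule bexE)
  have M': "ideal M R" "I \<subseteq> M" "M \<noteq> carrier R" using M unfolding F_def by simp_all
  have "maximalideal M R"
  proof (rule maximalidealI)
    show "ideal M R" by (rule M'(1))
    show "carrier R \<noteq> M" using M'(3) by simp
    fix J assume J: "ideal J R" "M \<subseteq> J" "J \<subseteq> carrier R"
    have "I \<subseteq> J" using M'(2) J(2) by (rule subset_trans)
    then have "J \<noteq> carrier R \<Longrightarrow> J \<in> F" unfolding F_def using J(1) by simp
    then show "J = M \<or> J = carrier R" using mp[OF bspec[OF max] J(2)] by (cases "J = carrier R") simp_all
  qed
  then show thesis using M'(2) by (rule that)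
qed

text \<open>The elements \<open>y\<^sup>n s\<close> with \<open>s \<notin> P\<close> form a multiplicative set. An ideal that is maximal among the ideals
  disjoint from it is prime; it is contained in \<open>P\<close>, as the set contains all elements outside \<open>P\<close>, and
  it does not contain \<open>y\<close>. This replaces a localization at \<open>P\<close> and gives a lower bound for the height.\<close>

lemma exists_smaller_prime:
  assumes noeth: "noetherian_ring R" and P: "primeideal P R" and y: "y \<in> P"
    and ndz: "\<And>n s. s \<in> carrier R \<Longrightarrow> s \<notin> P \<Longrightarrow> y [^] (n::nat) \<otimes> s \<noteq> \<zero>"
  obtains P0 where "primeideal P0 R" "P0 \<subset> P"
proof -
  interpret P: primeideal P R by fact
  have yc [simp]: "y \<in> carrier R" using P.Icarr[OF y] .
  define S where "S = {y [^] n \<otimes> s | (n::nat) s. s \<in> carrier R \<and> s \<notin> P}"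
  have S_I: "y [^] (n::nat) \<otimes> s \<in> S" if "s \<in> carrier R" "s \<notin> P" for n s using that unfolding S_def by blast
  have S_mult: "u \<otimes> v \<in> S" if uS: "u \<in> S" and vS: "v \<in> S" for u v
  proof -
    obtain n s where u: "u = y [^] (n::nat) \<otimes> s" "s \<in> carrier R" "s \<notin> P" using uS unfolding S_def by blast
    obtain k t where v: "v = y [^] (k::nat) \<otimes> t" "t \<in> carrier R" "t \<notin> P" using vS unfolding S_def by blast
    have "u \<otimes> v = y [^] (n + k) \<otimes> (s \<otimes> t)" unfolding u(1) v(1) using u(2) v(2) by (simp add: nat_pow_mult[symmetric] m_ac)
    moreover have "s \<otimes> t \<notin> P" using P.I_prime[OF u(2) v(2)] u(3) v(3) by blast
    ultimately show ?thesis using S_I u(2) v(2) by simp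
  qed
  define F where "F = {I. ideal I R \<and> I \<inter> S = {}}"
  have "\<zero> \<notin> S"
  proof
    assume "\<zero> \<in> S"
    then obtain n s where ns: "y [^] (n::nat) \<otimes> s = \<zero>" "s \<in> carrier R" "s \<notin> P" unfolding S_def by force
    show False using ndz[OF ns(2,3), of n] ns(1) by (rule notE)
  qed
  then have zF: "{\<zero>} \<in> F" unfolding F_def using zeroideal by blast
  have F: "F \<noteq> {}" "\<And>I. I \<in> F \<Longrightarrow> ideal I R" using zF unfolding F_def by auto
  obtain M where M: "M \<in> F" "\<forall>Y\<in>F. M \<subseteq> Y \<longrightarrow> Y = M"
    using noetherian_maximal_element[OF noeth F] by (rule bexE)
  have Mi: "ideal M R" and MS: "M \<inter> S = {}" using M(1) unfolding F_def by auto
  interpret M: ideal M R by (rule Mi)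
  have Pone: "\<one> \<notin> P" using P.one_imp_carrier P.I_notcarr by auto
  have oneS: "\<one> \<in> S" using S_I[of \<one> 0] Pone by simp
  have yS: "y \<in> S" using S_I[of \<one> 1] Pone by simp
  have meet: "\<exists>i\<in>M. \<exists>u\<in>carrier R. i \<oplus> u \<otimes> a \<in> S" if a: "a \<in> carrier R" "a \<notin> M" for a
  proof -
    have I: "ideal (M <+>\<^bsub>R\<^esub> PIdl a) R" by (rule add_ideals[OF Mi cgenideal_ideal[OF a(1)]])
    note up = set_add_ideal_upper[OF Mi cgenideal_ideal[OF a(1)]]
    have "a \<in> M <+>\<^bsub>R\<^esub> PIdl a" using up(2) cgenideal_self[OF a(1)] by (rule subsetD)
    then have "M <+>\<^bsub>R\<^esub> PIdl a \<noteq> M" using a(2) by blast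
    then have "M <+>\<^bsub>R\<^esub> PIdl a \<notin> F" using mp[OF bspec[OF M(2)] up(1)] by blast
    then obtain z where z: "z \<in> M <+>\<^bsub>R\<^esub> PIdl a" "z \<in> S" unfolding F_def using I by blast
    then show ?thesis unfolding set_add_def' cgenideal_def by blast
  qed
  have prime: "primeideal M R"
  proof (rule primeidealI[OF Mi is_cring])
    show "carrier R \<noteq> M" using oneS MS by blast
    fix a b assume a: "a \<in> carrier R" and b: "b \<in> carrier R" and ab: "a \<otimes> b \<in> M"
    show "a \<in> M \<or> b \<in> M"
    proof (rule ccontr)
      assume "\<not> (a \<in> M \<or> b \<in> M)"
      then have na: "a \<notin> M" and nb: "b \<notin> M" by auto
      obtain i u where i: "i \<in> M" "u \<in> carrier R" "i \<oplus> u \<otimes> a \<in> S" using meet[OF a na] by blast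
      obtain j v where j: "j \<in> M" "v \<in> carrier R" "j \<oplus> v \<otimes> b \<in> S" using meet[OF b nb] by blast
      note ci = M.Icarr[OF i(1)] and cj = M.Icarr[OF j(1)]
      have "(i \<oplus> u \<otimes> a) \<otimes> (j \<oplus> v \<otimes> b) = i \<otimes> (j \<oplus> v \<otimes> b) \<oplus> ((u \<otimes> a) \<otimes> j \<oplus> (u \<otimes> v) \<otimes> (a \<otimes> b))"
        using ci cj a b i(2) j(2) by (simp add: l_distr r_distr m_ac a_ac)
      moreover have "i \<otimes> (j \<oplus> v \<otimes> b) \<in> M" by (rule M.I_r_closed[OF i(1)]) (use cj b j(2) in simp)
      moreover have "(u \<otimes> a) \<otimes> j \<in> M" by (rule M.I_l_closed[OF j(1)]) (use a i(2) in simp)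
      moreover have "(u \<otimes> v) \<otimes> (a \<otimes> b) \<in> M" by (rule M.I_l_closed[OF ab]) (use i(2) j(2) in simp)
      ultimately have "(i \<oplus> u \<otimes> a) \<otimes> (j \<oplus> v \<otimes> b) \<in> M" by simp
      then show False using S_mult[OF i(3) j(3)] MS by blast
    qed
  qed
  moreover have "M \<subseteq> P"
  proof
    fix a assume a: "a \<in> M"
    show "a \<in> P"
    proof (rule ccontr)
      assume "a \<notin> P"
      then have "a \<in> S" using S_I[of a 0] M.Icarr[OF a] by simp
      then show False using a MS by blast
    qed
  qed
  moreover have "y \<notin> M" using yS MS by blast
  ultimately show thesis using that y by blast
qed

text \<open>In a ring of dimension one the quotient by \<open>P\<^sub>0 + f R\<close> has finite length if \<open>f\<close> is regular modulo \<open>P\<^sub>0\<close>,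
  so the ideals generated by the powers of \<open>g\<close> in this quotient form a descending chain that stops:
  \<open>g\<^sup>n = g\<^sup>n\<^sup>+\<^sup>1 h\<close> modulo \<open>P\<^sub>0 + f R\<close>. This consequence already bounds the lengths of regular sequences and of
  prime chains, without dimension theory.\<close>

definition powers_stop :: bool where
  "powers_stop \<longleftrightarrow> (\<forall>P0 f g. ideal P0 R \<longrightarrow> f \<in> carrier R \<longrightarrow> (\<forall>u\<in>carrier R. f \<otimes> u \<in> P0 \<longrightarrow> u \<in> P0) \<longrightarrow> g \<in> carrier R
     \<longrightarrow> (\<exists>n::nat. \<exists>h\<in>carrier R. g [^] n \<otimes> (\<one> \<ominus> g \<otimes> h) \<in> P0 <+>\<^bsub>R\<^esub> PIdl f))"

lemma one_in_ideal:
  assumes "ideal I R" "g \<in> I" "h \<in> carrier R" "\<one> \<ominus> g \<otimes> h \<in> I" shows "\<one> \<in> I"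
proof -
  interpret I: ideal I R by fact
  have gh: "g \<otimes> h \<in> I" by (rule I.I_r_closed[OF assms(2,3)])
  have "(\<one> \<ominus> g \<otimes> h) \<oplus> g \<otimes> h \<in> I" by (rule I.a_closed[OF assms(4) gh])
  moreover have "(\<one> \<ominus> g \<otimes> h) \<oplus> g \<otimes> h = \<one>" using I.Icarr[OF gh] by (simp add: minus_eq a_assoc l_neg)
  ultimately show ?thesis by simp
qed

text \<open>Let a regular sequence begin with \<open>f\<close> and \<open>g\<close>. As \<open>g\<close> is regular modulo \<open>f\<close>, the powers of \<open>g\<close> can be
cancelled in \<open>g\<^sup>n (1 - g h) \<in> f R\<close>, and the ideal generated by the sequence contains one.\<close>

lemma regular_seq_length_le_1:
  assumes stop: powers_stop and reg: "regular_seq R xs" shows "length xs \<le> 1"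
proof (rule ccontr)
  assume "\<not> length xs \<le> 1"
  then have len: "1 < length xs" by simp
  let ?f = "xs ! 0" and ?g = "xs ! 1"
  have sub: "set xs \<subseteq> carrier R" using reg by (simp add: regular_seq_def)
  have fm: "?f \<in> set xs" by (rule nth_mem) (use len in linarith)
  have gm: "?g \<in> set xs" by (rule nth_mem[OF len])
  have f: "?f \<in> carrier R" and g: "?g \<in> carrier R" using sub fm gm by auto
  have take1: "set (take 1 xs) = {?f}" using len by (cases xs) auto
  have fi: "ideal (Idl {?f}) R" using genideal_ideal[of "{?f}"] f by simp
  have reg1: "a \<in> Idl {?f}" if "a \<in> carrier R" "?g \<otimes> a \<in> Idl {?f}" for a
  proof -
    have "\<forall>a\<in>carrier R. xs ! 1 \<otimes> a \<in> Idl (set (take 1 xs)) \<longrightarrow> a \<in> Idl (set (take 1 xs))"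
      using reg len unfolding regular_seq_def by blast
    then show ?thesis using that unfolding take1 by blast
  qed
  have fz: "\<forall>u\<in>carrier R. ?f \<otimes> u \<in> {\<zero>} \<longrightarrow> u \<in> {\<zero>}"
  proof (intro ballI impI)
    fix u assume u: "u \<in> carrier R" "?f \<otimes> u \<in> {\<zero>}"
    have "xs \<noteq> []" using len by auto
    then have "u = \<zero>" by (rule regular_seq_nzd[OF reg _ u(1)]) (use u(2) in simp)
    then show "u \<in> {\<zero>}" by simp
  qed
  obtain n h where nh: "h \<in> carrier R" "?g [^] (n::nat) \<otimes> (\<one> \<ominus> ?g \<otimes> h) \<in> {\<zero>} <+>\<^bsub>R\<^esub> PIdl ?f"
    using stop zeroideal f fz g unfolding powers_stop_def by blast
  have "{\<zero>} <+>\<^bsub>R\<^esub> PIdl ?f \<subseteq> Idl {?f}"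
    using set_add_ideal_least[OF fi _ cgenideal_minimal[OF fi]] genideal_self'[OF f]
      additive_subgroup.zero_closed[OF ideal.axioms(1)[OF fi]] by simp
  then have "?g [^] n \<otimes> (\<one> \<ominus> ?g \<otimes> h) \<in> Idl {?f}" using nh(2) by blast
  moreover have c: "\<one> \<ominus> ?g \<otimes> h \<in> carrier R" using g nh(1) by simp
  ultimately have "\<one> \<ominus> ?g \<otimes> h \<in> Idl {?f}"
  proof (induction n)
    case (Suc n)
    have "?g \<otimes> (?g [^] n \<otimes> (\<one> \<ominus> ?g \<otimes> h)) = ?g [^] Suc n \<otimes> (\<one> \<ominus> ?g \<otimes> h)"
      using g c by (simp add: m_ac)
    then have "?g [^] n \<otimes> (\<one> \<ominus> ?g \<otimes> h) \<in> Idl {?f}" using reg1 Suc.prems(1) g c by simp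
    then show ?case using Suc.IH c by blast
  qed simp
  moreover have "Idl {?f} \<subseteq> Idl (set xs)"
    by (rule subset_Idl_subset[OF sub]) (use fm in simp)
  ultimately have "\<one> \<ominus> ?g \<otimes> h \<in> Idl (set xs)" by blast
  moreover have "?g \<in> Idl (set xs)" using genideal_self[OF sub] gm by blast
  ultimately have "\<one> \<in> Idl (set xs)" using one_in_ideal[OF genideal_ideal[OF sub]] nh(1) by blast
  then have "Idl (set xs) = carrier R" by (rule ideal.one_imp_carrier[OF genideal_ideal[OF sub]])
  then show False using reg by (simp add: regular_seq_def)
qed

lemma primeideal_powD:
  assumes "primeideal P R" "g \<in> carrier R" "g [^] (n::nat) \<in> P" shows "g \<in> P"
  using assms(3)
proof (induction n)
  case 0
  then show ?case using ideal.one_imp_carrier[OF primeideal.axioms(1)[OF assms(1)]] primeideal.I_notcarr[OF assms(1)] by simp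
next
  case (Suc n)
  then have "g [^] n \<in> P \<or> g \<in> P" using primeideal.I_prime[OF assms(1)] assms(2) by simp
  then show ?case using Suc.IH by blast
qed

text \<open>In a chain of three primes choose \<open>f\<close> and \<open>g\<close> that are new in the second and in the third prime. Then
\<open>g\<^sup>n (1 - g h)\<close> lies in the second prime, hence so does \<open>1 - g h\<close>, and the third prime contains one.\<close>

lemma prime_chain_length_le_1:
  assumes stop: powers_stop and chain: "prime_chain R n P" shows "n \<le> 1"
proof (rule ccontr)
  assume "\<not> n \<le> 1"
  then have pr: "primeideal (P 0) R" "primeideal (P 1) R" "primeideal (P 2) R" and "P 0 \<subset> P 1" "P 1 \<subset> P 2"
    using chain unfolding prime_chain_def by (auto simp: numeral_2_eq_2)
  \<comment> \<open>\<open>f\<close> is regular modulo the prime ideal \<open>P 0\<close>\<close>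
  then obtain f g where f: "f \<in> P 1" "f \<notin> P 0" and g: "g \<in> P 2" "g \<notin> P 1" by blast
  note id = primeideal.axioms(1)[OF pr(1)] primeideal.axioms(1)[OF pr(2)] primeideal.axioms(1)[OF pr(3)]
  have fc: "f \<in> carrier R" and gc: "g \<in> carrier R" using f g ideal.Icarr[OF id(2)] ideal.Icarr[OF id(3)] by auto
  have "\<forall>u\<in>carrier R. f \<otimes> u \<in> P 0 \<longrightarrow> u \<in> P 0"
    using primeideal.I_prime[OF pr(1) fc] f(2) by blast
  then obtain k h where kh: "h \<in> carrier R" "g [^] (k::nat) \<otimes> (\<one> \<ominus> g \<otimes> h) \<in> P 0 <+>\<^bsub>R\<^esub> PIdl f"
    using stop id(1) fc gc unfolding powers_stop_def by blast
  have "P 0 <+>\<^bsub>R\<^esub> PIdl f \<subseteq> P 1"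
    by (rule set_add_ideal_least[OF id(2) _ cgenideal_minimal[OF id(2) f(1)]]) (use \<open>P 0 \<subset> P 1\<close> in blast)
  then have "g [^] k \<otimes> (\<one> \<ominus> g \<otimes> h) \<in> P 1" using kh(2) by blast
  then have "g [^] k \<in> P 1 \<or> \<one> \<ominus> g \<otimes> h \<in> P 1"
    using primeideal.I_prime[OF pr(2)] gc kh(1) by simp
  then have "\<one> \<ominus> g \<otimes> h \<in> P 2"
    using primeideal_powD[OF pr(2) gc] g(2) \<open>P 1 \<subset> P 2\<close> by blast
  then have "\<one> \<in> P 2" by (rule one_in_ideal[OF id(3) g(1) kh(1)])
  then show False using ideal.one_imp_carrier[OF id(3)] primeideal.I_notcarr[OF pr(3)] by simp
qed

text \<open>Depth and height of every maximal ideal are at most one by the two preceding bounds, and at least one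
because a nonzerodivisor in a prime ideal yields a smaller prime ideal.\<close>

lemma cohen_macaulay_ringI:
  assumes noeth: "noetherian_ring R" and stop: powers_stop
    and nzd: "\<And>P. maximalideal P R \<Longrightarrow> \<exists>y\<in>P. y \<in> nonzerodivisors R"
  shows "cohen_macaulay_ring R"
  unfolding cohen_macaulay_ring_def
proof (intro conjI allI impI)
  show "cring R" by (rule is_cring)
  show "noetherian_ring R" by fact
  fix P assume P: "maximalideal P R"
  note Pi = maximalideal.axioms(1)[OF P] and Pp = maximalideal_prime[OF P]
  have Pn: "P \<noteq> carrier R" using maximalideal.I_notcarr[OF P] by blast
  obtain y where y: "y \<in> P" "y \<in> nonzerodivisors R" using nzd[OF P] by blast
  have yc: "y \<in> carrier R" using y(2) by simp
  have "ideal_depth R P \<le> 1" unfolding ideal_depth_def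
    by (rule Sup_least) (use regular_seq_length_le_1[OF stop] in \<open>auto simp: one_enat_def\<close>)
  then have depth: "ideal_depth R P = 1" using depth_ge_1[OF Pi Pn y] by (rule antisym)
  have "y [^] (n::nat) \<otimes> s \<noteq> \<zero>" if s: "s \<in> carrier R" "s \<notin> P" for n s
  proof
    assume z: "y [^] n \<otimes> s = \<zero>"
    have nz: "y [^] n \<in> nonzerodivisors R" by (induction n) (simp_all add: y(2))
    have "s = \<zero>" by (rule NZD_D[OF nz s(1) z])
    then show False using s(2) additive_subgroup.zero_closed[OF ideal.axioms(1)[OF Pi]] by simp
  qed
  then obtain P0 where P0: "primeideal P0 R" "P0 \<subset> P"
    using exists_smaller_prime[OF noeth Pp y(1)] by metis
  have "height R P \<le> 1" unfolding height_def
    by (rule Sup_least) (use prime_chain_length_le_1[OF stop] in \<open>auto simp: one_enat_def\<close>)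
  then have "height R P = 1" using height_ge_1[OF Pp P0] by (rule antisym)
  then show "ideal_depth R P = height R P" using depth by simp
qed

text \<open>For the \<open>A\<close>-module structure of the tangent cone, whose ideals are in particular \<open>A\<close>-submodules.\<close>

lemma ideal_submodule_along:
  assumes S: "cring S" and \<phi>: "\<phi> \<in> ring_hom R S" and J: "ideal J S"
  shows "submodule J R (scalars_along \<phi> S)"
proof -
  interpret M: module R "scalars_along \<phi> S" by (rule module_scalars_along[OF is_cring S \<phi>])
  interpret J: ideal J S by fact
  show ?thesis
    by (rule M.submoduleI') (use J.a_subset ring_hom_closed[OF \<phi>] in \<open>auto intro: J.I_l_closed\<close>)
qed

end

section \<open>Cohen--Macaulay tangent cones have a regular initial form\<close>

context reduction_ring
begin

lemma G_add_apply: "(f \<oplus>\<^bsub>G\<^esub> g) n = f n <+>\<^bsub>A\<^esub> g n" by (simp add: tangent_cone_def)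

lemma pow_add_pow: "pow n <+>\<^bsub>A\<^esub> pow n = pow n"
  using set_add_ideal_least[OF pow_ideal order_refl order_refl] set_add_ideal_upper(1)[OF pow_ideal pow_ideal, of n n]
  by (rule antisym)

lemma component_add_zero:
  assumes "f n = pow (Suc n)" "g n = pow (Suc n)" shows "(f \<oplus>\<^bsub>G\<^esub> g) n = pow (Suc n)"
  unfolding G_add_apply assms by (rule pow_add_pow)

lemma component_diff_zero:
  assumes f: "f \<in> carrier G" and g: "g \<in> carrier G" and eq: "f n = g n"
  shows "(f \<ominus>\<^bsub>G\<^esub> g) n = pow (Suc n)"
proof -
  have d: "f \<ominus>\<^bsub>G\<^esub> g \<in> carrier G" using f g by simp
  obtain s where s: "s \<in> rees" "f \<ominus>\<^bsub>G\<^esub> g = form s" using formE[OF d] by metis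
  obtain q where q: "q \<in> rees" "g = form q" using formE[OF g] by metis
  have "f = (f \<ominus>\<^bsub>G\<^esub> g) \<oplus>\<^bsub>G\<^esub> g" using f g by (simp add: G.minus_eq G.a_assoc G.l_neg)
  also have "\<dots> = form s \<oplus>\<^bsub>G\<^esub> form q" unfolding s(2)[symmetric] q(2)[symmetric] by (rule refl)
  also have "\<dots> = form (\<lambda>n. s n \<oplus> q n)" unfolding form_add[OF s(1) q(1)] rees_add[OF s(1) q(1)] by (rule refl)
  finally have "f = form (\<lambda>n. s n \<oplus> q n)" .
  then have "pow (Suc n) +> (s n \<oplus> q n) = pow (Suc n) +> q n" using eq by (simp add: form_def q(2))
  then have "(s n \<oplus> q n) \<ominus> q n \<in> pow (Suc n)"
    by (subst quotient_eq_iff_same_a_r_cos[OF pow_ideal]) (use rees_carrier[OF s(1)] rees_carrier[OF q(1)] in simp_all)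
  moreover have "(s n \<oplus> q n) \<ominus> q n = s n"
    using rees_carrier[OF s(1), of n] rees_carrier[OF q(1), of n] by (simp add: minus_eq a_assoc r_neg)
  ultimately have "s n \<in> pow (Suc n)" by simp
  then show ?thesis unfolding s(2) by (simp add: form_zero_iff[OF s(1)])
qed

lemma cls_0_ring_hom: "cls 0 \<in> ring_hom A G"
proof (rule ring_hom_memI)
  fix a b assume "a \<in> carrier A" "b \<in> carrier A"
  then have ab: "a \<in> pow 0" "b \<in> pow 0" by simp_all
  show "cls 0 a \<in> carrier G" by (rule cls_closed[OF ab(1)])
  show "cls 0 (a \<otimes> b) = cls 0 a \<otimes>\<^bsub>G\<^esub> cls 0 b" using cls_mult[OF ab] by simp
  show "cls 0 (a \<oplus> b) = cls 0 a \<oplus>\<^bsub>G\<^esub> cls 0 b" using cls_add[OF ab] by simp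
qed (rule cls_one)

lemma cls_0_below: "a \<in> carrier A \<Longrightarrow> cls 0 a \<in> below (Suc 0)"
  unfolding below_Suc_eq using cls_closed[of a 0] by (simp add: cls_def)

lemma ideal_above: "ideal (above k) G"
proof -
  show ?thesis
  proof (rule G.idealI_cring)
    show "above k \<subseteq> carrier G" by (auto simp: above_def)
    show "\<zero>\<^bsub>G\<^esub> \<in> above k"
      using G.zero_closed by (simp add: above_def) (simp add: zero_G)
    show "f \<oplus>\<^bsub>G\<^esub> g \<in> above k" if "f \<in> above k" "g \<in> above k" for f g
      using that by (simp add: above_def component_add_zero)
    show "f \<otimes>\<^bsub>G\<^esub> g \<in> above k" if "f \<in> carrier G" "g \<in> above k" for f g
      using above_mult[of f 0 g k] that by (simp add: above_0)
  qed
qed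

lemma in_above_1_iff: "f \<in> above 1 \<longleftrightarrow> f \<in> carrier G \<and> f 0 = pow (Suc 0)"
  by (auto simp: above_def)

text \<open>An element with nonzero component of degree zero is, modulo the elements of positive degree, a unit of
the residue field.\<close>

lemma maximal_above_1: "maximalideal (above 1) G"
proof (rule maximalidealI[OF ideal_above])
  have "\<one>\<^bsub>G\<^esub> 0 \<noteq> pow (Suc 0)"
    unfolding cls_one[symmetric] cls_def using coset_zero_iff[OF pow_ideal one_closed, of "Suc 0"] one_notin_m
    by (simp add: pow_1)
  then show "carrier G \<noteq> above 1" using in_above_1_iff G.one_closed by blast
  fix J assume J: "ideal J G" "above 1 \<subseteq> J" "J \<subseteq> carrier G"
  interpret J: ideal J G by (rule J(1))
  show "J = above 1 \<or> J = carrier G"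
  proof (cases "J \<subseteq> above 1")
    case False
    then obtain f where f: "f \<in> J" "f \<notin> above 1" by blast
    have fc: "f \<in> carrier G" using J.Icarr[OF f(1)] .
    obtain p where p: "p \<in> rees" "f = form p" using formE[OF fc] by metis
    have "p 0 \<notin> pow (Suc 0)" using f(2) fc form_zero_iff[OF p(1), of 0] unfolding in_above_1_iff p(2) by blast
    then have unit: "p 0 \<in> Units A" using unitsI rees_carrier[OF p(1)] by (simp add: pow_1)
    define u where "u = cls 0 (inv (p 0))"
    have u: "u \<in> carrier G" unfolding u_def using unit by (intro cls_closed) simp
    have uf: "u \<otimes>\<^bsub>G\<^esub> f = form (\<lambda>n. inv (p 0) \<otimes> p n)"
      unfolding u_def p(2) using cls_mult_form[of "inv (p 0)" 0 p] unit p(1) by simp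
    have "(u \<otimes>\<^bsub>G\<^esub> f) 0 = \<one>\<^bsub>G\<^esub> 0"
      unfolding uf cls_one[symmetric] using unit by (simp add: form_def cls_def)
    then have eq: "\<one>\<^bsub>G\<^esub> 0 = (u \<otimes>\<^bsub>G\<^esub> f) 0" by simp
    have ufJ: "u \<otimes>\<^bsub>G\<^esub> f \<in> J" by (rule J.I_l_closed[OF f(1) u])
    have "(\<one>\<^bsub>G\<^esub> \<ominus>\<^bsub>G\<^esub> u \<otimes>\<^bsub>G\<^esub> f) 0 = pow (Suc 0)"
      by (rule component_diff_zero[OF G.one_closed J.Icarr[OF ufJ] eq])
    then have "\<one>\<^bsub>G\<^esub> \<ominus>\<^bsub>G\<^esub> u \<otimes>\<^bsub>G\<^esub> f \<in> above 1" unfolding in_above_1_iff using u fc by simp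
    then have "\<one>\<^bsub>G\<^esub> \<ominus>\<^bsub>G\<^esub> u \<otimes>\<^bsub>G\<^esub> f \<in> J" using J(2) by blast
    then have "(\<one>\<^bsub>G\<^esub> \<ominus>\<^bsub>G\<^esub> u \<otimes>\<^bsub>G\<^esub> f) \<oplus>\<^bsub>G\<^esub> u \<otimes>\<^bsub>G\<^esub> f \<in> J" using ufJ by (rule J.a_closed)
    moreover have "(\<one>\<^bsub>G\<^esub> \<ominus>\<^bsub>G\<^esub> u \<otimes>\<^bsub>G\<^esub> f) \<oplus>\<^bsub>G\<^esub> u \<otimes>\<^bsub>G\<^esub> f = \<one>\<^bsub>G\<^esub>"
      using u fc by (simp add: G.minus_eq G.a_assoc G.l_neg)
    ultimately show ?thesis using J.one_imp_carrier by simp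
  qed (use J in blast)
qed

text \<open>The component of degree \<open>n\<close> of such a product is the class of a unit multiple of \<open>x\<^sup>n\<close>.\<close>

lemma xs_pow_mult_nonzero:
  assumes s: "s \<in> carrier G" "s \<notin> above 1" shows "xs [^]\<^bsub>G\<^esub> (n::nat) \<otimes>\<^bsub>G\<^esub> s \<noteq> \<zero>\<^bsub>G\<^esub>"
proof
  assume z: "xs [^]\<^bsub>G\<^esub> n \<otimes>\<^bsub>G\<^esub> s = \<zero>\<^bsub>G\<^esub>"
  obtain p where p: "p \<in> rees" "s = form p" using formE[OF s(1)] by metis
  have "form (\<lambda>k. if n \<le> k then x [^] n \<otimes> p (k - n) else \<zero>) = \<zero>\<^bsub>G\<^esub>"
    using z unfolding xs_pow p(2) cls_mult_form[OF x_pow_in_pow p(1)] .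
  from fun_cong[OF this, of n] have "pow (Suc n) +> (x [^] n \<otimes> p 0) = pow (Suc n)"
    by (simp add: form_def zero_G)
  then have "x [^] n \<otimes> p 0 \<in> pow (Suc n)" using coset_zero_iff[OF pow_ideal] rees_carrier[OF p(1)] by simp
  then have "p 0 \<in> m" by (rule x_pow_mult_in_powD[OF rees_carrier[OF p(1)]])
  then have "s \<in> above 1" unfolding in_above_1_iff p(2) using form_zero_iff[OF p(1), of 0] form_in_G[OF p(1)] by (simp add: pow_1)
  then show False using s(2) by blast
qed

text \<open>By the previous lemma the ideal of the elements of positive degree is not a minimal prime, so it has
positive height and positive depth. The power \<open>y\<^sup>r\<^sup>+\<^sup>1\<close> of a nonzerodivisor \<open>y\<close> in it lies in degrees above \<open>r\<close>
and is therefore a multiple of the initial form of \<open>x\<close>. Factors of nonzerodivisors are nonzerodivisors.\<close>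

theorem regular_of_cohen_macaulay:
  assumes cm: "cohen_macaulay_ring G" shows regular_initial_form
  unfolding regular_initial_form_iff
proof (intro ballI impI)
  fix f assume f: "f \<in> carrier G" and z: "xs \<otimes>\<^bsub>G\<^esub> f = \<zero>\<^bsub>G\<^esub>"
  have noeth: "noetherian_ring G" using cm by (simp add: cohen_macaulay_ring_def)
  have prime: "primeideal (above 1) G" by (rule G.maximalideal_prime[OF maximal_above_1])
  have "xs \<in> above 1" unfolding in_above_1_iff initial_form_eq using cls_closed[OF x_in_pow] by (simp add: cls_def)
  then obtain P0 where "primeideal P0 G" "P0 \<subset> above 1"
    by (rule G.exists_smaller_prime[OF noeth prime]) (rule xs_pow_mult_nonzero)
  then have "1 \<le> height G (above 1)" by (rule G.height_ge_1[OF prime])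
  then have "1 \<le> ideal_depth G (above 1)" using cm maximal_above_1 by (simp add: cohen_macaulay_ring_def)
  then obtain y where y: "y \<in> above 1" "y \<in> nonzerodivisors G" by (rule G.nzd_of_depth)
  have yc: "y \<in> carrier G" using y(2) by simp
  have "y [^]\<^bsub>G\<^esub> n \<in> above n" for n
  proof (induction n)
    case 0 show ?case by (simp add: above_0)
  next
    case (Suc n) show ?case using above_mult[OF Suc y(1)] by simp
  qed
  then obtain g where g: "g \<in> carrier G" "y [^]\<^bsub>G\<^esub> (Suc r) = xs \<otimes>\<^bsub>G\<^esub> g" using above_dvd by metis
  have "y [^]\<^bsub>G\<^esub> (Suc r) \<otimes>\<^bsub>G\<^esub> f = g \<otimes>\<^bsub>G\<^esub> (xs \<otimes>\<^bsub>G\<^esub> f)"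
    unfolding g(2) using f g(1) xs_closed by (simp only: G.m_ac G.m_closed)
  also have "\<dots> = \<zero>\<^bsub>G\<^esub>" unfolding z using g(1) by simp
  finally have yz: "y [^]\<^bsub>G\<^esub> (Suc r) \<otimes>\<^bsub>G\<^esub> f = \<zero>\<^bsub>G\<^esub>" .
  have nz: "y [^]\<^bsub>G\<^esub> n \<in> nonzerodivisors G" for n :: nat by (induction n) (simp_all add: y(2))
  show "f = \<zero>\<^bsub>G\<^esub>" by (rule G.NZD_D[OF nz f yz])
qed

end

section \<open>Lengths in the tangent cone\<close>

lemma scalars_along_a_inv: "a_inv (scalars_along \<phi> S) = a_inv S"
  by (simp add: a_inv_def m_inv_def fun_eq_iff)

context reduction_ring
begin

lemma below_0: "below 0 = {\<zero>\<^bsub>G\<^esub>}"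
proof
  show "below 0 \<subseteq> {\<zero>\<^bsub>G\<^esub>}" by (auto simp: below_def zero_G fun_eq_iff)
  show "{\<zero>\<^bsub>G\<^esub>} \<subseteq> below 0" using G.zero_closed by (simp add: below_def) (simp add: zero_G)
qed

lemma below_mono: "k \<le> l \<Longrightarrow> below k \<subseteq> below l" by (auto simp: below_def)

lemma below_carrier: "below n \<subseteq> carrier G" by (auto simp: below_def)

text \<open>The tangent cone as a module over \<open>A\<close>. It is not of finite length, but its truncations \<open>below n\<close> are.\<close>

abbreviation GM :: "('a, nat \<Rightarrow> 'a set) module" where "GM \<equiv> scalars_along (cls 0) G"

lemma GM_module: "module A GM"
  by (rule module_scalars_along[OF is_cring tangent_cone_cring cls_0_ring_hom])

sublocale GM: module A GM by (rule GM_module)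

lemma ideal_submodule_GM: "ideal J G \<Longrightarrow> submodule J A GM"
  by (rule ideal_submodule_along[OF tangent_cone_cring cls_0_ring_hom])

lemma below_add: "f \<in> below n \<Longrightarrow> g \<in> below n \<Longrightarrow> f \<oplus>\<^bsub>G\<^esub> g \<in> below n"
  by (simp add: below_def component_add_zero)

lemma below_submodule: "submodule (below n) A GM"
proof (rule GM.submoduleI')
  show "below n \<subseteq> carrier GM" using below_carrier by simp
  show "\<zero>\<^bsub>GM\<^esub> \<in> below n" using below_0 below_mono[of 0 n] by auto
  show "f \<oplus>\<^bsub>GM\<^esub> g \<in> below n" if "f \<in> below n" "g \<in> below n" for f g
    using below_add[OF that] by simp
  show "a \<odot>\<^bsub>GM\<^esub> f \<in> below n" if "a \<in> carrier A" "f \<in> below n" for a f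
    using below_mult[OF cls_0_below[OF that(1)] that(2)] by simp
qed

text \<open>The leading coefficients in degree \<open>n\<close> of the elements of \<open>U\<close> of degree at most \<open>n\<close>. They form an ideal
  between \<open>m\<^sup>n\<^sup>+\<^sup>1\<close> and \<open>m\<^sup>n\<close>, and so reduce questions about submodules of the tangent cone, which need not be
  homogeneous, to ideals of \<open>A\<close>.\<close>

definition lead :: "nat \<Rightarrow> (nat \<Rightarrow> 'a set) set \<Rightarrow> 'a set" where
  "lead n U = {a \<in> pow n. \<exists>f\<in>U \<inter> below (Suc n). f n = pow (Suc n) +> a}"

lemma lead_ideal:
  assumes U: "submodule U A GM" shows "ideal (lead n U) A"
proof -
  have V: "submodule (U \<inter> below (Suc n)) A GM" by (rule GM.submodule_Int[OF U below_submodule])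
  show ?thesis
  proof (rule idealI_cring)
    show "lead n U \<subseteq> carrier A"
      using pow_carrier by (auto simp: lead_def)
    have "\<zero>\<^bsub>G\<^esub> \<in> U \<inter> below (Suc n)" using GM.submodule_zero[OF V] by simp
    moreover have "\<zero>\<^bsub>G\<^esub> n = pow (Suc n) +> \<zero>"
      using a_rcos_zero[OF pow_ideal pow_zero_closed, of "Suc n"] by (simp add: zero_G)
    ultimately show "\<zero> \<in> lead n U"
      using pow_zero_closed unfolding lead_def by auto
    fix a b assume a: "a \<in> lead n U" and b: "b \<in> lead n U"
    obtain f where f: "f \<in> U \<inter> below (Suc n)" "f n = pow (Suc n) +> a" using a unfolding lead_def by blast
    obtain g where g: "g \<in> U \<inter> below (Suc n)" "g n = pow (Suc n) +> b" using b unfolding lead_def by blast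
    have ap: "a \<in> pow n" and bp: "b \<in> pow n" using a b unfolding lead_def by auto
    have "f \<oplus>\<^bsub>G\<^esub> g \<in> U \<inter> below (Suc n)" using GM.submoduleE(5)[OF V f(1) g(1)] by simp
    moreover have "(f \<oplus>\<^bsub>G\<^esub> g) n = pow (Suc n) +> (a \<oplus> b)"
      unfolding G_add_apply f(2) g(2)
      by (rule ideal.a_rcos_sum[OF pow_ideal pow_carrier[OF ap] pow_carrier[OF bp]])
    ultimately show "a \<oplus> b \<in> lead n U"
      using pow_add_closed[OF ap bp] unfolding lead_def by auto
  next
    fix c a assume c: "c \<in> carrier A" and a: "a \<in> lead n U"
    obtain f where f: "f \<in> U \<inter> below (Suc n)" "f n = pow (Suc n) +> a" using a unfolding lead_def by blast
    have ap: "a \<in> pow n" using a unfolding lead_def by auto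
    have "cls 0 c \<otimes>\<^bsub>G\<^esub> f \<in> U \<inter> below (Suc n)" using GM.submoduleE(4)[OF V c f(1)] by simp
    moreover have "(cls 0 c \<otimes>\<^bsub>G\<^esub> f) n = pow (Suc n) +> (c \<otimes> a)"
    proof -
      have fc: "f \<in> carrier G" using f(1) by (simp add: below_Suc_eq)
      obtain p where p: "p \<in> rees" "f = form p" using formE[OF fc] by metis
      have c0: "c \<in> pow 0" using c by simp
      have "(cls 0 c \<otimes>\<^bsub>G\<^esub> f) n = pow (Suc n) +> (c \<otimes> p n)"
        unfolding p(2) cls_mult_form[OF c0 p(1)] by (simp add: form_def)
      also have "\<dots> = rcoset_mult A (pow (Suc n)) (pow (Suc n) +> c) (pow (Suc n) +> p n)"
        by (rule ideal.rcoset_mult_add[OF pow_ideal c rees_carrier[OF p(1)], symmetric])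
      also have "pow (Suc n) +> p n = pow (Suc n) +> a" using f(2) unfolding p(2) form_def .
      also have "rcoset_mult A (pow (Suc n)) (pow (Suc n) +> c) (pow (Suc n) +> a) = pow (Suc n) +> (c \<otimes> a)"
        by (rule ideal.rcoset_mult_add[OF pow_ideal c pow_carrier[OF ap]])
      finally show ?thesis .
    qed
    ultimately show "c \<otimes> a \<in> lead n U"
      using ideal.I_l_closed[OF pow_ideal ap c] unfolding lead_def by auto
  qed
qed

lemma lead_subset: "lead n U \<subseteq> pow n" by (auto simp: lead_def)

lemma lead_mono: "U \<subseteq> V \<Longrightarrow> lead n U \<subseteq> lead n V" unfolding lead_def by blast

lemma pow_subset_lead:
  assumes U: "submodule U A GM" shows "pow (Suc n) \<subseteq> lead n U"
proof
  fix a assume a: "a \<in> pow (Suc n)"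
  have "\<zero>\<^bsub>G\<^esub> \<in> U \<inter> below (Suc n)"
    using GM.submodule_zero[OF GM.submodule_Int[OF U below_submodule]] by simp
  moreover have "\<zero>\<^bsub>G\<^esub> n = pow (Suc n) +> a" using a_rcos_zero[OF pow_ideal a] by (simp add: zero_G)
  moreover have "a \<in> pow n" using a pow_Suc_subset by blast
  ultimately show "a \<in> lead n U" unfolding lead_def by blast
qed

lemma lead_of_apply:
  assumes "f \<in> U" "f \<in> below (Suc n)" obtains a where "a \<in> lead n U" "f n = pow (Suc n) +> a"
proof -
  have "f \<in> carrier G" using assms(2) by (simp add: below_Suc_eq)
  then have "f n \<in> (\<lambda>a. pow (Suc n) +> a) ` pow n" by (simp add: tangent_cone_def)
  then obtain a where "a \<in> pow n" "f n = pow (Suc n) +> a" by blast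
  then show thesis using assms that unfolding lead_def by blast
qed

text \<open>If \<open>U\<close> and \<open>V\<close> agree in lower degrees and have the same leading coefficients in degree \<open>n\<close>, then an
  element of \<open>V\<close> of degree \<open>n\<close> differs from an element of \<open>U\<close> by an element of lower degree.\<close>

lemma lead_step:
  assumes U: "submodule U A GM" and sub: "below n \<inter> V \<subseteq> U" and V: "submodule V A GM"
    and UV: "U \<subseteq> V" and f: "f \<in> V" "f \<in> below (Suc n)" and lead: "lead n V \<subseteq> lead n U"
  shows "f \<in> U"
proof -
  obtain a where a: "a \<in> lead n V" "f n = pow (Suc n) +> a" by (rule lead_of_apply[OF f])
  then obtain g where g: "g \<in> U" "g \<in> below (Suc n)" "g n = pow (Suc n) +> a" using lead unfolding lead_def by blast
  have fc: "f \<in> carrier G" and gc: "g \<in> carrier G" using f(2) g(2) by (auto simp: below_Suc_eq)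
  have "(f \<ominus>\<^bsub>G\<^esub> g) k = pow (Suc k)" if "n \<le> k" for k
    by (rule component_diff_zero[OF fc gc]) (use that f(2) g(2,3) a(2) in \<open>cases "k = n", auto simp: below_Suc_eq\<close>)
  then have "f \<ominus>\<^bsub>G\<^esub> g \<in> below n" using fc gc by (simp add: below_def)
  moreover have ng: "\<ominus>\<^bsub>G\<^esub> g \<in> V"
    using GM.submoduleE(3)[OF V, of g] g(1) UV by (auto simp: scalars_along_a_inv)
  ultimately have "f \<ominus>\<^bsub>G\<^esub> g \<in> U"
    using GM.submoduleE(5)[OF V f(1) ng] sub by (auto simp: G.minus_eq)
  then have "(f \<ominus>\<^bsub>G\<^esub> g) \<oplus>\<^bsub>G\<^esub> g \<in> U" using GM.submoduleE(5)[OF U _ g(1)] by simp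
  moreover have "(f \<ominus>\<^bsub>G\<^esub> g) \<oplus>\<^bsub>G\<^esub> g = f" using fc gc by (simp add: G.minus_eq G.a_assoc G.l_neg)
  ultimately show ?thesis by simp
qed

text \<open>A submodule between two consecutive truncations is determined by its leading coefficients in the one
degree that is added.\<close>

lemma len_below_Suc_le: "len A GM (below n) (below (Suc n)) \<le> enat (hilb n)"
proof -
  have "len A GM (below n) (below (Suc n)) \<le> ilen (pow (Suc n)) (pow n)"
    unfolding len_def ilen_def
  proof (rule chain_length_mono_map[where \<Psi> = "lead n"])
    fix U assume "U \<in> segment A GM (below n) (below (Suc n))"
    then have "submodule U A GM" by (simp add: segment_def)
    then show "lead n U \<in> segment A (scalars_along (\<lambda>a. a) A) (pow (Suc n)) (pow n)"
      unfolding segment_def using lead_ideal pow_subset_lead lead_subset by (simp add: submodule_self_iff)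
  next
    fix U V assume UV: "U \<in> segment A GM (below n) (below (Suc n))" "V \<in> segment A GM (below n) (below (Suc n))" "U \<subset> V"
    then have s: "submodule U A GM" "submodule V A GM" "below n \<subseteq> U" "V \<subseteq> below (Suc n)"
      by (auto simp: segment_def)
    have "\<not> lead n V \<subseteq> lead n U"
    proof
      assume l: "lead n V \<subseteq> lead n U"
      have "V \<subseteq> U"
      proof
        fix f assume "f \<in> V"
        then show "f \<in> U" using lead_step[OF s(1) _ s(2) _ _ _ l] s UV(3) by blast
      qed
      then show False using UV(3) by blast
    qed
    then show "lead n U \<subset> lead n V" using lead_mono[of U V n] UV(3) by blast
  qed
  also have "\<dots> = enat (hilb n)" by (rule enat_ell[OF cofinite_pow pow_ideal pow_Suc_subset, symmetric])
  finally show ?thesis .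
qed

lemma hilb_bounded: "hilb n \<le> (\<Sum>i\<le>r. hilb i)"
proof (cases "n \<le> r")
  case True then show ?thesis by (intro member_le_sum) auto
next
  case False
  then have "hilb n = hilb r" by (intro hilb_const) simp
  then show ?thesis using member_le_sum[of r "{..r}" hilb] by simp
qed

text \<open>The aim is a bound for the lengths of the
truncations of \<open>G / (P0 + f G)\<close> that does not depend on the range of degrees.\<close>

context
  fixes P0 f
  assumes P0: "ideal P0 G" and f: "f \<in> carrier G"
    and fP0: "\<And>u. u \<in> carrier G \<Longrightarrow> f \<otimes>\<^bsub>G\<^esub> u \<in> P0 \<Longrightarrow> u \<in> P0"
begin

interpretation P0: ideal P0 G by (rule P0)

text \<open>Preimages of the truncations of \<open>G / P0\<close>, and below, with \<open>ftrunc\<close>, of their multiples by \<open>f\<close>.\<close>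

abbreviation trunc where "trunc n \<equiv> P0 <+>\<^bsub>G\<^esub> below n"

lemma P0_submodule: "submodule P0 A GM" by (rule ideal_submodule_GM[OF P0])

lemma trunc_submodule: "submodule (trunc n) A GM"
  using GM.submodule_set_add[OF P0_submodule below_submodule] by simp

lemma P0_trunc: "P0 \<subseteq> trunc n" and below_trunc: "below n \<subseteq> trunc n"
  using GM.set_add_upper[OF P0_submodule below_submodule] by simp_all

lemma trunc_mono: "k \<le> l \<Longrightarrow> trunc k \<subseteq> trunc l"
  using GM.set_add_mono[OF order_refl below_mono] by simp

lemma len_trunc_Suc_le: "len A GM (trunc n) (trunc (Suc n)) \<le> enat (\<Sum>i\<le>r. hilb i)"
proof -
  have eq: "trunc n <+>\<^bsub>G\<^esub> below (Suc n) = trunc (Suc n)"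
  proof
    show "trunc n <+>\<^bsub>G\<^esub> below (Suc n) \<subseteq> trunc (Suc n)"
      using GM.set_add_least[OF trunc_submodule trunc_mono[of n "Suc n"] below_trunc] by simp
    have s: "submodule (trunc n <+>\<^bsub>G\<^esub> below (Suc n)) A GM"
      using GM.submodule_set_add[OF trunc_submodule below_submodule] by simp
    have up: "trunc n \<subseteq> trunc n <+>\<^bsub>G\<^esub> below (Suc n)" "below (Suc n) \<subseteq> trunc n <+>\<^bsub>G\<^esub> below (Suc n)"
      using GM.set_add_upper[OF trunc_submodule below_submodule] by simp_all
    show "trunc (Suc n) \<subseteq> trunc n <+>\<^bsub>G\<^esub> below (Suc n)"
      using GM.set_add_least[OF s _ up(2), of P0] P0_trunc[of n] up(1) by auto
  qed
  have "len A GM (trunc n) (trunc (Suc n)) = len A GM (trunc n \<inter> below (Suc n)) (below (Suc n))"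
    using GM.len_Int_eq_len_add[OF trunc_submodule below_submodule, of n "Suc n"] eq by simp
  also have "\<dots> \<le> len A GM (below n) (below (Suc n))"
  proof -
    have "len A GM (below n) (below (Suc n))
        = len A GM (below n) (trunc n \<inter> below (Suc n)) + len A GM (trunc n \<inter> below (Suc n)) (below (Suc n))"
      by (rule GM.len_add[OF below_submodule GM.submodule_Int[OF trunc_submodule below_submodule] below_submodule])
        (use below_trunc below_mono[of n "Suc n"] in auto)
    then show ?thesis by simp
  qed
  also have "\<dots> \<le> enat (hilb n)" by (rule len_below_Suc_le)
  also have "\<dots> \<le> enat (\<Sum>i\<le>r. hilb i)" using hilb_bounded by simp
  finally show ?thesis .
qed

lemma len_trunc_add_le: "len A GM (trunc n) (trunc (n + d)) \<le> enat (d * (\<Sum>i\<le>r. hilb i))"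
proof (induction d)
  case 0
  have "len A GM (trunc n) (trunc n) = 0" by (rule GM.len_refl[OF trunc_submodule])
  then show ?case by simp
next
  case (Suc d)
  have "len A GM (trunc n) (trunc (n + Suc d)) = len A GM (trunc n) (trunc (n + d)) + len A GM (trunc (n + d)) (trunc (Suc (n + d)))"
    using GM.len_add[OF trunc_submodule trunc_submodule trunc_submodule trunc_mono trunc_mono, of n "n + d" "n + Suc d"] by simp
  also have "\<dots> \<le> enat (d * (\<Sum>i\<le>r. hilb i)) + enat (\<Sum>i\<le>r. hilb i)"
    by (rule add_mono[OF Suc len_trunc_Suc_le])
  finally show ?case by (simp add: add.commute)
qed

lemma trunc_0: "trunc 0 = P0"
  using GM.set_add_least[OF P0_submodule order_refl, of "below 0"] P0_trunc[of 0] P0.zero_closed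
  by (simp add: below_0 subset_antisym)

lemma len_P0_trunc_finite: "len A GM P0 (trunc n) \<noteq> \<infinity>"
  using len_trunc_add_le[of 0 n] unfolding trunc_0 by (cases "len A GM P0 (trunc n)") auto

abbreviation fmul where "fmul V \<equiv> (\<lambda>u. f \<otimes>\<^bsub>G\<^esub> u) ` V"

lemma fmul_submodule: assumes V: "submodule V A GM" shows "submodule (fmul V) A GM"
proof -
  have Vc: "V \<subseteq> carrier G" using GM.submoduleE(1)[OF V] by simp
  show ?thesis
  proof (rule GM.submoduleI')
    show "fmul V \<subseteq> carrier GM" using Vc f by auto
    have "\<zero>\<^bsub>G\<^esub> \<in> V" using GM.submodule_zero[OF V] by simp
    then show "\<zero>\<^bsub>GM\<^esub> \<in> fmul V" using G.r_null[OF f] by (simp add: image_iff) metis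
    fix u v assume "u \<in> fmul V" "v \<in> fmul V"
    then obtain a b where ab: "a \<in> V" "b \<in> V" "u = f \<otimes>\<^bsub>G\<^esub> a" "v = f \<otimes>\<^bsub>G\<^esub> b" by blast
    have "u \<oplus>\<^bsub>G\<^esub> v = f \<otimes>\<^bsub>G\<^esub> (a \<oplus>\<^bsub>G\<^esub> b)" unfolding ab(3,4)
      by (rule G.r_distr[symmetric]) (use ab Vc f in auto)
    moreover have "a \<oplus>\<^bsub>G\<^esub> b \<in> V" using GM.submoduleE(5)[OF V ab(1,2)] by simp
    ultimately show "u \<oplus>\<^bsub>GM\<^esub> v \<in> fmul V" by simp
  next
    fix c u assume c: "c \<in> carrier A" and "u \<in> fmul V"
    then obtain a where a: "a \<in> V" "u = f \<otimes>\<^bsub>G\<^esub> a" by blast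
    have "cls 0 c \<otimes>\<^bsub>G\<^esub> u = f \<otimes>\<^bsub>G\<^esub> (cls 0 c \<otimes>\<^bsub>G\<^esub> a)" unfolding a(2)
      by (rule G.m_lcomm) (use a Vc f c in auto)
    moreover have "cls 0 c \<otimes>\<^bsub>G\<^esub> a \<in> V" using GM.submoduleE(4)[OF V c a(1)] by simp
    ultimately show "c \<odot>\<^bsub>GM\<^esub> u \<in> fmul V" by simp
  qed
qed

abbreviation ftrunc where "ftrunc n \<equiv> P0 <+>\<^bsub>G\<^esub> fmul (below n)"

lemma ftrunc_submodule: "submodule (ftrunc n) A GM"
  using GM.submodule_set_add[OF P0_submodule fmul_submodule[OF below_submodule]] by simp

text \<open>Multiplication by \<open>f\<close> embeds \<open>trunc n / P0\<close> into \<open>ftrunc n / P0\<close>, because \<open>f\<close> is regular modulo \<open>P0\<close>.\<close>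

lemma len_P0_trunc_le: "len A GM P0 (trunc n) \<le> len A GM P0 (ftrunc n)"
  unfolding len_def
proof (rule chain_length_mono_map[where \<Psi> = "\<lambda>V. P0 <+>\<^bsub>G\<^esub> fmul V"])
  fix V assume V: "V \<in> segment A GM P0 (trunc n)"
  then have s: "submodule V A GM" "P0 \<subseteq> V" "V \<subseteq> trunc n" by (auto simp: segment_def)
  note fV = fmul_submodule[OF s(1)]
  note upT = GM.set_add_upper[OF P0_submodule fmul_submodule[OF below_submodule], simplified]
  have "fmul V \<subseteq> ftrunc n"
  proof
    fix w assume "w \<in> fmul V"
    then obtain v where v: "v \<in> V" "w = f \<otimes>\<^bsub>G\<^esub> v" by blast
    then have "v \<in> trunc n" using s(3) by blast
    then obtain p b where pb: "p \<in> P0" "b \<in> below n" "v = p \<oplus>\<^bsub>G\<^esub> b" unfolding set_add_def' by blast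
    have bc: "b \<in> carrier G" using pb(2) below_carrier by blast
    have "w = f \<otimes>\<^bsub>G\<^esub> p \<oplus>\<^bsub>G\<^esub> f \<otimes>\<^bsub>G\<^esub> b" unfolding v(2) pb(3) by (rule G.r_distr[OF P0.Icarr[OF pb(1)] bc f])
    moreover have "f \<otimes>\<^bsub>G\<^esub> p \<in> P0" by (rule P0.I_l_closed[OF pb(1) f])
    ultimately show "w \<in> ftrunc n" using pb(2) unfolding set_add_def' by blast
  qed
  then have "P0 <+>\<^bsub>G\<^esub> fmul V \<subseteq> ftrunc n" using GM.set_add_least[OF ftrunc_submodule upT(1), of "fmul V" n] by simp
  moreover have "submodule (P0 <+>\<^bsub>G\<^esub> fmul V) A GM" using GM.submodule_set_add[OF P0_submodule fV] by simp
  moreover have "P0 \<subseteq> P0 <+>\<^bsub>G\<^esub> fmul V" using GM.set_add_upper(1)[OF P0_submodule fV] by simp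
  ultimately show "P0 <+>\<^bsub>G\<^esub> fmul V \<in> segment A GM P0 (ftrunc n)" by (simp add: segment_def)
next
  fix V W assume VW: "V \<in> segment A GM P0 (trunc n)" "W \<in> segment A GM P0 (trunc n)" "V \<subset> W"
  then have s: "submodule V A GM" "submodule W A GM" "P0 \<subseteq> V" by (auto simp: segment_def)
  have Vc: "V \<subseteq> carrier G" and Wc: "W \<subseteq> carrier G" using GM.submoduleE(1) s by auto
  obtain u where u: "u \<in> W" "u \<notin> V" using VW(3) by blast
  have "f \<otimes>\<^bsub>G\<^esub> u \<in> P0 <+>\<^bsub>G\<^esub> fmul W"
    using GM.set_add_upper(2)[OF P0_submodule fmul_submodule[OF s(2)]] u(1) by auto
  moreover have "f \<otimes>\<^bsub>G\<^esub> u \<notin> P0 <+>\<^bsub>G\<^esub> fmul V"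
  proof
    assume "f \<otimes>\<^bsub>G\<^esub> u \<in> P0 <+>\<^bsub>G\<^esub> fmul V"
    then obtain p v where pv: "p \<in> P0" "v \<in> V" "f \<otimes>\<^bsub>G\<^esub> u = p \<oplus>\<^bsub>G\<^esub> f \<otimes>\<^bsub>G\<^esub> v" unfolding set_add_def' by blast
    have uc: "u \<in> carrier G" and vc: "v \<in> carrier G" using u pv Vc Wc by auto
    have "f \<otimes>\<^bsub>G\<^esub> (u \<ominus>\<^bsub>G\<^esub> v) = f \<otimes>\<^bsub>G\<^esub> u \<ominus>\<^bsub>G\<^esub> f \<otimes>\<^bsub>G\<^esub> v"
      using f uc vc by (simp add: G.minus_eq G.r_distr G.r_minus)
    also have "\<dots> = p" unfolding pv(3) using P0.Icarr[OF pv(1)] f vc by (simp add: G.minus_eq G.a_assoc G.r_neg)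
    finally have "u \<ominus>\<^bsub>G\<^esub> v \<in> P0" using fP0[of "u \<ominus>\<^bsub>G\<^esub> v"] uc vc pv(1) by simp
    then have "(u \<ominus>\<^bsub>G\<^esub> v) \<oplus>\<^bsub>G\<^esub> v \<in> V" using GM.submoduleE(5)[OF s(1) _ pv(2)] s(3) by auto
    moreover have "(u \<ominus>\<^bsub>G\<^esub> v) \<oplus>\<^bsub>G\<^esub> v = u" using uc vc by (simp add: G.minus_eq G.a_assoc G.l_neg)
    ultimately show False using u(2) by simp
  qed
  moreover have "P0 <+>\<^bsub>G\<^esub> fmul V \<subseteq> P0 <+>\<^bsub>G\<^esub> fmul W"
    using GM.set_add_mono[OF order_refl image_mono, of V W P0 "\<lambda>u. f \<otimes>\<^bsub>G\<^esub> u"] VW(3) by auto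
  ultimately show "P0 <+>\<^bsub>G\<^esub> fmul V \<subset> P0 <+>\<^bsub>G\<^esub> fmul W" by blast
qed

text \<open>The submodule \<open>ftrunc n\<close> has at least the length of \<open>trunc n\<close> over \<open>P0\<close>. So its colength in \<open>trunc (n + d)\<close>
is at most the length of \<open>trunc (n + d) / trunc n\<close>, to which each of the \<open>d\<close> added degrees contributes
a bounded amount.\<close>

lemma len_ftrunc_le:
  assumes "f \<in> below (Suc d)"
  shows "ftrunc n \<subseteq> trunc (n + d)" "len A GM (ftrunc n) (trunc (n + d)) \<le> enat (d * (\<Sum>i\<le>r. hilb i))"
proof -
  have "fmul (below n) \<subseteq> trunc (n + d)" using below_mult[OF assms] below_trunc[of "n + d"] by blast
  then show TU: "ftrunc n \<subseteq> trunc (n + d)" using GM.set_add_least[OF trunc_submodule P0_trunc, of "fmul (below n)" "n + d"] by simp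
  have P0T: "P0 \<subseteq> ftrunc n" using GM.set_add_upper(1)[OF P0_submodule fmul_submodule[OF below_submodule]] by simp
  have "len A GM P0 (ftrunc n) + len A GM (ftrunc n) (trunc (n + d)) = len A GM P0 (trunc n) + len A GM (trunc n) (trunc (n + d))"
    using GM.len_add[OF P0_submodule ftrunc_submodule trunc_submodule P0T TU]
      GM.len_add[OF P0_submodule trunc_submodule trunc_submodule P0_trunc trunc_mono, of n "n + d"] by simp
  then have "len A GM P0 (trunc n) + len A GM (ftrunc n) (trunc (n + d)) \<le> len A GM P0 (trunc n) + len A GM (trunc n) (trunc (n + d))"
    using add_right_mono[OF len_P0_trunc_le[of n], of "len A GM (ftrunc n) (trunc (n + d))"] by simp
  then have "len A GM (ftrunc n) (trunc (n + d)) \<le> len A GM (trunc n) (trunc (n + d))"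
    using len_P0_trunc_finite[of n] by (simp add: enat_add_left_cancel_le)
  then show "len A GM (ftrunc n) (trunc (n + d)) \<le> enat (d * (\<Sum>i\<le>r. hilb i))"
    using len_trunc_add_le[of n d] by (rule order_trans)
qed

text \<open>If the ideals \<open>P0 + f G + g\<^sup>j G\<close> were different for all \<open>j \<le> k\<close>, this would be visible in a finite range of
degrees that contains the powers of \<open>g\<close> in question. Their traces on \<open>trunc (n + d)\<close> contain \<open>ftrunc n\<close>,
and the bound of the previous lemma is violated if \<open>k\<close> exceeds it.\<close>

lemma powers_stop_modulo:
  assumes g: "g \<in> carrier G"
  shows "\<exists>n::nat. \<exists>h\<in>carrier G. g [^]\<^bsub>G\<^esub> n \<otimes>\<^bsub>G\<^esub> (\<one>\<^bsub>G\<^esub> \<ominus>\<^bsub>G\<^esub> g \<otimes>\<^bsub>G\<^esub> h) \<in> P0 <+>\<^bsub>G\<^esub> PIdl\<^bsub>G\<^esub> f"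
proof -
  let ?I = "P0 <+>\<^bsub>G\<^esub> PIdl\<^bsub>G\<^esub> f"
  obtain d where d: "f \<in> below (Suc d)" using below_exists[OF f] by metis
  define k where "k = Suc (d * (\<Sum>i\<le>r. hilb i))"
  define W where "W j = ?I <+>\<^bsub>G\<^esub> PIdl\<^bsub>G\<^esub> (g [^]\<^bsub>G\<^esub> j)" for j :: nat
  have I: "ideal ?I G" by (rule G.add_ideals[OF P0 G.cgenideal_ideal[OF f]])
  have gj: "g [^]\<^bsub>G\<^esub> j \<in> carrier G" for j :: nat using g by simp
  have W: "ideal (W j) G" for j unfolding W_def by (rule G.add_ideals[OF I G.cgenideal_ideal[OF gj]])
  note Wup = G.set_add_ideal_upper[OF I G.cgenideal_ideal[OF gj], folded W_def]
  have gW: "g [^]\<^bsub>G\<^esub> j \<in> W j" for j using Wup(2) G.cgenideal_self[OF gj] by blast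
  have Wdec: "W (Suc j) \<subseteq> W j" for j
  proof -
    have "g [^]\<^bsub>G\<^esub> Suc j \<in> W j" using ideal.I_r_closed[OF W gW g] by simp
    then show ?thesis unfolding W_def[of "Suc j"]
      using G.set_add_ideal_least[OF W Wup(1) G.cgenideal_minimal[OF W]] by blast
  qed
  have "\<exists>j<k. g [^]\<^bsub>G\<^esub> j \<in> W (Suc j)"
  proof (rule ccontr)
    assume no: "\<not> (\<exists>j<k. g [^]\<^bsub>G\<^esub> j \<in> W (Suc j))"
    have "\<exists>n. \<forall>j<k. g [^]\<^bsub>G\<^esub> j \<in> below n" for k :: nat
    proof (induction k)
      case (Suc k)
      then obtain n where n: "\<forall>j<k. g [^]\<^bsub>G\<^esub> j \<in> below n" by blast
      obtain n' where n': "g [^]\<^bsub>G\<^esub> k \<in> below (Suc n')" using below_exists[OF gj] by metis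
      have "\<forall>j<Suc k. g [^]\<^bsub>G\<^esub> j \<in> below (max n (Suc n'))"
        using n n' below_mono[of n "max n (Suc n')"] below_mono[of "Suc n'" "max n (Suc n')"] by (auto simp: less_Suc_eq)
      then show ?case by blast
    qed simp
    then obtain n where n: "\<forall>j<k. g [^]\<^bsub>G\<^esub> j \<in> below n" by blast
    have nU: "g [^]\<^bsub>G\<^esub> j \<in> trunc (n + d)" if "j < k" for j
      using n that below_mono[of n "n + d"] below_trunc[of "n + d"] by auto
    \<comment> \<open>the ideals \<open>W j\<close> decrease, so the chain is read backwards\<close>
    define c where "c i = W (k - i) \<inter> trunc (n + d)" for i
    have "fmul (below n) \<subseteq> PIdl\<^bsub>G\<^esub> f"
      using below_carrier[of n] f G.m_comm unfolding cgenideal_def by blast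
    then have "ftrunc n \<subseteq> ?I" using GM.set_add_mono[OF order_refl, of "fmul (below n)" "PIdl\<^bsub>G\<^esub> f" P0] by simp
    then have seg: "c i \<in> segment A GM (ftrunc n) (trunc (n + d))" for i
      unfolding segment_def c_def
      using GM.submodule_Int[OF ideal_submodule_GM[OF W] trunc_submodule] Wup(1)[of "k - i"] len_ftrunc_le(1)[OF d, of n]
      by auto
    have "strict_chain (segment A GM (ftrunc n) (trunc (n + d))) k c"
      unfolding strict_chain_def
    proof (intro conjI allI impI)
      fix i assume i: "i < k"
      then have e: "k - i = Suc (k - Suc i)" and lt: "k - Suc i < k" by auto
      have "g [^]\<^bsub>G\<^esub> (k - Suc i) \<in> c (Suc i)" unfolding c_def using gW nU[OF lt] by blast
      moreover have "g [^]\<^bsub>G\<^esub> (k - Suc i) \<notin> c i" unfolding c_def e using no lt by blast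
      moreover have "c i \<subseteq> c (Suc i)" unfolding c_def e using Wdec by blast
      ultimately show "c i \<subset> c (Suc i)" by blast
    qed (rule seg)
    then have "enat k \<le> len A GM (ftrunc n) (trunc (n + d))" unfolding len_def by (rule chain_length_ge)
    also have "\<dots> \<le> enat (d * (\<Sum>i\<le>r. hilb i))" by (rule len_ftrunc_le(2)[OF d])
    finally show False by (simp add: k_def)
  qed
  then obtain j where j: "g [^]\<^bsub>G\<^esub> j \<in> W (Suc j)" by blast
  then obtain i h where ih: "i \<in> ?I" "h \<in> carrier G" "g [^]\<^bsub>G\<^esub> j = i \<oplus>\<^bsub>G\<^esub> h \<otimes>\<^bsub>G\<^esub> g [^]\<^bsub>G\<^esub> Suc j"
    unfolding W_def set_add_def' cgenideal_def by blast
  have ic: "i \<in> carrier G" using ideal.Icarr[OF I ih(1)] .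
  have "g [^]\<^bsub>G\<^esub> j \<otimes>\<^bsub>G\<^esub> (\<one>\<^bsub>G\<^esub> \<ominus>\<^bsub>G\<^esub> g \<otimes>\<^bsub>G\<^esub> h) = g [^]\<^bsub>G\<^esub> j \<ominus>\<^bsub>G\<^esub> h \<otimes>\<^bsub>G\<^esub> g [^]\<^bsub>G\<^esub> Suc j"
    using g gj[of j] ih(2) by (simp add: G.minus_eq G.r_distr G.r_minus G.m_ac)
  also have "\<dots> = (i \<oplus>\<^bsub>G\<^esub> h \<otimes>\<^bsub>G\<^esub> g [^]\<^bsub>G\<^esub> Suc j) \<ominus>\<^bsub>G\<^esub> h \<otimes>\<^bsub>G\<^esub> g [^]\<^bsub>G\<^esub> Suc j"
    using arg_cong[OF ih(3), of "\<lambda>z. z \<ominus>\<^bsub>G\<^esub> h \<otimes>\<^bsub>G\<^esub> g [^]\<^bsub>G\<^esub> Suc j"] .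
  also have "\<dots> = i" using ic ih(2) gj[of "Suc j"] by (simp add: G.minus_eq G.a_assoc G.r_neg del: G.nat_pow_Suc)
  finally show ?thesis using ih(1,2) by auto
qed

end

lemma powers_stop_G: "G.powers_stop"
  unfolding G.powers_stop_def using powers_stop_modulo by blast

section \<open>The tangent cone is noetherian\<close>

lemma lead_cofinite: "submodule J A GM \<Longrightarrow> cofinite_ideal (lead n J)"
  unfolding cofinite_ideal_def using lead_ideal pow_subset_lead by blast

text \<open>Multiplication by the initial form of \<open>x\<close> multiplies leading coefficients by \<open>x\<close>. As in the proof of the
basis theorem of Hilbert, leading coefficients of an ideal only grow from one degree to the next, if \<open>m\<^sup>n\<close>
and \<open>m\<^sup>n\<^sup>+\<^sup>1 = x m\<^sup>n\<close> are identified for \<open>n \<ge> r\<close>.\<close>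

lemma x_lead:
  assumes J: "ideal J G" shows "x <# lead n J \<subseteq> lead (Suc n) J"
proof
  fix b assume "b \<in> x <# lead n J"
  then obtain a where a: "a \<in> lead n J" "b = x \<otimes> a" by (rule l_cosetE)
  obtain f where f: "f \<in> J" "f \<in> below (Suc n)" "f n = pow (Suc n) +> a" and ap: "a \<in> pow n"
    using a(1) unfolding lead_def by blast
  have fc: "f \<in> carrier G" using f(2) by (simp add: below_Suc_eq)
  obtain p where p: "p \<in> rees" "f = form p" using formE[OF fc] by metis
  have "xs \<otimes>\<^bsub>G\<^esub> f \<in> J" by (rule ideal.I_l_closed[OF J f(1) xs_closed])
  moreover have "xs \<in> below (Suc (Suc 0))" using xs_closed unfolding below_Suc_eq initial_form_eq by (simp add: cls_def)
  then have "xs \<otimes>\<^bsub>G\<^esub> f \<in> below (Suc (Suc n))" using below_mult[OF _ f(2)] by force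
  moreover have "(xs \<otimes>\<^bsub>G\<^esub> f) (Suc n) = pow (Suc (Suc n)) +> b"
  proof -
    have "(xs \<otimes>\<^bsub>G\<^esub> f) (Suc n) = pow (Suc (Suc n)) +> (x \<otimes> p n)"
      unfolding p(2) initial_form_eq cls_mult_form[OF x_in_pow p(1)] by (simp add: form_def)
    also have "\<dots> = pow (Suc (Suc n)) +> (x \<otimes> a)"
    proof (subst quotient_eq_iff_same_a_r_cos[OF pow_ideal, symmetric])
      have "p n \<ominus> a \<in> pow (Suc n)"
        using f(3) unfolding p(2) form_def
        by (subst quotient_eq_iff_same_a_r_cos[OF pow_ideal]) (use rees_carrier[OF p(1)] pow_carrier[OF ap] in auto)
      then have "x \<otimes> (p n \<ominus> a) \<in> pow (Suc (Suc n))" by (rule m_mult_pow[OF x_in_m])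
      moreover have "x \<otimes> (p n \<ominus> a) = x \<otimes> p n \<ominus> x \<otimes> a"
        using rees_carrier[OF p(1), of n] pow_carrier[OF ap] by (simp add: minus_eq r_distr r_minus)
      ultimately show "x \<otimes> p n \<ominus> x \<otimes> a \<in> pow (Suc (Suc n))" by simp
    qed (use rees_carrier[OF p(1)] pow_carrier[OF ap] in auto)
    finally show ?thesis using a(2) by simp
  qed
  ultimately show "b \<in> lead (Suc n) J"
    using m_mult_pow[OF x_in_m ap] a(2) unfolding lead_def by blast
qed

abbreviation colead :: "(nat \<Rightarrow> 'a set) set \<Rightarrow> nat \<Rightarrow> nat" where
  "colead J n \<equiv> ell (lead n J) (pow n)"

lemma colead_Suc_le:
  assumes J: "ideal J G" and n: "r \<le> n" shows "colead J (Suc n) \<le> colead J n"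
proof -
  note sJ = ideal_submodule_GM[OF J]
  have X: "ideal (x <# lead n J) A" by (rule ideal_l_coset[OF lead_ideal[OF sJ] x_carrier])
  have "pow (Suc (Suc n)) \<subseteq> x <# lead n J"
    using reduction[of "Suc n"] n pow_subset_lead[OF sJ, of n] by (auto simp: l_coset_def)
  then have cX: "cofinite_ideal (x <# lead n J)" using X unfolding cofinite_ideal_def by blast
  have "ell (x <# lead n J) (pow (Suc n)) = ell (x <# lead n J) (lead (Suc n) J) + ell (lead (Suc n) J) (pow (Suc n))"
    by (rule ell_add[OF cX lead_ideal[OF sJ] pow_ideal x_lead[OF J] lead_subset])
  moreover have "ell (x <# lead n J) (pow (Suc n)) = ell (lead n J) (pow n)"
    using ell_x_pow[OF lead_ideal[OF sJ, of n] pow_ideal[of n] lead_subset, of "Suc 0"] reduction[OF n] by simp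
  ultimately show ?thesis by simp
qed

lemma colead_antimono:
  assumes J: "ideal J G" and n: "r \<le> k" "k \<le> n" shows "colead J n \<le> colead J k"
  using n(2)
proof (induction n rule: dec_induct)
  case (step n)
  then show ?case using colead_Suc_le[OF J, of n] n(1) by simp
qed simp

lemma colead_subset:
  assumes J: "ideal J G" and K: "ideal K G" and sub: "J \<subseteq> K"
  shows "colead K n \<le> colead J n" and "colead K n = colead J n \<Longrightarrow> lead n K = lead n J"
proof -
  note sJ = ideal_submodule_GM[OF J] and sK = ideal_submodule_GM[OF K]
  have e: "colead J n = ell (lead n J) (lead n K) + colead K n"
    by (rule ell_add[OF lead_cofinite[OF sJ] lead_ideal[OF sK] pow_ideal lead_mono[OF sub] lead_subset])
  then show "colead K n \<le> colead J n" by simp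
  assume "colead K n = colead J n"
  then have "ell (lead n J) (lead n K) = 0" using e by simp
  then have "lead n J = lead n K"
    by (rule ell_eq_0D[OF lead_cofinite[OF sJ] lead_ideal[OF sK] lead_mono[OF sub]])
  then show "lead n K = lead n J" by (rule sym)
qed

lemma ideal_eq_of_lead_eq:
  assumes J: "ideal J G" and K: "ideal K G" and sub: "J \<subseteq> K" and eq: "\<And>n. lead n K = lead n J"
  shows "K \<subseteq> J"
proof -
  note sJ = ideal_submodule_GM[OF J] and sK = ideal_submodule_GM[OF K]
  have "below n \<inter> K \<subseteq> J" for n
  proof (induction n)
    case 0
    show ?case using GM.submodule_zero[OF sJ] by (auto simp: below_0)
  next
    case (Suc n)
    show ?case
    proof
      fix f assume "f \<in> below (Suc n) \<inter> K"
      then have "f \<in> K" "f \<in> below (Suc n)" by auto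
      then show "f \<in> J" by (rule lead_step[OF sJ Suc sK sub]) (simp add: eq)
    qed
  qed
  then show ?thesis using below_exists ideal.Icarr[OF K] by blast
qed

text \<open>The colengths \<open>colead\<close> do not increase when an ideal is enlarged, nor, for a fixed ideal, with the degree
from \<open>r\<close> on. Among the finitely generated subideals of \<open>J\<close> and the degrees \<open>\<ge> r\<close> choose \<open>S0\<close> and
\<open>n0\<close> with the least colength: no larger finite set lowers any colength in degrees from \<open>n0\<close> on. Then
enlarge \<open>S0\<close> to \<open>S1\<close> so as to minimize the colengths in the finitely many degrees below \<open>n0\<close> as well.
Another generator changes no leading coefficients, hence not the ideal.\<close>

lemma noetherian_G: "noetherian_ring G"
proof (rule G.noetherian_ringI)
  fix J assume J: "ideal J G"
  have Jc: "J \<subseteq> carrier G" by (rule G.ideal_subset[OF J])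
  define fin where "fin = {S. finite S \<and> S \<subseteq> J}"
  let ?I = "\<lambda>S. Idl\<^bsub>G\<^esub> S"
  have I: "ideal (?I S) G" and IJ: "?I S \<subseteq> J" if "S \<in> fin" for S
    using that Jc G.genideal_ideal[of S] G.genideal_minimal[OF J, of S] unfolding fin_def by auto
  have mono: "?I S \<subseteq> ?I S'" if "S \<subseteq> S'" "S' \<in> fin" for S S'
    using G.subset_Idl_subset[OF _ that(1)] that(2) Jc unfolding fin_def by blast
  have "\<exists>p. fst p \<in> fin \<and> r \<le> snd p"
    by (rule HOL.exI[of _ "({}, r)"]) (simp add: fin_def)
  then obtain p where p: "fst p \<in> fin" "r \<le> snd p"
    and pmin: "\<And>q. fst q \<in> fin \<Longrightarrow> r \<le> snd q \<Longrightarrow> colead (?I (fst p)) (snd p) \<le> colead (?I (fst q)) (snd q)"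
    using ex_has_least_nat[of "\<lambda>p. fst p \<in> fin \<and> r \<le> snd p" _ "\<lambda>p. colead (?I (fst p)) (snd p)"] by blast
  \<comment> \<open>\<open>n0\<close> is the degree from which on no finite superset of \<open>S0\<close> has smaller colengths\<close>
  define S0 n0 where "S0 = fst p" and "n0 = snd p"
  have S0: "S0 \<in> fin" and n0: "r \<le> n0" using p by (simp_all add: S0_def n0_def)
  have min0: "colead (?I S0) n0 \<le> colead (?I S) n" if "S \<in> fin" "r \<le> n" for S n
    using pmin[of "(S, n)"] that by (simp add: S0_def n0_def)
  obtain S1 where S1: "S1 \<in> fin" "S0 \<subseteq> S1"
    and min1: "\<And>S. S \<in> fin \<Longrightarrow> S0 \<subseteq> S \<Longrightarrow> (\<Sum>n<n0. colead (?I S1) n) \<le> (\<Sum>n<n0. colead (?I S) n)"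
    using ex_has_least_nat[of "\<lambda>S. S \<in> fin \<and> S0 \<subseteq> S" S0 "\<lambda>S. \<Sum>n<n0. colead (?I S) n"] S0 by blast
  have "J \<subseteq> ?I S1"
  proof
    fix g assume g: "g \<in> J"
    let ?S = "insert g S1"
    have S: "?S \<in> fin" using g S1(1) by (simp add: fin_def)
    have sub: "?I S1 \<subseteq> ?I ?S" by (rule mono[OF _ S]) blast
    have sub0: "?I S0 \<subseteq> ?I S1" by (rule mono[OF S1(2,1)])
    note le = colead_subset(1)[OF I[OF S1(1)] I[OF S] sub]
    have "colead (?I ?S) n = colead (?I S1) n" for n
    proof (cases "n < n0")
      case True
      have "(\<Sum>n<n0. colead (?I ?S) n) \<le> (\<Sum>n<n0. colead (?I S1) n)" by (rule ordered_comm_monoid_add_class.sum_mono) (rule le)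
      moreover have "(\<Sum>n<n0. colead (?I S1) n) \<le> (\<Sum>n<n0. colead (?I ?S) n)"
        by (rule min1[OF S]) (use S1(2) in blast)
      ultimately have "(\<Sum>n<n0. colead (?I ?S) n) = (\<Sum>n<n0. colead (?I S1) n)" by (rule antisym)
      then show ?thesis by (rule sum_mono_inv) (use le True in auto)
    next
      case False
      then have n: "r \<le> n" "n0 \<le> n" using n0 by auto
      have "colead (?I S1) n \<le> colead (?I S0) n" by (rule colead_subset(1)[OF I[OF S0] I[OF S1(1)] sub0])
      also have "\<dots> \<le> colead (?I S0) n0" by (rule colead_antimono[OF I[OF S0] n0 n(2)])
      also have "\<dots> \<le> colead (?I ?S) n" by (rule min0[OF S n(1)])
      finally show ?thesis using le[of n] by simp
    qed
    then have "?I ?S \<subseteq> ?I S1"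
      by (intro ideal_eq_of_lead_eq[OF I[OF S1(1)] I[OF S] sub] colead_subset(2)[OF I[OF S1(1)] I[OF S] sub])
    moreover have "g \<in> ?I ?S" using G.genideal_self[of ?S] S Jc unfolding fin_def by blast
    ultimately show "g \<in> ?I S1" by blast
  qed
  then have "J = ?I S1" using IJ[OF S1(1)] by blast
  moreover have "finite S1" "S1 \<subseteq> carrier G" using S1(1) Jc unfolding fin_def by auto
  ultimately show "\<exists>S\<subseteq>carrier G. finite S \<and> J = Idl\<^bsub>G\<^esub> S" by blast
qed

text \<open>If \<open>g = x\<^sup>* u g\<close>, then \<open>g\<close> has no components in degrees below \<open>n\<close>, for every \<open>n\<close>.\<close>

lemma nzd_of_one_minus_xs:
  assumes u: "u \<in> carrier G" shows "\<one>\<^bsub>G\<^esub> \<ominus>\<^bsub>G\<^esub> xs \<otimes>\<^bsub>G\<^esub> u \<in> nonzerodivisors G"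
  unfolding nonzerodivisors_def
proof (intro CollectI conjI ballI impI)
  show "\<one>\<^bsub>G\<^esub> \<ominus>\<^bsub>G\<^esub> xs \<otimes>\<^bsub>G\<^esub> u \<in> carrier G" using u by simp
  fix g assume g: "g \<in> carrier G" and z: "(\<one>\<^bsub>G\<^esub> \<ominus>\<^bsub>G\<^esub> xs \<otimes>\<^bsub>G\<^esub> u) \<otimes>\<^bsub>G\<^esub> g = \<zero>\<^bsub>G\<^esub>"
  have "(\<one>\<^bsub>G\<^esub> \<ominus>\<^bsub>G\<^esub> xs \<otimes>\<^bsub>G\<^esub> u) \<otimes>\<^bsub>G\<^esub> g = g \<ominus>\<^bsub>G\<^esub> xs \<otimes>\<^bsub>G\<^esub> u \<otimes>\<^bsub>G\<^esub> g"
    using u g by (simp add: G.minus_eq G.l_distr G.l_minus)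
  then have "g \<ominus>\<^bsub>G\<^esub> xs \<otimes>\<^bsub>G\<^esub> u \<otimes>\<^bsub>G\<^esub> g = \<zero>\<^bsub>G\<^esub>" using z by simp
  then have eq: "g = xs \<otimes>\<^bsub>G\<^esub> u \<otimes>\<^bsub>G\<^esub> g"
    using G.r_right_minus_eq[of g "xs \<otimes>\<^bsub>G\<^esub> u \<otimes>\<^bsub>G\<^esub> g"] u g by simp
  have "xs \<in> above 1" unfolding in_above_1_iff initial_form_eq using cls_closed[OF x_in_pow] by (simp add: cls_def)
  then have xu: "xs \<otimes>\<^bsub>G\<^esub> u \<in> above 1" by (rule ideal.I_r_closed[OF ideal_above _ u])
  have "g \<in> above n" for n
  proof (induction n)
    case 0 show ?case using g by (simp add: above_0)
  next
    case (Suc n)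
    have "xs \<otimes>\<^bsub>G\<^esub> u \<otimes>\<^bsub>G\<^esub> g \<in> above (1 + n)" by (rule above_mult[OF xu Suc])
    then show ?case using eq by simp
  qed
  then show "g = \<zero>\<^bsub>G\<^esub>" by (rule above_all_zero)
qed

text \<open>For the direction from right to left: a maximal ideal that does not contain the initial form \<open>x\<^sup>*\<close>
contains an element \<open>1 - x\<^sup>* u\<close>.\<close>

theorem cohen_macaulay_iff_regular: "cohen_macaulay_ring G \<longleftrightarrow> regular_initial_form"
proof
  show "cohen_macaulay_ring G \<Longrightarrow> regular_initial_form" by (rule regular_of_cohen_macaulay)
  assume reg: regular_initial_form
  show "cohen_macaulay_ring G"
  proof (rule G.cohen_macaulay_ringI[OF noetherian_G powers_stop_G])
    fix P assume P: "maximalideal P G"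
    interpret P: maximalideal P G by fact
    show "\<exists>y\<in>P. y \<in> nonzerodivisors G"
    proof (cases "xs \<in> P")
      case True
      have "xs \<in> nonzerodivisors G" unfolding nonzerodivisors_def
        using reg unfolding regular_initial_form_iff using xs_closed by blast
      then show ?thesis using True by blast
    next
      case False
      have I: "ideal (P <+>\<^bsub>G\<^esub> PIdl\<^bsub>G\<^esub> xs) G"
        by (rule G.add_ideals[OF P.is_ideal G.cgenideal_ideal[OF xs_closed]])
      note up = G.set_add_ideal_upper[OF P.is_ideal G.cgenideal_ideal[OF xs_closed]]
      have "xs \<in> P <+>\<^bsub>G\<^esub> PIdl\<^bsub>G\<^esub> xs" using up(2) G.cgenideal_self[OF xs_closed] by blast
      then have "P <+>\<^bsub>G\<^esub> PIdl\<^bsub>G\<^esub> xs = carrier G"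
        using P.I_maximal[OF I up(1) G.ideal_subset[OF I]] False by blast
      then have "\<one>\<^bsub>G\<^esub> \<in> P <+>\<^bsub>G\<^esub> PIdl\<^bsub>G\<^esub> xs" by simp
      then obtain p u where pu: "p \<in> P" "u \<in> carrier G" "\<one>\<^bsub>G\<^esub> = p \<oplus>\<^bsub>G\<^esub> u \<otimes>\<^bsub>G\<^esub> xs"
        unfolding set_add_def' cgenideal_def by blast
      have "\<one>\<^bsub>G\<^esub> \<ominus>\<^bsub>G\<^esub> xs \<otimes>\<^bsub>G\<^esub> u = p"
        unfolding pu(3) using P.Icarr[OF pu(1)] pu(2) by (simp add: G.minus_eq G.a_assoc G.r_neg G.m_comm)
      then show ?thesis using nzd_of_one_minus_xs[OF pu(2)] pu(1) by auto
    qed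
  qed
qed

end

section \<open>The Hilbert function as a number of coordinates\<close>

context reduction_ring
begin

text \<open>Linear algebra over the residue field, phrased with ideals. The sets \<open>Z s\<close> play the role of the kernels
  of coordinate functions on \<open>m\<^sup>n/m\<^sup>n\<^sup>+\<^sup>1\<close>: by \<open>all\<close> they separate points, by \<open>line\<close> each function has values
  in a line, and by \<open>ind\<close> the functions are independent. Releasing the conditions one after another
  gives a chain from \<open>m\<^sup>n\<^sup>+\<^sup>1\<close> to \<open>m\<^sup>n\<close> with simple steps.\<close>

lemma hilb_eq_card:
  assumes fin: "finite S" and Z: "\<And>s. s \<in> S \<Longrightarrow> ideal (Z s) A"
    and all: "{a \<in> pow n. \<forall>s\<in>S. a \<in> Z s} = pow (Suc n)"
    and line: "\<And>s a b. s \<in> S \<Longrightarrow> a \<in> pow n \<Longrightarrow> a \<notin> Z s \<Longrightarrow> b \<in> pow n \<Longrightarrow> \<exists>c\<in>carrier A. b \<oplus> c \<otimes> a \<in> Z s"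
    and ind: "\<And>s. s \<in> S \<Longrightarrow> \<exists>a\<in>pow n. a \<notin> Z s \<and> (\<forall>t\<in>S. t \<noteq> s \<longrightarrow> a \<in> Z t)"
  shows "hilb n = card S"
proof -
  \<comment> \<open>only the conditions outside \<open>T\<close> are imposed\<close>
  define N where "N T = {a \<in> pow n. \<forall>s\<in>S - T. a \<in> Z s}" for T
  have Nid: "ideal (N T) A" for T
  proof -
    show ?thesis
    proof (rule idealI_cring)
      show "N T \<subseteq> carrier A" using pow_carrier by (auto simp: N_def)
      have "\<zero> \<in> Z s" if "s \<in> S" for s by (rule additive_subgroup.zero_closed[OF ideal.axioms(1)[OF Z[OF that]]])
      then show "\<zero> \<in> N T" using pow_zero_closed by (simp add: N_def)
      fix a b assume ab: "a \<in> N T" "b \<in> N T"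
      have "a \<oplus> b \<in> Z s" if "s \<in> S - T" for s
        using additive_subgroup.a_closed[OF ideal.axioms(1)[OF Z]] that ab by (simp add: N_def)
      then show "a \<oplus> b \<in> N T" using ab pow_add_closed by (simp add: N_def)
    next
      fix c a assume c: "c \<in> carrier A" and a: "a \<in> N T"
      have "c \<otimes> a \<in> Z s" if "s \<in> S - T" for s
        using ideal.I_l_closed[OF Z _ c] that a by (simp add: N_def)
      then show "c \<otimes> a \<in> N T" using a ideal.I_l_closed[OF pow_ideal _ c] by (simp add: N_def)
    qed
  qed
  have Nmono: "N T \<subseteq> N T'" if "T \<subseteq> T'" for T T' using that by (auto simp: N_def)
  have N0: "N {} = pow (Suc n)" using all by (simp add: N_def)
  have step: "ell (N T) (N (insert s T)) = 1" if s: "s \<in> S" "s \<notin> T" for s T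
  proof -
    obtain a where a: "a \<in> pow n" "a \<notin> Z s" "\<forall>t\<in>S. t \<noteq> s \<longrightarrow> a \<in> Z t" using ind[OF s(1)] by blast
    have "a \<in> N (insert s T)" "a \<notin> N T" using a s by (auto simp: N_def)
    then have ss: "N T \<subset> N (insert s T)" using Nmono[of T "insert s T"] by blast
    have "ilen (N T) (N (insert s T)) = 1"
    proof (rule ilen_covering[OF Nid Nid ss])
      fix U u assume U: "ideal U A" "N T \<subseteq> U" "U \<subseteq> N (insert s T)" and u: "u \<in> U" "u \<notin> N T"
      have uN: "u \<in> N (insert s T)" using U(3) u(1) by blast
      have un: "u \<in> pow n" "u \<notin> Z s" using uN u(2) by (auto simp: N_def)
      show "N (insert s T) \<subseteq> U"
      proof
        fix b assume b: "b \<in> N (insert s T)"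
        then have bn: "b \<in> pow n" by (simp add: N_def)
        obtain c where c: "c \<in> carrier A" "b \<oplus> c \<otimes> u \<in> Z s" using line[OF s(1) un bn] by blast
        have cuU: "c \<otimes> u \<in> U" by (rule ideal.I_l_closed[OF U(1) u(1) c(1)])
        have "c \<otimes> u \<in> N (insert s T)" using cuU U(3) by blast
        then have bc: "b \<oplus> c \<otimes> u \<in> N (insert s T)"
          by (rule additive_subgroup.a_closed[OF ideal.axioms(1)[OF Nid] b])
        have "b \<oplus> c \<otimes> u \<in> N T" using bc c(2) s by (auto simp: N_def)
        then have "c \<otimes> u \<oplus> b \<in> U"
          using U(2) a_comm[OF pow_carrier[OF bn] ideal.Icarr[OF U(1) cuU]] by auto
        then show "b \<in> U" by (rule ideal_diff_mem[OF U(1) pow_carrier[OF bn] cuU])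
      qed
    qed
    then show ?thesis by (simp add: ell_def one_enat_def)
  qed
  have "ell (pow (Suc n)) (N T) = card T" if "T \<subseteq> S" for T
  proof -
    have "finite T" using that fin by (rule finite_subset)
    then show ?thesis using that
    proof (induction T rule: finite_induct)
      case empty
      show ?case by (simp add: N0 ell_refl[OF pow_ideal])
    next
      case (insert s T)
      have "ell (pow (Suc n)) (N (insert s T)) = ell (pow (Suc n)) (N T) + ell (N T) (N (insert s T))"
        by (rule ell_add[OF cofinite_pow Nid Nid])
          (use Nmono[of "{}" T] Nmono[of T "insert s T"] in \<open>auto simp: N0\<close>)
      then show ?case using insert step[of s T] by simp
    qed
  qed
  moreover have "N S = pow n" by (simp add: N_def)
  ultimately show ?thesis by fastforce
qed

section \<open>The fiber cone\<close>

abbreviation F :: "(nat \<Rightarrow> 'a set) ring" where "F \<equiv> fiber_cone A m x"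
abbreviation FC :: "(nat \<Rightarrow> 'a set) set" where "FC \<equiv> carrier F"

lemma F_simps [simp]:
  "monoid.mult F = monoid.mult G" "add F = add G" "ring.zero F = ring.zero G" "one F = one G"
  by (simp_all add: fiber_cone_def)

lemma F_eq: "F = G\<lparr>carrier := FC\<rparr>" by (simp add: fiber_cone_def)

lemma xn_ideal: "ideal (x [^] (n::nat) <# carrier A) A" by (rule ideal_l_coset[OF oneideal x_pow_carrier])

lemma xn_zero: "\<zero> \<in> x [^] (n::nat) <# carrier A"
  by (rule additive_subgroup.zero_closed[OF ideal.axioms(1)[OF xn_ideal]])

lemma FC_subset: "FC \<subseteq> carrier G" by (auto simp: fiber_cone_def)

lemma FCI:
  assumes p: "p \<in> rees" and x: "\<And>n. p n \<in> x [^] n <# carrier A" shows "form p \<in> FC"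
proof -
  have "form p n \<in> (\<lambda>a. pow (Suc n) +> (x [^] n \<otimes> a)) ` carrier A" for n
    using x[of n] by (auto simp: form_def elim!: l_cosetE)
  then show ?thesis using form_in_G[OF p] by (simp add: fiber_cone_def)
qed

lemma FCE:
  assumes "f \<in> FC"
  obtains p where "p \<in> rees" "f = form p" "\<And>n. p n \<in> x [^] n <# carrier A"
proof (rule form_of_cosets[of f "\<lambda>n. x [^] n <# carrier A"])
  show "f \<in> carrier G" using assms FC_subset by blast
  show "f n \<in> (\<lambda>a. pow (Suc n) +> a) ` (x [^] n <# carrier A)" for n
  proof -
    have "f n \<in> (\<lambda>a. pow (Suc n) +> (x [^] n \<otimes> a)) ` carrier A" using assms by (auto simp: fiber_cone_def)
    then obtain a where "f n = pow (Suc n) +> (x [^] n \<otimes> a)" "a \<in> carrier A" by (rule imageE)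
    then show ?thesis by (rule image_eqI[OF _ l_cosetI])
  qed
  show "x [^] n <# carrier A \<subseteq> pow n" for n by (rule x_pow_l_coset_subset)
qed (rule xn_zero, rule that)

lemma form_uminus: assumes p: "p \<in> rees" shows "\<ominus>\<^bsub>G\<^esub> form p = form (\<lambda>n. \<ominus> p n)"
proof -
  have "(\<lambda>n. \<ominus> p n) \<oplus>\<^bsub>UP A\<^esub> p = (\<lambda>n. \<zero>)"
    using rees_add[OF rees_uminus[OF p] p] rees_carrier[OF p] by (simp add: l_neg)
  then have "form (\<lambda>n. \<ominus> p n) \<oplus>\<^bsub>G\<^esub> form p = \<zero>\<^bsub>G\<^esub>"
    unfolding form_add[OF rees_uminus[OF p] p] form_zero[symmetric] by (rule arg_cong)
  then show ?thesis by (rule G.minus_equality) (rule form_in_G[OF p] form_in_G[OF rees_uminus[OF p]])+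
qed

lemma FC_subring: "subring FC G"
proof (rule G.subringI[OF FC_subset])
  have "(if n = 0 then \<one> else \<zero>) \<in> x [^] n <# carrier A" for n :: nat
    using l_cosetI[OF one_closed, of \<one>] xn_zero[of n] by (cases n) simp_all
  then show "\<one>\<^bsub>G\<^esub> \<in> FC" unfolding form_one[symmetric] by (intro FCI[OF rees_one]) (simp add: UP_one)
  fix f assume f: "f \<in> FC"
  obtain p where p: "p \<in> rees" "f = form p" "\<And>n. p n \<in> x [^] n <# carrier A" using FCE[OF f] by metis
  show "\<ominus>\<^bsub>G\<^esub> f \<in> FC" unfolding p(2) form_uminus[OF p(1)]
    by (rule FCI[OF rees_uminus[OF p(1)]]) (rule additive_subgroup.a_inv_closed[OF ideal.axioms(1)[OF xn_ideal] p(3)])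
  fix g assume g: "g \<in> FC"
  obtain q where q: "q \<in> rees" "g = form q" "\<And>n. q n \<in> x [^] n <# carrier A" using FCE[OF g] by metis
  show "f \<oplus>\<^bsub>G\<^esub> g \<in> FC" unfolding p(2) q(2) form_add[OF p(1) q(1)]
    by (rule FCI[OF rees_add_closed[OF p(1) q(1)]], unfold rees_add[OF p(1) q(1)])
      (rule additive_subgroup.a_closed[OF ideal.axioms(1)[OF xn_ideal] p(3) q(3)])
  have "p i \<otimes> q (n - i) \<in> x [^] n <# carrier A" if i: "i \<le> n" for i n
  proof -
    obtain a where a: "a \<in> carrier A" "p i = x [^] i \<otimes> a" using p(3)[of i] by (rule l_cosetE)
    obtain b where b: "b \<in> carrier A" "q (n - i) = x [^] (n - i) \<otimes> b" using q(3)[of "n - i"] by (rule l_cosetE)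
    have "p i \<otimes> q (n - i) = (x [^] i \<otimes> x [^] (n - i)) \<otimes> (a \<otimes> b)" unfolding a(2) b(2) using a(1) b(1) by (simp add: m_ac)
    also have "x [^] i \<otimes> x [^] (n - i) = x [^] n" using i by (simp add: nat_pow_mult)
    finally show ?thesis using l_cosetI[of "a \<otimes> b" "carrier A" "x [^] n"] a(1) b(1) by simp
  qed
  then have "(\<Oplus>i\<in>{..n}. p i \<otimes> q (n - i)) \<in> x [^] n <# carrier A" for n
    by (intro finsum_in_ideal[OF xn_ideal]) auto
  then show "f \<otimes>\<^bsub>G\<^esub> g \<in> FC" unfolding p(2) q(2) form_mult[OF p(1) q(1)]
    by (intro FCI[OF rees_mult_closed[OF p(1) q(1)]]) (simp add: rees_mult[OF p(1) q(1)])
qed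

lemma F_cring: "cring F"
  using G.subcring_iff[OF FC_subset] G.subcringI'[OF FC_subring] F_eq by simp

sublocale F: cring F by (rule F_cring)

lemma xn_in_pow: "a \<in> carrier A \<Longrightarrow> x [^] n \<otimes> a \<in> pow n"
  by (rule ideal.I_r_closed[OF pow_ideal x_pow_in_pow])

lemma cls_xn_FC [simp]: "a \<in> carrier A \<Longrightarrow> cls n (x [^] n \<otimes> a) \<in> FC"
  unfolding cls_eq_form
  by (rule FCI[OF monomial_rees[OF xn_in_pow]]) (use xn_zero in \<open>auto simp: monomial_def intro: l_cosetI\<close>)

lemma cls_0_FC [simp]: "c \<in> carrier A \<Longrightarrow> cls 0 c \<in> FC"
  using cls_xn_FC[of c 0] by simp

lemma xs_FC [simp]: "xs \<in> FC" using cls_xn_FC[of \<one> "Suc 0"] by (simp add: initial_form_eq)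

lemma homogeneous_eq: "homogeneous A m n = cls n ` pow n"
proof
  show "cls n ` pow n \<subseteq> homogeneous A m n"
    using cls_closed[of _ n] by (auto simp: homogeneous_def cls_def)
  show "homogeneous A m n \<subseteq> cls n ` pow n"
  proof
    fix f assume "f \<in> homogeneous A m n"
    then have f: "f \<in> carrier G" "\<And>k. k \<noteq> n \<Longrightarrow> f k = pow (Suc k)" by (auto simp: homogeneous_def)
    have "f n \<in> (\<lambda>a. pow (Suc n) +> a) ` pow n" using f(1) by (simp add: tangent_cone_def)
    then obtain a where a: "a \<in> pow n" "f n = pow (Suc n) +> a" by blast
    have "f = cls n a" using f(2) a(2) by (auto simp: cls_def fun_eq_iff)
    then show "f \<in> cls n ` pow n" using a(1) by blast
  qed
qed

lemma FC_homogeneous: "FC \<inter> homogeneous A m n = (\<lambda>a. cls n (x [^] n \<otimes> a)) ` carrier A"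
proof
  show "(\<lambda>a. cls n (x [^] n \<otimes> a)) ` carrier A \<subseteq> FC \<inter> homogeneous A m n"
    using cls_xn_FC xn_in_pow unfolding homogeneous_eq by blast
  show "FC \<inter> homogeneous A m n \<subseteq> (\<lambda>a. cls n (x [^] n \<otimes> a)) ` carrier A"
  proof
    fix f assume f: "f \<in> FC \<inter> homogeneous A m n"
    then have "f n \<in> (\<lambda>a. pow (Suc n) +> (x [^] n \<otimes> a)) ` carrier A" by (simp add: fiber_cone_def)
    then obtain a where a: "a \<in> carrier A" "f n = pow (Suc n) +> (x [^] n \<otimes> a)" by blast
    have "f = cls n (x [^] n \<otimes> a)" using f a(2) by (auto simp: homogeneous_def cls_def fun_eq_iff)
    then show "f \<in> (\<lambda>a. cls n (x [^] n \<otimes> a)) ` carrier A" using a(1) by blast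
  qed
qed

text \<open>The homogeneous part of degree \<open>n\<close> of the fiber cone is a copy of the residue field, spanned by the class
of \<open>x\<^sup>n\<close>.\<close>

lemma cls_xn_zero_iff: "a \<in> carrier A \<Longrightarrow> cls n (x [^] n \<otimes> a) = \<zero>\<^bsub>G\<^esub> \<longleftrightarrow> a \<in> m"
  unfolding cls_eq_zero_iff[OF xn_in_pow]
proof
  assume a: "a \<in> carrier A"
  show "x [^] n \<otimes> a \<in> pow (Suc n) \<Longrightarrow> a \<in> m" by (rule x_pow_mult_in_powD[OF a])
  show "a \<in> m \<Longrightarrow> x [^] n \<otimes> a \<in> pow (Suc n)" using m_mult_pow[OF _ x_pow_in_pow, of a n] a by (simp add: m_comm)
qed

lemma cls_0_mult_xn:
  "c \<in> carrier A \<Longrightarrow> a \<in> carrier A \<Longrightarrow> cls 0 c \<otimes>\<^bsub>G\<^esub> cls n (x [^] n \<otimes> a) = cls n (x [^] n \<otimes> (c \<otimes> a))"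
  using cls_mult[of c 0 "x [^] n \<otimes> a" n] xn_in_pow by (simp add: m_lcomm)

lemma cls_add_xn:
  "a \<in> carrier A \<Longrightarrow> b \<in> carrier A \<Longrightarrow>
    cls n (x [^] n \<otimes> a) \<oplus>\<^bsub>G\<^esub> cls n (x [^] n \<otimes> b) = cls n (x [^] n \<otimes> (a \<oplus> b))"
  using cls_add[OF xn_in_pow xn_in_pow, of a b n] by (simp add: r_distr)

lemma cls_zero: "cls n \<zero> = \<zero>\<^bsub>G\<^esub>"
  using cls_eq_zero_iff[OF pow_zero_closed] pow_zero_closed by blast

text \<open>The fiber cone is a polynomial ring in the initial form of \<open>x\<close>: a unit multiple of \<open>x\<^sup>n\<^sup>+\<^sup>1\<close> does not lie in
\<open>m\<^sup>n\<^sup>+\<^sup>2\<close>.\<close>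

lemma xs_mult_FC_zeroD:
  assumes f: "f \<in> FC" and z: "xs \<otimes>\<^bsub>G\<^esub> f = \<zero>\<^bsub>G\<^esub>" shows "f = \<zero>\<^bsub>G\<^esub>"
proof -
  obtain p where p: "p \<in> rees" "f = form p" "\<And>n. p n \<in> x [^] n <# carrier A" using FCE[OF f] by metis
  have z': "form (\<lambda>n. if Suc 0 \<le> n then x \<otimes> p (n - Suc 0) else \<zero>) = \<zero>\<^bsub>G\<^esub>"
    using z cls_mult_form[OF x_in_pow p(1)] by (simp add: initial_form_eq p(2))
  have "p n \<in> pow (Suc n)" for n
  proof -
    obtain a where a: "a \<in> carrier A" "p n = x [^] n \<otimes> a" using p(3)[of n] by (rule l_cosetE)
    have "pow (Suc (Suc n)) +> (x \<otimes> p n) = pow (Suc (Suc n))"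
      using fun_cong[OF z', of "Suc n"] by (simp add: form_def zero_G)
    then have "x \<otimes> p n \<in> pow (Suc (Suc n))"
      using coset_zero_iff[OF pow_ideal] rees_carrier[OF p(1)] by simp
    then have "x [^] Suc n \<otimes> a \<in> pow (Suc (Suc n))" unfolding a(2) using a(1) by (simp add: m_ac)
    then have "a \<in> m" by (rule x_pow_mult_in_powD[OF a(1)])
    then show ?thesis unfolding a(2) using m_mult_pow[OF _ x_pow_in_pow, of a n] a(1) by (simp add: m_comm)
  qed
  then show ?thesis unfolding p(2) zero_G using form_zero_iff[OF p(1)] by (intro HOL.ext) simp
qed

abbreviation xs_ideal :: "nat \<Rightarrow> (nat \<Rightarrow> 'a set) set" where "xs_ideal j \<equiv> PIdl\<^bsub>F\<^esub> (xs [^]\<^bsub>F\<^esub> j)"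

lemma xs_pow_F: "xs [^]\<^bsub>F\<^esub> j = cls j (x [^] (j::nat))"
proof (induction j)
  case 0 show ?case by (simp add: cls_one)
next
  case (Suc j)
  then show ?case using cls_mult[OF x_pow_in_pow[of j] x_in_pow] by (simp add: initial_form_eq)
qed

lemma ideal_xs_ideal: "ideal (xs_ideal j) F" by (rule F.cgenideal_ideal) simp

lemma xs_ideal_vanish:
  assumes "f \<in> xs_ideal j" shows "f \<in> above j"
proof -
  obtain g where g: "g \<in> FC" "f = g \<otimes>\<^bsub>G\<^esub> cls j (x [^] j)"
    using assms unfolding cgenideal_def xs_pow_F by auto
  have "cls j (x [^] j) \<in> above j" using cls_closed[OF x_pow_in_pow, of j] by (simp add: above_def cls_def)
  moreover have "g \<in> above 0" using g(1) FC_subset above_0 by blast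
  ultimately show ?thesis unfolding g(2) using above_mult[of g 0 _ j] by simp
qed

text \<open>The quotient of the fiber cone by the \<open>j\<close>-th power of the initial form is a copy of the residue field in
each degree below \<open>j\<close>, and zero in the other degrees.\<close>

lemma cls_xs_ideal_iff:
  assumes a: "a \<in> carrier A"
  shows "cls n (x [^] n \<otimes> a) \<in> xs_ideal j \<longleftrightarrow> j \<le> n \<or> a \<in> m"
proof (cases "j \<le> n")
  case True
  have "cls (n - j) (x [^] (n - j) \<otimes> a) \<otimes>\<^bsub>G\<^esub> cls j (x [^] j) = cls n ((x [^] (n - j) \<otimes> a) \<otimes> x [^] j)"
    using cls_mult[OF xn_in_pow[OF a] x_pow_in_pow, of "n - j" j] True by simp
  also have "(x [^] (n - j) \<otimes> a) \<otimes> x [^] j = (x [^] (n - j) \<otimes> x [^] j) \<otimes> a" using a by (simp add: m_ac)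
  also have "x [^] (n - j) \<otimes> x [^] j = x [^] n" using True by (simp add: nat_pow_mult)
  finally have "cls n (x [^] n \<otimes> a) = cls (n - j) (x [^] (n - j) \<otimes> a) \<otimes>\<^bsub>G\<^esub> cls j (x [^] j)" by (rule sym)
  then have "cls n (x [^] n \<otimes> a) \<in> xs_ideal j" unfolding cgenideal_def xs_pow_F using cls_xn_FC[OF a, of "n - j"] by auto
  then show ?thesis using True by simp
next
  case False
  show ?thesis
  proof
    assume "cls n (x [^] n \<otimes> a) \<in> xs_ideal j"
    then have "cls n (x [^] n \<otimes> a) n = pow (Suc n)" using xs_ideal_vanish False by (auto simp: above_def)
    then have "cls n (x [^] n \<otimes> a) = \<zero>\<^bsub>G\<^esub>" unfolding cls_def zero_G by (intro HOL.ext) simp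
    then show "j \<le> n \<or> a \<in> m" using cls_xn_zero_iff[OF a] by blast
  next
    assume "j \<le> n \<or> a \<in> m"
    then have "cls n (x [^] n \<otimes> a) = \<zero>\<^bsub>G\<^esub>" using False cls_xn_zero_iff[OF a] by blast
    then show "cls n (x [^] n \<otimes> a) \<in> xs_ideal j"
      using additive_subgroup.zero_closed[OF ideal.axioms(1)[OF ideal_xs_ideal, of j]] by simp
  qed
qed

abbreviation residue :: "nat \<Rightarrow> (nat \<Rightarrow> 'a set) \<Rightarrow> (nat \<Rightarrow> 'a set) set" where "residue j f \<equiv> xs_ideal j +>\<^bsub>F\<^esub> f"

lemma residue_zero_iff: "f \<in> FC \<Longrightarrow> residue j f = xs_ideal j \<longleftrightarrow> f \<in> xs_ideal j"
  by (rule F.coset_zero_iff[OF ideal_xs_ideal])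

lemma residue_add: "f \<in> FC \<Longrightarrow> g \<in> FC \<Longrightarrow> residue j f <+>\<^bsub>F\<^esub> residue j g = residue j (f \<oplus>\<^bsub>G\<^esub> g)"
  using ideal.a_rcos_sum[OF ideal_xs_ideal] by simp

lemma residue_mult: "f \<in> FC \<Longrightarrow> g \<in> FC \<Longrightarrow> rcoset_mult F (xs_ideal j) (residue j f) (residue j g) = residue j (f \<otimes>\<^bsub>G\<^esub> g)"
  using ideal.rcoset_mult_add[OF ideal_xs_ideal] by simp

lemma residue_zero: "residue j \<zero>\<^bsub>G\<^esub> = xs_ideal j"
  using residue_zero_iff[of "\<zero>\<^bsub>G\<^esub>" j] F.zero_closed additive_subgroup.zero_closed[OF ideal.axioms(1)[OF ideal_xs_ideal, of j]] by simp

end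

section \<open>Decompositions of the tangent cone\<close>

text \<open>The map \<open>\<phi>\<close> is a graded isomorphism of \<open>G\<close> with a direct sum of copies of \<open>F(-i)\<close> for \<open>(i, k) \<in> S1\<close> and of
\<open>F/(x\<^sup>*)\<^sup>jF (-i)\<close> for \<open>(i, j, k) \<in> S2\<close>. The module operations of the sum are written out.\<close>

locale cone_decomposition = reduction_ring +
  fixes S1 :: "(nat \<times> nat) set" and S2 :: "(nat \<times> nat \<times> nat) set" and \<phi>
  assumes bij: "bij_betw \<phi> (carrier G) ((\<Pi>\<^sub>E s\<in>S1. FC) \<times> (\<Pi>\<^sub>E s\<in>S2. residue (fst (snd s)) ` FC))"
    and \<phi>_add: "\<And>u v. u \<in> carrier G \<Longrightarrow> v \<in> carrier G \<Longrightarrow> \<phi> (u \<oplus>\<^bsub>G\<^esub> v)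
      = (\<lambda>s\<in>S1. fst (\<phi> u) s \<oplus>\<^bsub>G\<^esub> fst (\<phi> v) s, \<lambda>s\<in>S2. snd (\<phi> u) s <+>\<^bsub>F\<^esub> snd (\<phi> v) s)"
    and \<phi>_lin: "\<And>a u. a \<in> FC \<Longrightarrow> u \<in> carrier G \<Longrightarrow> \<phi> (a \<otimes>\<^bsub>G\<^esub> u)
      = (\<lambda>s\<in>S1. a \<otimes>\<^bsub>G\<^esub> fst (\<phi> u) s,
         \<lambda>s\<in>S2. rcoset_mult F (xs_ideal (fst (snd s))) (residue (fst (snd s)) a) (snd (\<phi> u) s))"
    and \<phi>_deg: "\<And>n. \<phi> ` homogeneous A m n
      = (\<Pi>\<^sub>E s\<in>S1. if n < fst s then {\<zero>\<^bsub>G\<^esub>} else FC \<inter> homogeneous A m (n - fst s))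
        \<times> (\<Pi>\<^sub>E s\<in>S2. if n < fst s then {xs_ideal (fst (snd s))}
             else residue (fst (snd s)) ` (FC \<inter> homogeneous A m (n - fst s)))"
    and fin: "finite S1" "finite S2"
begin

text \<open>The zero of a torsion summand is the ideal \<open>xs_ideal j\<close> as a coset. Both kinds of summands are treated
  together through this predicate.\<close>

definition vanish :: "(nat \<times> nat) + (nat \<times> nat \<times> nat) \<Rightarrow> (nat \<Rightarrow> 'a set) \<Rightarrow> bool" where
  "vanish s u = (case s of Inl s \<Rightarrow> fst (\<phi> u) s = \<zero>\<^bsub>G\<^esub> | Inr s \<Rightarrow> snd (\<phi> u) s = xs_ideal (fst (snd s)))"

abbreviation summands where "summands \<equiv> Inl ` S1 \<union> Inr ` S2"

lemma \<phi>_closed: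
  assumes "u \<in> carrier G"
  shows "\<And>s. s \<in> S1 \<Longrightarrow> fst (\<phi> u) s \<in> FC" and "\<And>s. s \<in> S2 \<Longrightarrow> snd (\<phi> u) s \<in> residue (fst (snd s)) ` FC"
    and "fst (\<phi> u) \<in> extensional S1" and "snd (\<phi> u) \<in> extensional S2"
proof -
  have "\<phi> u \<in> (\<Pi>\<^sub>E s\<in>S1. FC) \<times> (\<Pi>\<^sub>E s\<in>S2. residue (fst (snd s)) ` FC)"
    using bij_betw_apply[OF bij assms] .
  then have 1: "fst (\<phi> u) \<in> (\<Pi>\<^sub>E s\<in>S1. FC)" and 2: "snd (\<phi> u) \<in> (\<Pi>\<^sub>E s\<in>S2. residue (fst (snd s)) ` FC)"
    by (simp_all add: mem_Times_iff)
  show "\<And>s. s \<in> S1 \<Longrightarrow> fst (\<phi> u) s \<in> FC" by (rule PiE_mem[OF 1])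
  show "\<And>s. s \<in> S2 \<Longrightarrow> snd (\<phi> u) s \<in> residue (fst (snd s)) ` FC" by (rule PiE_mem[OF 2])
  show "fst (\<phi> u) \<in> extensional S1" using 1 by (simp add: PiE_def)
  show "snd (\<phi> u) \<in> extensional S2" using 2 by (simp add: PiE_def)
qed

lemma vanish_add:
  assumes "u \<in> carrier G" "v \<in> carrier G" "s \<in> summands" "vanish s u" "vanish s v"
  shows "vanish s (u \<oplus>\<^bsub>G\<^esub> v)"
proof (cases s)
  case (Inl t)
  then show ?thesis using assms by (auto simp: vanish_def \<phi>_add)
next
  case (Inr t)
  have "xs_ideal j <+>\<^bsub>F\<^esub> xs_ideal j = xs_ideal j" for j
    using residue_add[OF F.zero_closed F.zero_closed, of j] residue_zero[of j] by simp
  then show ?thesis using assms Inr by (auto simp: vanish_def \<phi>_add)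
qed

lemma vanish_mult:
  assumes a: "a \<in> FC" and u: "u \<in> carrier G" and s: "s \<in> summands" and v: "vanish s u"
  shows "vanish s (a \<otimes>\<^bsub>G\<^esub> u)"
proof (cases s)
  case (Inl t)
  have "a \<in> carrier G" using a FC_subset by blast
  then show ?thesis using Inl s v by (auto simp: vanish_def \<phi>_lin[OF a u])
next
  case (Inr t)
  have "rcoset_mult F (xs_ideal j) (residue j a) (xs_ideal j) = xs_ideal j" for j
  proof -
    have "a \<otimes>\<^bsub>G\<^esub> \<zero>\<^bsub>G\<^esub> = \<zero>\<^bsub>G\<^esub>" using a FC_subset by (intro G.r_null) blast
    then show ?thesis using residue_mult[OF a F.zero_closed, of j] residue_zero[of j] by simp
  qed
  then show ?thesis using Inr s v by (auto simp: vanish_def \<phi>_lin[OF a u])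
qed

lemma vanish_zero: assumes s: "s \<in> summands" shows "vanish s \<zero>\<^bsub>G\<^esub>"
proof -
  have zF: "\<zero>\<^bsub>G\<^esub> \<in> FC" using F.zero_closed by simp
  have zz: "\<zero>\<^bsub>G\<^esub> \<otimes>\<^bsub>G\<^esub> \<zero>\<^bsub>G\<^esub> = \<zero>\<^bsub>G\<^esub>" by simp
  show ?thesis
proof (cases s)
    case (Inl t)
    then have t: "t \<in> S1" using s by auto
    have c: "fst (\<phi> \<zero>\<^bsub>G\<^esub>) t \<in> carrier G" using \<phi>_closed(1)[OF G.zero_closed t] FC_subset by blast
    have "fst (\<phi> (\<zero>\<^bsub>G\<^esub> \<otimes>\<^bsub>G\<^esub> \<zero>\<^bsub>G\<^esub>)) t = \<zero>\<^bsub>G\<^esub> \<otimes>\<^bsub>G\<^esub> fst (\<phi> \<zero>\<^bsub>G\<^esub>) t"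
      unfolding \<phi>_lin[OF zF G.zero_closed] using t by simp
    then have "fst (\<phi> \<zero>\<^bsub>G\<^esub>) t = \<zero>\<^bsub>G\<^esub>" by (simp only: zz G.l_null[OF c])
    then show ?thesis using Inl by (simp add: vanish_def)
  next
    case (Inr t)
    then have t: "t \<in> S2" using s by auto
    let ?j = "fst (snd t)"
    obtain f where f: "f \<in> FC" "snd (\<phi> \<zero>\<^bsub>G\<^esub>) t = residue ?j f" using \<phi>_closed(2)[OF G.zero_closed t] by blast
    have "snd (\<phi> (\<zero>\<^bsub>G\<^esub> \<otimes>\<^bsub>G\<^esub> \<zero>\<^bsub>G\<^esub>)) t = rcoset_mult F (xs_ideal ?j) (residue ?j \<zero>\<^bsub>G\<^esub>) (snd (\<phi> \<zero>\<^bsub>G\<^esub>) t)"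
      unfolding \<phi>_lin[OF zF G.zero_closed] using t by simp
    also have "\<dots> = residue ?j (\<zero>\<^bsub>G\<^esub> \<otimes>\<^bsub>G\<^esub> f)" unfolding f(2) by (rule residue_mult[OF zF f(1)])
    also have "\<zero>\<^bsub>G\<^esub> \<otimes>\<^bsub>G\<^esub> f = \<zero>\<^bsub>G\<^esub>" using f(1) FC_subset by (intro G.l_null) blast
    finally have "snd (\<phi> \<zero>\<^bsub>G\<^esub>) t = xs_ideal ?j" by (simp only: zz residue_zero)
    then show ?thesis using Inr by (simp add: vanish_def)
  qed
qed

lemma all_vanish:
  assumes u: "u \<in> carrier G" and v: "\<And>s. s \<in> summands \<Longrightarrow> vanish s u" shows "u = \<zero>\<^bsub>G\<^esub>"
proof -
  have "fst (\<phi> u) s = fst (\<phi> \<zero>\<^bsub>G\<^esub>) s" if "s \<in> S1" for s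
    using v[of "Inl s"] vanish_zero[of "Inl s"] that by (simp add: vanish_def)
  then have 1: "fst (\<phi> u) = fst (\<phi> \<zero>\<^bsub>G\<^esub>)"
    by (rule extensionalityI[OF \<phi>_closed(3)[OF u] \<phi>_closed(3)[OF G.zero_closed]])
  have "snd (\<phi> u) s = snd (\<phi> \<zero>\<^bsub>G\<^esub>) s" if "s \<in> S2" for s
    using v[of "Inr s"] vanish_zero[of "Inr s"] that by (simp add: vanish_def)
  then have 2: "snd (\<phi> u) = snd (\<phi> \<zero>\<^bsub>G\<^esub>)"
    by (rule extensionalityI[OF \<phi>_closed(4)[OF u] \<phi>_closed(4)[OF G.zero_closed]])
  have "\<phi> u = \<phi> \<zero>\<^bsub>G\<^esub>" using 1 2 by (rule prod_eqI)
  then show ?thesis using bij_betw_imp_inj_on[OF bij] u G.zero_closed by (auto dest: inj_onD)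
qed

text \<open>The summands that are nonzero in degree \<open>n\<close>: the torsion summand \<open>F/(x\<^sup>*)\<^sup>jF (-i)\<close> lives in the degrees from
  \<open>i\<close> to \<open>i + j - 1\<close>.\<close>

definition active :: "nat \<Rightarrow> ((nat \<times> nat) + (nat \<times> nat \<times> nat)) set" where
  "active n = Inl ` {s \<in> S1. fst s \<le> n} \<union> Inr ` {s \<in> S2. fst s \<le> n \<and> n < fst s + fst (snd s)}"

lemma active_subset: "active n \<subseteq> summands" by (auto simp: active_def)

lemma \<phi>_cls:
  assumes a: "a \<in> pow n"
  shows "\<And>s. s \<in> S1 \<Longrightarrow> fst (\<phi> (cls n a)) s \<in> (if n < fst s then {\<zero>\<^bsub>G\<^esub>} else FC \<inter> homogeneous A m (n - fst s))"
    and "\<And>s. s \<in> S2 \<Longrightarrow> snd (\<phi> (cls n a)) s \<in> (if n < fst s then {xs_ideal (fst (snd s))}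
             else residue (fst (snd s)) ` (FC \<inter> homogeneous A m (n - fst s)))"
proof -
  have "\<phi> (cls n a) \<in> \<phi> ` homogeneous A m n" using a unfolding homogeneous_eq by blast
  then have 1: "fst (\<phi> (cls n a)) \<in> (\<Pi>\<^sub>E s\<in>S1. if n < fst s then {\<zero>\<^bsub>G\<^esub>} else FC \<inter> homogeneous A m (n - fst s))"
    and 2: "snd (\<phi> (cls n a)) \<in> (\<Pi>\<^sub>E s\<in>S2. if n < fst s then {xs_ideal (fst (snd s))}
             else residue (fst (snd s)) ` (FC \<inter> homogeneous A m (n - fst s)))"
    unfolding \<phi>_deg by (simp_all only: mem_Times_iff)
  show "\<And>s. s \<in> S1 \<Longrightarrow> fst (\<phi> (cls n a)) s \<in> (if n < fst s then {\<zero>\<^bsub>G\<^esub>} else FC \<inter> homogeneous A m (n - fst s))"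
    by (rule PiE_mem[OF 1])
  show "\<And>s. s \<in> S2 \<Longrightarrow> snd (\<phi> (cls n a)) s \<in> (if n < fst s then {xs_ideal (fst (snd s))}
             else residue (fst (snd s)) ` (FC \<inter> homogeneous A m (n - fst s)))"
    by (rule PiE_mem[OF 2])
qed

lemma \<phi>_cls_Inl:
  assumes a: "a \<in> pow n" and s: "s \<in> S1" and n: "fst s \<le> n"
  obtains b where "b \<in> carrier A" "fst (\<phi> (cls n a)) s = cls (n - fst s) (x [^] (n - fst s) \<otimes> b)"
proof -
  have "fst (\<phi> (cls n a)) s \<in> FC \<inter> homogeneous A m (n - fst s)" using \<phi>_cls(1)[OF a s] n by simp
  then show thesis using that unfolding FC_homogeneous by blast
qed

lemma \<phi>_cls_Inr:
  assumes a: "a \<in> pow n" and s: "s \<in> S2" and n: "fst s \<le> n"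
  obtains b where "b \<in> carrier A"
    "snd (\<phi> (cls n a)) s = residue (fst (snd s)) (cls (n - fst s) (x [^] (n - fst s) \<otimes> b))"
proof -
  have "snd (\<phi> (cls n a)) s \<in> residue (fst (snd s)) ` (FC \<inter> homogeneous A m (n - fst s))"
    using \<phi>_cls(2)[OF a s] n by simp
  then show thesis using that unfolding FC_homogeneous by blast
qed

lemma inactive_vanish:
  assumes a: "a \<in> pow n" and s: "s \<in> summands" "s \<notin> active n" shows "vanish s (cls n a)"
proof (cases s)
  case (Inl t)
  then have t: "t \<in> S1" "n < fst t" using s by (auto simp: active_def)
  then show ?thesis using \<phi>_cls(1)[OF a t(1)] Inl by (simp add: vanish_def)
next
  case (Inr t)
  then have t: "t \<in> S2" using s by auto
  show ?thesis
  proof (cases "n < fst t")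
    case True then show ?thesis using \<phi>_cls(2)[OF a t] Inr by (simp add: vanish_def)
  next
    case False
    then have j: "fst (snd t) \<le> n - fst t" using s(2) Inr t by (auto simp: active_def)
    obtain b where b: "b \<in> carrier A" "snd (\<phi> (cls n a)) t = residue (fst (snd t)) (cls (n - fst t) (x [^] (n - fst t) \<otimes> b))"
      by (rule \<phi>_cls_Inr[OF a t]) (use False in auto)
    have "cls (n - fst t) (x [^] (n - fst t) \<otimes> b) \<in> xs_ideal (fst (snd t))" using cls_xs_ideal_iff[OF b(1)] j by blast
    then show ?thesis using b(2) Inr residue_zero_iff[OF cls_xn_FC[OF b(1)]] by (simp add: vanish_def)
  qed
qed

lemma vanish_cls_ideal:
  assumes s: "s \<in> summands" shows "ideal {a \<in> pow n. vanish s (cls n a)} A"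
proof -
  show ?thesis
  proof (rule idealI_cring)
    show "{a \<in> pow n. vanish s (cls n a)} \<subseteq> carrier A" using pow_carrier by auto
    show "\<zero> \<in> {a \<in> pow n. vanish s (cls n a)}"
      using vanish_zero[OF s] by (simp add: cls_zero pow_zero_closed)
    fix a b assume "a \<in> {a \<in> pow n. vanish s (cls n a)}" "b \<in> {a \<in> pow n. vanish s (cls n a)}"
    then have a: "a \<in> pow n" "vanish s (cls n a)" and b: "b \<in> pow n" "vanish s (cls n b)" by auto
    have "vanish s (cls n a \<oplus>\<^bsub>G\<^esub> cls n b)"
      by (rule vanish_add[OF cls_closed[OF a(1)] cls_closed[OF b(1)] s a(2) b(2)])
    then show "a \<oplus> b \<in> {a \<in> pow n. vanish s (cls n a)}"
      using pow_add_closed[OF a(1) b(1)] by (simp add: cls_add[OF a(1) b(1)])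
  next
    fix c a assume c: "c \<in> carrier A" and "a \<in> {a \<in> pow n. vanish s (cls n a)}"
    then have a: "a \<in> pow n" "vanish s (cls n a)" by auto
    have "vanish s (cls 0 c \<otimes>\<^bsub>G\<^esub> cls n a)" by (rule vanish_mult[OF cls_0_FC[OF c] cls_closed[OF a(1)] s a(2)])
    then show "c \<otimes> a \<in> {a \<in> pow n. vanish s (cls n a)}"
      using cls_mult[of c 0 a n] c a(1) ideal.I_l_closed[OF pow_ideal a(1) c] by simp
  qed
qed

text \<open>In degree \<open>n\<close> an active summand is a copy of the residue field, so a nonzero component can be scaled to
cancel any other.\<close>

lemma vanish_combination:
  assumes s: "s \<in> active n" and a: "a \<in> pow n" "\<not> vanish s (cls n a)" and b: "b \<in> pow n"
  shows "\<exists>c\<in>carrier A. vanish s (cls n (b \<oplus> c \<otimes> a))"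
proof -
  have split: "cls n (b \<oplus> c \<otimes> a) = cls n b \<oplus>\<^bsub>G\<^esub> (cls 0 c \<otimes>\<^bsub>G\<^esub> cls n a)" if c: "c \<in> carrier A" for c
    using cls_mult[of c 0 a n] cls_add[OF b ideal.I_l_closed[OF pow_ideal a(1) c]] c a(1) by simp
  \<comment> \<open>an element outside \<open>m\<close> is a unit\<close>
  have kill: "\<exists>c\<in>carrier A. b' \<oplus> c \<otimes> a' = \<zero>" if "a' \<in> carrier A" "a' \<notin> m" "b' \<in> carrier A" for a' b'
  proof -
    have u: "a' \<in> Units A" using unitsI that by blast
    have "(\<ominus> b' \<otimes> inv a') \<otimes> a' = \<ominus> b'" using u that by (simp add: m_assoc)
    then have "b' \<oplus> (\<ominus> b' \<otimes> inv a') \<otimes> a' = \<zero>" using that by (simp add: r_neg)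
    then show ?thesis using u that by (intro bexI[of _ "\<ominus> b' \<otimes> inv a'"]) auto
  qed
  have mc: "cls 0 c \<otimes>\<^bsub>G\<^esub> cls n a \<in> carrier G" if "c \<in> carrier A" for c using that a(1) by simp
  show ?thesis
  proof (cases s)
    case (Inl t)
    then have t: "t \<in> S1" "fst t \<le> n" using s by (auto simp: active_def)
    let ?d = "n - fst t"
    obtain a' where a': "a' \<in> carrier A" "fst (\<phi> (cls n a)) t = cls ?d (x [^] ?d \<otimes> a')" by (rule \<phi>_cls_Inl[OF a(1) t])
    obtain b' where b': "b' \<in> carrier A" "fst (\<phi> (cls n b)) t = cls ?d (x [^] ?d \<otimes> b')" by (rule \<phi>_cls_Inl[OF b t])
    have "a' \<notin> m" using a(2) a'(2) Inl cls_xn_zero_iff[OF a'(1)] by (simp add: vanish_def)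
    then obtain c where c: "c \<in> carrier A" "b' \<oplus> c \<otimes> a' = \<zero>" using kill a'(1) b'(1) by blast
    have "fst (\<phi> (cls n (b \<oplus> c \<otimes> a))) t = cls ?d (x [^] ?d \<otimes> b') \<oplus>\<^bsub>G\<^esub> cls 0 c \<otimes>\<^bsub>G\<^esub> cls ?d (x [^] ?d \<otimes> a')"
      unfolding split[OF c(1)] \<phi>_add[OF cls_closed[OF b] mc[OF c(1)]] \<phi>_lin[OF cls_0_FC[OF c(1)] cls_closed[OF a(1)]]
      using t(1) a'(2) b'(2) by simp
    also have "\<dots> = cls ?d (x [^] ?d \<otimes> (b' \<oplus> c \<otimes> a'))"
      using cls_0_mult_xn[OF c(1) a'(1), of ?d] cls_add_xn[OF b'(1), of "c \<otimes> a'" ?d] c(1) a'(1) by simp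
    also have "\<dots> = \<zero>\<^bsub>G\<^esub>" unfolding c(2) using cls_zero by simp
    finally show ?thesis using c(1) Inl by (auto simp: vanish_def)
  next
    case (Inr t)
    then have t: "t \<in> S2" "fst t \<le> n" using s by (auto simp: active_def)
    let ?d = "n - fst t" and ?j = "fst (snd t)"
    obtain a' where a': "a' \<in> carrier A" "snd (\<phi> (cls n a)) t = residue ?j (cls ?d (x [^] ?d \<otimes> a'))" by (rule \<phi>_cls_Inr[OF a(1) t])
    obtain b' where b': "b' \<in> carrier A" "snd (\<phi> (cls n b)) t = residue ?j (cls ?d (x [^] ?d \<otimes> b'))" by (rule \<phi>_cls_Inr[OF b t])
    have "a' \<notin> m"
      using a(2) a'(2) Inr residue_zero_iff[OF cls_xn_FC[OF a'(1)], of ?j] cls_xs_ideal_iff[OF a'(1), of ?d ?j] by (simp add: vanish_def)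
    then obtain c where c: "c \<in> carrier A" "b' \<oplus> c \<otimes> a' = \<zero>" using kill a'(1) b'(1) by blast
    have "snd (\<phi> (cls n (b \<oplus> c \<otimes> a))) t
        = residue ?j (cls ?d (x [^] ?d \<otimes> b')) <+>\<^bsub>F\<^esub> rcoset_mult F (xs_ideal ?j) (residue ?j (cls 0 c)) (residue ?j (cls ?d (x [^] ?d \<otimes> a')))"
      unfolding split[OF c(1)] \<phi>_add[OF cls_closed[OF b] mc[OF c(1)]] \<phi>_lin[OF cls_0_FC[OF c(1)] cls_closed[OF a(1)]]
      using t(1) a'(2) b'(2) by simp
    also have "\<dots> = residue ?j (cls ?d (x [^] ?d \<otimes> b') \<oplus>\<^bsub>G\<^esub> cls 0 c \<otimes>\<^bsub>G\<^esub> cls ?d (x [^] ?d \<otimes> a'))"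
      unfolding residue_mult[OF cls_0_FC[OF c(1)] cls_xn_FC[OF a'(1)]] cls_0_mult_xn[OF c(1) a'(1)]
      by (rule residue_add) (use a'(1) b'(1) c(1) in auto)
    also have "\<dots> = residue ?j (cls ?d (x [^] ?d \<otimes> (b' \<oplus> c \<otimes> a')))"
      using cls_0_mult_xn[OF c(1) a'(1), of ?d] cls_add_xn[OF b'(1), of "c \<otimes> a'" ?d] c(1) a'(1) by simp
    also have "\<dots> = xs_ideal ?j" unfolding c(2) using cls_zero residue_zero by simp
    finally show ?thesis using c(1) Inr by (auto simp: vanish_def)
  qed
qed

text \<open>The preimage of the generator of a single summand in degree \<open>n\<close>.\<close>

lemma dual_basis:
  assumes s: "s \<in> active n"
  shows "\<exists>a\<in>pow n. \<not> vanish s (cls n a) \<and> (\<forall>t\<in>summands. t \<noteq> s \<longrightarrow> vanish t (cls n a))"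
proof -
  define e where "e i = cls (n - i) (x [^] (n - i) \<otimes> \<one>)" for i :: nat
  have eF: "e i \<in> FC \<inter> homogeneous A m (n - i)" for i
    unfolding FC_homogeneous e_def using one_closed by blast
  have z: "\<zero>\<^bsub>G\<^esub> \<in> FC \<inter> homogeneous A m k" for k
    using F.zero_closed G.zero_closed by (simp add: homogeneous_def) (simp add: zero_G)
  have zc: "xs_ideal j \<in> residue j ` (FC \<inter> homogeneous A m k)" for j k
    using imageI[OF z[of k], of "residue j"] by (simp only: residue_zero)
  define v1 where "v1 = (\<lambda>t\<in>S1. if s = Inl t then e (fst t) else \<zero>\<^bsub>G\<^esub>)"
  define v2 where "v2 = (\<lambda>t\<in>S2. if s = Inr t then residue (fst (snd t)) (e (fst t)) else xs_ideal (fst (snd t)))"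
  have act: "s = Inl t \<Longrightarrow> fst t \<le> n" for t using s by (auto simp: active_def)
  have act2: "s = Inr t \<Longrightarrow> fst t \<le> n \<and> n < fst t + fst (snd t)" for t using s by (auto simp: active_def)
  have "v1 \<in> (\<Pi>\<^sub>E t\<in>S1. if n < fst t then {\<zero>\<^bsub>G\<^esub>} else FC \<inter> homogeneous A m (n - fst t))"
    unfolding v1_def using eF z act by (intro restrict_PiE_iff[THEN iffD2] ballI) (auto simp: not_less)
  moreover have "v2 \<in> (\<Pi>\<^sub>E t\<in>S2. if n < fst t then {xs_ideal (fst (snd t))}
             else residue (fst (snd t)) ` (FC \<inter> homogeneous A m (n - fst t)))"
    unfolding v2_def using eF zc act2 by (intro restrict_PiE_iff[THEN iffD2] ballI) (auto simp: not_less)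
  ultimately have "(v1, v2) \<in> \<phi> ` homogeneous A m n" unfolding \<phi>_deg by blast
  then obtain a where a: "a \<in> pow n" "\<phi> (cls n a) = (v1, v2)" unfolding homogeneous_eq by fastforce
  have "\<not> vanish s (cls n a)"
  proof (cases s)
    case (Inl t)
    then have "t \<in> S1" using s by (auto simp: active_def)
    then show ?thesis using a(2) Inl cls_xn_zero_iff[OF one_closed] one_notin_m by (simp add: vanish_def v1_def e_def del: r_one)
  next
    case (Inr t)
    then have t: "t \<in> S2" using s by (auto simp: active_def)
    have "\<not> fst (snd t) \<le> n - fst t" using act2[OF Inr] by linarith
    then have "e (fst t) \<notin> xs_ideal (fst (snd t))" unfolding e_def using cls_xs_ideal_iff[OF one_closed] one_notin_m by blast
    then show ?thesis using a(2) Inr t residue_zero_iff eF by (simp add: vanish_def v2_def)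
  qed
  moreover have "vanish t (cls n a)" if "t \<in> summands" "t \<noteq> s" for t
    using that a(2) by (auto simp: vanish_def v1_def v2_def)
  ultimately show ?thesis using a(1) by blast
qed

text \<open>The components in the active summands are coordinates on \<open>m\<^sup>n/m\<^sup>n\<^sup>+\<^sup>1\<close> in the sense of \<open>hilb_eq_card\<close>.\<close>

lemma hilb_eq_card_active: "hilb n = card (active n)"
proof (rule hilb_eq_card[where Z = "\<lambda>s. {a \<in> pow n. vanish s (cls n a)}"])
  show "finite (active n)" using fin by (simp add: active_def)
  show "ideal {a \<in> pow n. vanish s (cls n a)} A" if "s \<in> active n" for s
    using vanish_cls_ideal that active_subset by blast
  show "{a \<in> pow n. \<forall>s\<in>active n. a \<in> {a \<in> pow n. vanish s (cls n a)}} = pow (Suc n)"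
  proof
    show "{a \<in> pow n. \<forall>s\<in>active n. a \<in> {a \<in> pow n. vanish s (cls n a)}} \<subseteq> pow (Suc n)"
    proof
      fix a assume "a \<in> {a \<in> pow n. \<forall>s\<in>active n. a \<in> {a \<in> pow n. vanish s (cls n a)}}"
      then have a: "a \<in> pow n" "\<And>s. s \<in> active n \<Longrightarrow> vanish s (cls n a)" by auto
      have "cls n a = \<zero>\<^bsub>G\<^esub>" using a(2) inactive_vanish[OF a(1)] by (intro all_vanish[OF cls_closed[OF a(1)]]) blast
      then show "a \<in> pow (Suc n)" using cls_eq_zero_iff[OF a(1)] by simp
    qed
    show "pow (Suc n) \<subseteq> {a \<in> pow n. \<forall>s\<in>active n. a \<in> {a \<in> pow n. vanish s (cls n a)}}"
    proof
      fix a assume a: "a \<in> pow (Suc n)"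
      then have an: "a \<in> pow n" using pow_Suc_subset by blast
      have "cls n a = \<zero>\<^bsub>G\<^esub>" using cls_eq_zero_iff[OF an] a by simp
      then show "a \<in> {a \<in> pow n. \<forall>s\<in>active n. a \<in> {a \<in> pow n. vanish s (cls n a)}}"
        using an vanish_zero active_subset[of n] by auto
    qed
  qed
  fix s a b assume s: "s \<in> active n" and a: "a \<in> pow n" "a \<notin> {a \<in> pow n. vanish s (cls n a)}" and b: "b \<in> pow n"
  obtain c where c: "c \<in> carrier A" "vanish s (cls n (b \<oplus> c \<otimes> a))" using vanish_combination[OF s a(1) _ b] a by blast
  have "b \<oplus> c \<otimes> a \<in> pow n" by (rule pow_add_closed[OF b ideal.I_l_closed[OF pow_ideal a(1) c(1)]])
  then show "\<exists>c\<in>carrier A. b \<oplus> c \<otimes> a \<in> {a \<in> pow n. vanish s (cls n a)}" using c by blast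
next
  fix s assume s: "s \<in> active n"
  show "\<exists>a\<in>pow n. a \<notin> {a \<in> pow n. vanish s (cls n a)} \<and> (\<forall>t\<in>active n. t \<noteq> s \<longrightarrow> a \<in> {a \<in> pow n. vanish t (cls n a)})"
    using dual_basis[OF s] active_subset[of n] by blast
qed

text \<open>The top degree of a torsion summand is annihilated by the initial form of \<open>x\<close>, while the initial form is
regular on the free summands.\<close>

lemma regular_iff_no_torsion:
  assumes "\<And>s. s \<in> S2 \<Longrightarrow> 1 \<le> fst (snd s)"
  shows "regular_initial_form \<longleftrightarrow> S2 = {}"
proof
  assume reg: regular_initial_form
  show "S2 = {}"
  proof (rule ccontr)
    assume "S2 \<noteq> {}"
    then obtain t where t: "t \<in> S2" by blast
    \<comment> \<open>the top degree of the summand \<open>t\<close>\<close>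
    define n where "n = fst t + fst (snd t) - 1"
    have j: "1 \<le> fst (snd t)" by (rule assms[OF t])
    then have s: "Inr t \<in> active n" using t by (auto simp: active_def n_def)
    obtain a where a: "a \<in> pow n" "\<not> vanish (Inr t) (cls n a)"
      "\<And>s. s \<in> summands \<Longrightarrow> s \<noteq> Inr t \<Longrightarrow> vanish s (cls n a)" using dual_basis[OF s] by blast
    have xa: "x \<otimes> a \<in> pow (Suc n)" by (rule m_mult_pow[OF x_in_m a(1)])
    have eq: "xs \<otimes>\<^bsub>G\<^esub> cls n a = cls (Suc n) (x \<otimes> a)" using cls_mult[OF x_in_pow a(1)] by (simp add: initial_form_eq)
    have "Inr t \<notin> active (Suc n)" using j by (auto simp: active_def n_def)
    then have "vanish (Inr t) (xs \<otimes>\<^bsub>G\<^esub> cls n a)" unfolding eq using t by (intro inactive_vanish[OF xa]) auto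
    then have "vanish s (xs \<otimes>\<^bsub>G\<^esub> cls n a)" if "s \<in> summands" for s
      using vanish_mult[OF xs_FC cls_closed[OF a(1)] that] a(3)[OF that] by (cases "s = Inr t") auto
    then have "xs \<otimes>\<^bsub>G\<^esub> cls n a = \<zero>\<^bsub>G\<^esub>" by (intro all_vanish) (use a(1) in simp)
    then have "cls n a = \<zero>\<^bsub>G\<^esub>" using reg cls_closed[OF a(1)] unfolding regular_initial_form_iff by blast
    then show False using a(2) vanish_zero[of "Inr t"] t by simp
  qed
next
  assume S2: "S2 = {}"
  show regular_initial_form unfolding regular_initial_form_iff
  proof (intro ballI impI)
    fix f assume f: "f \<in> carrier G" and z: "xs \<otimes>\<^bsub>G\<^esub> f = \<zero>\<^bsub>G\<^esub>"
    show "f = \<zero>\<^bsub>G\<^esub>"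
    proof (rule all_vanish[OF f])
      fix s assume s: "s \<in> summands"
      then obtain t where t: "s = Inl t" "t \<in> S1" using S2 by auto
      have "vanish s (xs \<otimes>\<^bsub>G\<^esub> f)" unfolding z by (rule vanish_zero[OF s])
      then have "xs \<otimes>\<^bsub>G\<^esub> fst (\<phi> f) t = \<zero>\<^bsub>G\<^esub>" using t \<phi>_lin[OF xs_FC f] by (simp add: vanish_def)
      then have "fst (\<phi> f) t = \<zero>\<^bsub>G\<^esub>" by (rule xs_mult_FC_zeroD[OF \<phi>_closed(1)[OF f t(2)]])
      then show "vanish s f" using t(1) by (simp add: vanish_def)
    qed
  qed
qed

end

section \<open>The setting of the theorem\<close>

text \<open>In dimension one there is a prime ideal properly below \<open>m\<close>, so \<open>m\<close> has positive height, hence positive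
depth, and contains a nonzerodivisor \<open>y\<close>. Since \<open>y\<^sup>n\<^sup>+\<^sup>1\<close> lies in \<open>m\<^sup>n\<^sup>+\<^sup>1 = x m\<^sup>n\<close>, it is a multiple of \<open>x\<close>, and \<open>x\<close>
is a nonzerodivisor as well. That every element outside \<open>m\<close> is a unit follows from the existence of
maximal ideals above proper ideals.\<close>

lemma reduction_ring_of_local:
  fixes A :: "('a, 'b) ring_scheme" (structure)
  assumes loc: "is_local_ring A m" and cm: "cohen_macaulay_ring A" and dim: "krull_dim A = 1"
    and red: "minimal_reduction A m x"
  shows "reduction_ring A m x (reduction_number A m x)"
proof -
  interpret cring A using loc by (simp add: is_local_ring_def)
  have noeth: "noetherian_ring A" using cm by (simp add: cohen_macaulay_ring_def)
  have max_iff: "maximalideal J A \<longleftrightarrow> J = m" for J using loc unfolding is_local_ring_def by blast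
  have max: "maximalideal m A" by (simp add: max_iff)
  interpret m: maximalideal m A by (rule max)
  have mi: "ideal m A" ..
  have le_m: "I \<subseteq> m" if "ideal I A" "I \<noteq> carrier A" for I
    using exists_maximalideal[OF noeth that] max_iff by metis
  have units: "a \<in> Units A" if a: "a \<in> carrier A" "a \<notin> m" for a
  proof -
    have "a \<in> PIdl a" by (rule cgenideal_self[OF a(1)])
    then have "PIdl a = carrier A" using le_m[OF cgenideal_ideal[OF a(1)]] a(2) by blast
    then have "\<one> \<in> PIdl a" by simp
    then obtain b where b: "b \<in> carrier A" "\<one> = b \<otimes> a" unfolding cgenideal_def by blast
    then have "b \<otimes> a = \<one>" "a \<otimes> b = \<one>" using a(1) b m_comm[OF a(1) b(1)] by simp_all
    then show ?thesis using a(1) b(1) unfolding Units_def by blast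
  qed
  have xm: "x \<in> m" using red by (simp add: minimal_reduction_def)
  then have xc: "x \<in> carrier A" by (rule m.Icarr)
  obtain n where n: "ideal_pow A m (Suc n) = x <# ideal_pow A m n" using red unfolding minimal_reduction_def by blast
  have lst: "ideal_pow A m (Suc (reduction_number A m x)) = x <# ideal_pow A m (reduction_number A m x)"
    unfolding reduction_number_def by (rule LeastI[where P = "\<lambda>n. ideal_pow A m (Suc n) = x <# ideal_pow A m n", OF n])
  have "0 < krull_dim A" using dim by simp
  then obtain d where "d \<in> {enat n | n. \<exists>P. prime_chain A n P}" "0 < d" unfolding krull_dim_def less_Sup_iff by blast
  then obtain k P where P: "prime_chain A k P" "0 < k" by (auto simp: zero_enat_def)
  have P1: "primeideal (P 1) A" and P0: "primeideal (P 0) A" and P01: "P 0 \<subset> P 1"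
    using P unfolding prime_chain_def by auto
  have "P 1 \<subseteq> m" using le_m[of "P 1"] primeideal.axioms(1)[OF P1] primeideal.I_notcarr[OF P1] by blast
  then have "P 0 \<subset> m" using P01 by blast
  then have "1 \<le> height A m" by (rule height_ge_1[OF maximalideal_prime[OF max] P0])
  then have "1 \<le> ideal_depth A m" using cm max unfolding cohen_macaulay_ring_def by simp
  then obtain y where y: "y \<in> m" "y \<in> nonzerodivisors A" by (rule nzd_of_depth)
  have yc: "y \<in> carrier A" by (rule m.Icarr[OF y(1)])
  have ypow: "y [^] k \<in> ideal_pow A m k" for k :: nat
  proof (induction k)
    case 0 show ?case by simp
  next
    case (Suc k)
    have "y \<in> ideal_pow A m 1" using y(1) ideal_pow_1[OF mi] by simp
    from ideal_pow_mult[OF mi Suc this] show ?case by simp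
  qed
  have ynz: "y [^] k \<in> nonzerodivisors A" for k :: nat by (induction k) (simp_all add: y(2))
  obtain c where c: "c \<in> ideal_pow A m n" "y [^] Suc n = x \<otimes> c"
    using ypow[of "Suc n"] unfolding n by (rule l_cosetE)
  have cc: "c \<in> carrier A" using ideal.Icarr[OF ideal_pow_ideal[OF mi] c(1)] .
  have nzd: "a = \<zero>" if a: "a \<in> carrier A" "x \<otimes> a = \<zero>" for a
  proof (rule NZD_D[OF ynz[of "Suc n"] a(1)])
    have "y [^] Suc n \<otimes> a = (c \<otimes> x) \<otimes> a" unfolding c(2) by (simp only: m_comm[OF xc cc])
    also have "\<dots> = c \<otimes> (x \<otimes> a)" by (rule m_assoc[OF cc xc a(1)])
    also have "\<dots> = \<zero>" unfolding a(2) by (rule r_null[OF cc])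
    finally show "y [^] Suc n \<otimes> a = \<zero>" .
  qed
  show ?thesis
  proof (intro reduction_ring.intro reduction_ring_axioms.intro)
    show "cring A" ..
    show "noetherian_ring A" by fact
    show "maximalideal m A" by fact
    show "x \<in> m" by fact
    show "a \<in> Units A" if "a \<in> carrier A" "a \<notin> m" for a by (rule units[OF that])
    show "a = \<zero>" if "a \<in> carrier A" "x \<otimes> a = \<zero>" for a by (rule nzd[OF that])
    show "ideal_pow A m (Suc k) = x <# ideal_pow A m k" if "reduction_number A m x \<le> k" for k
      by (rule ideal_pow_reduction_mono[OF mi xc lst that])
  qed
qed


section \<open>The invariants of the tangent cone\<close>

lemma graded_iso_iff:
  "graded_iso R M N \<longleftrightarrow> (\<exists>\<phi>.
     bij_betw \<phi> (carrier (fst M)) (carrier (fst N)) \<and>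
     (\<forall>u\<in>carrier (fst M). \<forall>v\<in>carrier (fst M). \<phi> (u \<oplus>\<^bsub>fst M\<^esub> v) = \<phi> u \<oplus>\<^bsub>fst N\<^esub> \<phi> v) \<and>
     (\<forall>a\<in>carrier R. \<forall>u\<in>carrier (fst M). \<phi> (a \<odot>\<^bsub>fst M\<^esub> u) = a \<odot>\<^bsub>fst N\<^esub> \<phi> u) \<and>
     (\<forall>n. \<phi> ` snd M n = snd N n))"
  by (cases M; cases N) (simp add: graded_iso_def)

lemma graded_shift_simps:
  "fst (graded_shift i M) = fst M"
  "snd (graded_shift i M) n = (if n < i then {\<zero>\<^bsub>fst M\<^esub>} else snd M (n - i))"
  by (simp_all add: graded_shift_def case_prod_beta)

lemma graded_dsum_simps:
  "carrier (fst (graded_dsum I L)) = (\<Pi>\<^sub>E i\<in>I. carrier (fst (L i)))"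
  "f \<oplus>\<^bsub>fst (graded_dsum I L)\<^esub> g = (\<lambda>i\<in>I. f i \<oplus>\<^bsub>fst (L i)\<^esub> g i)"
  "a \<odot>\<^bsub>fst (graded_dsum I L)\<^esub> f = (\<lambda>i\<in>I. a \<odot>\<^bsub>fst (L i)\<^esub> f i)"
  "snd (graded_dsum I L) n = (\<Pi>\<^sub>E i\<in>I. snd (L i) n)"
  by (simp_all add: graded_dsum_def)

lemma graded_sum2_simps:
  "carrier (fst (graded_sum2 M N)) = carrier (fst M) \<times> carrier (fst N)"
  "u \<oplus>\<^bsub>fst (graded_sum2 M N)\<^esub> v = (fst u \<oplus>\<^bsub>fst M\<^esub> fst v, snd u \<oplus>\<^bsub>fst N\<^esub> snd v)"
  "a \<odot>\<^bsub>fst (graded_sum2 M N)\<^esub> u = (a \<odot>\<^bsub>fst M\<^esub> fst u, a \<odot>\<^bsub>fst N\<^esub> snd u)"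
  "snd (graded_sum2 M N) n = snd M n \<times> snd N n"
  by (simp_all add: graded_sum2_def case_prod_beta)

context reduction_ring
begin

lemma cone_graded_simps:
  "carrier (fst (cone_graded A m)) = carrier G"
  "u \<oplus>\<^bsub>fst (cone_graded A m)\<^esub> v = u \<oplus>\<^bsub>G\<^esub> v"
  "f \<odot>\<^bsub>fst (cone_graded A m)\<^esub> u = f \<otimes>\<^bsub>G\<^esub> u"
  "snd (cone_graded A m) = homogeneous A m"
  by (simp_all add: cone_graded_def scalars_along_def)

lemma fiber_graded_simps:
  "carrier (fst (fiber_graded A m x)) = FC"
  "u \<oplus>\<^bsub>fst (fiber_graded A m x)\<^esub> v = u \<oplus>\<^bsub>G\<^esub> v"
  "f \<odot>\<^bsub>fst (fiber_graded A m x)\<^esub> u = f \<otimes>\<^bsub>G\<^esub> u"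
  "\<zero>\<^bsub>fst (fiber_graded A m x)\<^esub> = \<zero>\<^bsub>G\<^esub>"
  "snd (fiber_graded A m x) n = FC \<inter> homogeneous A m n"
  by (simp_all add: fiber_graded_def scalars_along_def)

lemma fiber_torsion_graded_simps:
  "carrier (fst (fiber_torsion_graded A m x j)) = residue j ` FC"
  "u \<oplus>\<^bsub>fst (fiber_torsion_graded A m x j)\<^esub> v = u <+>\<^bsub>F\<^esub> v"
  "f \<odot>\<^bsub>fst (fiber_torsion_graded A m x j)\<^esub> u = rcoset_mult F (xs_ideal j) (residue j f) u"
  "\<zero>\<^bsub>fst (fiber_torsion_graded A m x j)\<^esub> = xs_ideal j"
  "snd (fiber_torsion_graded A m x j) n = residue j ` (FC \<inter> homogeneous A m n)"
  by (simp_all add: fiber_torsion_graded_def scalars_along_def FactRing_def Let_def image_UN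
      A_RCOSETS_def RCOSETS_def a_r_coset_def UNION_singleton_eq_range)

definition free_summands :: "(nat \<Rightarrow> nat) \<Rightarrow> (nat \<times> nat) set" where
  "free_summands \<alpha> = {(i, k). i \<le> r \<and> k < \<alpha> i}"

definition torsion_summands :: "(nat \<Rightarrow> nat \<Rightarrow> nat) \<Rightarrow> (nat \<times> nat \<times> nat) set" where
  "torsion_summands \<tau> = {(i, j, k). 1 \<le> i \<and> i \<le> r - 1 \<and> 1 \<le> j \<and> j \<le> r - i \<and> k < \<tau> i j}"

lemma finite_summands: "finite (free_summands \<alpha>)" "finite (torsion_summands \<tau>)"
proof -
  have "free_summands \<alpha> = (SIGMA i:{..r}. {..<\<alpha> i})" by (auto simp: free_summands_def)
  then show "finite (free_summands \<alpha>)" by simp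
  have "torsion_summands \<tau> \<subseteq> (SIGMA i:{..r}. SIGMA j:{..r}. {..<\<tau> i j})" by (auto simp: torsion_summands_def)
  then show "finite (torsion_summands \<tau>)" by (rule finite_subset) simp
qed

lemma decomposition:
  assumes inv: "tangent_cone_invariants A m x \<alpha> \<tau>" and r: "r = reduction_number A m x"
  obtains \<phi> where "cone_decomposition A m x r (free_summands \<alpha>) (torsion_summands \<tau>) \<phi>"
proof -
  have "graded_iso F (cone_graded A m)
      (graded_sum2 (graded_dsum (free_summands \<alpha>) (\<lambda>s. graded_shift (fst s) (fiber_graded A m x)))
        (graded_dsum (torsion_summands \<tau>) (\<lambda>s. graded_shift (fst s) (fiber_torsion_graded A m x (fst (snd s))))))"
    using inv unfolding tangent_cone_invariants_def Let_def r[symmetric] free_summands_def torsion_summands_def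
      case_prod_beta .
  then obtain \<phi> where \<phi>:
    "bij_betw \<phi> (carrier G) ((\<Pi>\<^sub>E s\<in>free_summands \<alpha>. FC) \<times> (\<Pi>\<^sub>E s\<in>torsion_summands \<tau>. residue (fst (snd s)) ` FC))"
    "\<forall>u\<in>carrier G. \<forall>v\<in>carrier G. \<phi> (u \<oplus>\<^bsub>G\<^esub> v)
      = (\<lambda>s\<in>free_summands \<alpha>. fst (\<phi> u) s \<oplus>\<^bsub>G\<^esub> fst (\<phi> v) s, \<lambda>s\<in>torsion_summands \<tau>. snd (\<phi> u) s <+>\<^bsub>F\<^esub> snd (\<phi> v) s)"
    "\<forall>a\<in>FC. \<forall>u\<in>carrier G. \<phi> (a \<otimes>\<^bsub>G\<^esub> u)
      = (\<lambda>s\<in>free_summands \<alpha>. a \<otimes>\<^bsub>G\<^esub> fst (\<phi> u) s,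
         \<lambda>s\<in>torsion_summands \<tau>. rcoset_mult F (xs_ideal (fst (snd s))) (residue (fst (snd s)) a) (snd (\<phi> u) s))"
    "\<forall>n. \<phi> ` homogeneous A m n
      = (\<Pi>\<^sub>E s\<in>free_summands \<alpha>. if n < fst s then {\<zero>\<^bsub>G\<^esub>} else FC \<inter> homogeneous A m (n - fst s))
        \<times> (\<Pi>\<^sub>E s\<in>torsion_summands \<tau>. if n < fst s then {xs_ideal (fst (snd s))}
             else residue (fst (snd s)) ` (FC \<inter> homogeneous A m (n - fst s)))"
    unfolding graded_iso_iff graded_sum2_simps graded_dsum_simps graded_shift_simps cone_graded_simps
      fiber_graded_simps fiber_torsion_graded_simps by (elim HOL.exE conjE) (rule that)
  show thesis
  proof (rule that, intro cone_decomposition.intro cone_decomposition_axioms.intro)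
    show "reduction_ring A m x r" by unfold_locales
  qed ((rule \<phi>(1) finite_summands spec[OF \<phi>(4)] \<phi>(2,3)[rule_format] | assumption)+)
qed

lemma hilb_decomposition:
  assumes inv: "tangent_cone_invariants A m x \<alpha> \<tau>" and r: "r = reduction_number A m x" and n: "n \<le> r"
  shows "hilb n = (\<Sum>i\<le>n. \<alpha> i) + card {s \<in> torsion_summands \<tau>. fst s \<le> n \<and> n < fst s + fst (snd s)}"
proof -
  obtain \<phi> where "cone_decomposition A m x r (free_summands \<alpha>) (torsion_summands \<tau>) \<phi>"
    by (rule decomposition[OF inv r])
  then interpret cone_decomposition A m x r "free_summands \<alpha>" "torsion_summands \<tau>" \<phi> .
  have "{s \<in> free_summands \<alpha>. fst s \<le> n} = (SIGMA i:{..n}. {..<\<alpha> i})"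
    using n by (auto simp: free_summands_def)
  then have "card {s \<in> free_summands \<alpha>. fst s \<le> n} = (\<Sum>i\<le>n. \<alpha> i)" by simp
  then show ?thesis
    unfolding hilb_eq_card_active active_def using fin by (subst card_Un_disjoint) (auto simp: card_image)
qed

lemma regular_iff_torsion_free:
  assumes inv: "tangent_cone_invariants A m x \<alpha> \<tau>" and r: "r = reduction_number A m x"
  shows "regular_initial_form \<longleftrightarrow> torsion_summands \<tau> = {}"
proof -
  obtain \<phi> where "cone_decomposition A m x r (free_summands \<alpha>) (torsion_summands \<tau>) \<phi>"
    by (rule decomposition[OF inv r])
  then interpret cone_decomposition A m x r "free_summands \<alpha>" "torsion_summands \<tau>" \<phi> .
  show ?thesis by (rule regular_iff_no_torsion) (auto simp: torsion_summands_def)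
qed

text \<open>A torsion summand \<open>F/(x\<^sup>*)\<^sup>jF (-i)\<close> has \<open>i < r\<close> and contributes to the Hilbert function in degree \<open>i\<close>.\<close>

lemma regularI_free_part:
  assumes inv: "tangent_cone_invariants A m x \<alpha> \<tau>" and r: "r = reduction_number A m x"
    and eq: "\<And>n. n < r \<Longrightarrow> (\<Sum>i\<le>n. \<alpha> i) = hilb n"
  shows regular_initial_form
proof -
  have "s \<notin> torsion_summands \<tau>" for s
  proof
    assume s: "s \<in> torsion_summands \<tau>"
    let ?T = "{t \<in> torsion_summands \<tau>. fst t \<le> fst s \<and> fst s < fst t + fst (snd t)}"
    have lt: "fst s < r" and mem: "s \<in> ?T" using s by (auto simp: torsion_summands_def)
    have "card ?T = 0" using hilb_decomposition[OF inv r, of "fst s"] eq[OF lt] lt by simp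
    then have "?T = {}" using finite_summands(2)[of \<tau>] by simp
    then show False using mem by blast
  qed
  then show ?thesis unfolding regular_iff_torsion_free[OF inv r] by blast
qed

end

section \<open>Comparison of the invariants\<close>

lemma eq_iff_partial_sums_eq:
  fixes f g :: "nat \<Rightarrow> int"
  shows "(\<forall>i\<le>r. f i = g i) \<longleftrightarrow> (\<forall>n\<le>r. (\<Sum>i\<le>n. f i) = (\<Sum>i\<le>n. g i))"
proof (intro iffI allI impI)
  fix n assume "\<forall>i\<le>r. f i = g i" "n \<le> r"
  then show "(\<Sum>i\<le>n. f i) = (\<Sum>i\<le>n. g i)" by (intro sum.cong) auto
next
  fix n assume *: "\<forall>n\<le>r. (\<Sum>i\<le>n. f i) = (\<Sum>i\<le>n. g i)" and n: "n \<le> r"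
  show "f n = g n"
  proof (cases n)
    case 0
    have "(\<Sum>i\<le>0. f i) = (\<Sum>i\<le>0. g i)" by (rule *[rule_format]) simp
    then show ?thesis using 0 by simp
  next
    case (Suc k)
    have "(\<Sum>i\<le>n. f i) = (\<Sum>i\<le>n. g i)" and "(\<Sum>i\<le>k. f i) = (\<Sum>i\<le>k. g i)"
      by (rule *[rule_format], use n Suc in simp)+
    then show ?thesis using Suc by simp
  qed
qed

lemma eq_of_le_of_sum_eq:
  fixes f g :: "nat \<Rightarrow> int"
  assumes "\<And>n. n < r \<Longrightarrow> f n \<le> g n" "(\<Sum>n<r. f n) = (\<Sum>n<r. g n)" "n < r"
  shows "f n = g n"
proof -
  have "(\<Sum>n<r. g n - f n) = 0" using assms(2) by (simp add: sum_subtractf)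
  then have "\<forall>n\<in>{..<r}. g n - f n = 0" by (subst (asm) sum_nonneg_eq_0_iff) (use assms(1) in auto)
  then show ?thesis using assms(3) by simp
qed

theorem theorem4p2:
  fixes A :: "('a, 'b) ring_scheme" (structure)
    and m :: "'a set" and x :: 'a and r :: nat
    and \<alpha> :: "nat \<Rightarrow> nat" and \<tau> :: "nat \<Rightarrow> nat \<Rightarrow> nat"
  assumes "is_local_ring A m"
    and "cohen_macaulay_ring A"
    and "krull_dim A = 1"
    and "infinite (carrier (A Quot m))"
    and "minimal_reduction A m x"
    and "r = reduction_number A m x"
    and "tangent_cone_invariants A m x \<alpha> \<tau>"
  shows "(cohen_macaulay_ring (tangent_cone A m) \<longleftrightarrow>
            (\<forall>i\<le>r. int (\<alpha> i) = micro_invariant A m x i))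
       \<and> (cohen_macaulay_ring (tangent_cone A m) \<longleftrightarrow>
            (\<forall>i\<le>r. \<alpha> i = apery_invariant A m x i))
       \<and> (cohen_macaulay_ring (tangent_cone A m) \<longleftrightarrow>
            (\<forall>i\<le>r. micro_invariant A m x i = int (apery_invariant A m x i)))"
proof -
  interpret reduction_ring A m x r
    using reduction_ring_of_local[OF assms(1-3,5)] assms(6) by simp
  define a where "a n = (\<Sum>i\<le>n. int (\<alpha> i))" for n
  define b where "b n = (\<Sum>i\<le>n. micro_invariant A m x i)" for n
  define c where "c n = (\<Sum>i\<le>n. int (apery_invariant A m x i))" for n
  have c: "c n = int (hilb n) + int (ell (pow n) (colon (pow (Suc n)) (Suc 0)))" for n
    using arg_cong[OF sum_apery_invariants[of n], of int] by (simp add: c_def)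
  have b: "b n = int (hilb r) - int (micro_len n)" for n
    using sum_micro_invariant by (simp add: b_def)
  have a: "a n = int (hilb n) - int (card {s \<in> torsion_summands \<tau>. fst s \<le> n \<and> n < fst s + fst (snd s)})"
    if "n \<le> r" for n
    using arg_cong[OF hilb_decomposition[OF assms(7,6) that], of int] by (simp add: a_def)
  have a_le: "a n \<le> int (hilb n)" if "n < r" for n using a[of n] that by simp
  have c_ge: "int (hilb n) \<le> c n" for n by (simp add: c)
  have sum_b: "(\<Sum>n<r. b n) = (\<Sum>n<r. int (hilb n))" unfolding b by (rule sum_sum_micro)
  have regular_imp: "a n = int (hilb n)" "b n = int (hilb n)" "c n = int (hilb n)"
    if "regular_initial_form" "n \<le> r" for n
  proof -
    have "torsion_summands \<tau> = {}" using that(1) regular_iff_torsion_free[OF assms(7,6)] by simp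
    then show "a n = int (hilb n)" using a[OF that(2)] by simp
    show "b n = int (hilb n)" unfolding b regular_micro_len[OF that(1)] by simp
    have "colon (pow (Suc n)) (Suc 0) = pow n" using that(1) unfolding regular_initial_form_def by blast
    then show "c n = int (hilb n)" by (simp add: c ell_refl[OF pow_ideal])
  qed
  have regular_a: regular_initial_form if "\<And>n. n < r \<Longrightarrow> a n = int (hilb n)"
  proof (rule regularI_free_part[OF assms(7,6)])
    show "(\<Sum>i\<le>n. \<alpha> i) = hilb n" if "n < r" for n
      using \<open>\<And>n. n < r \<Longrightarrow> a n = int (hilb n)\<close>[OF that] by (simp add: a_def flip: of_nat_sum)
  qed
  have regular_c: regular_initial_form if "\<And>n. n < r \<Longrightarrow> c n = int (hilb n)"
    by (rule regular_initial_formI) (use that in \<open>simp add: c\<close>)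
  \<comment> \<open>\<open>a\<close> lies below \<open>H\<close> and has the same sum over \<open>n < r\<close> as \<open>b\<close>, that is, as \<open>H\<close>\<close>
  have 1: "regular_initial_form \<longleftrightarrow> (\<forall>n\<le>r. a n = b n)"
  proof
    assume eq: "\<forall>n\<le>r. a n = b n"
    have "(\<Sum>n<r. a n) = (\<Sum>n<r. b n)" using eq by (intro sum.cong) auto
    then show regular_initial_form using sum_b by (intro regular_a eq_of_le_of_sum_eq a_le) auto
  qed (use regular_imp in simp)
  \<comment> \<open>\<open>H\<close> is squeezed between \<open>a\<close> and \<open>c\<close>\<close>
  have 2: "regular_initial_form \<longleftrightarrow> (\<forall>n\<le>r. a n = c n)"
  proof
    assume eq: "\<forall>n\<le>r. a n = c n"
    show regular_initial_form
      by (rule regular_a) (use eq a_le c_ge in \<open>metis antisym less_imp_le\<close>)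
  qed (use regular_imp in simp)
  \<comment> \<open>\<open>c\<close> lies above \<open>H\<close> and has the same sum over \<open>n < r\<close> as \<open>b\<close>, that is, as \<open>H\<close>\<close>
  have 3: "regular_initial_form \<longleftrightarrow> (\<forall>n\<le>r. b n = c n)"
  proof
    assume eq: "\<forall>n\<le>r. b n = c n"
    have s: "(\<Sum>n<r. int (hilb n)) = (\<Sum>n<r. c n)" unfolding sum_b[symmetric] using eq by (intro sum.cong) auto
    show regular_initial_form
      by (rule regular_c) (rule eq_of_le_of_sum_eq[OF c_ge s, symmetric])
  qed (use regular_imp in simp)
  have nat: "(\<forall>i\<le>r. \<alpha> i = apery_invariant A m x i) \<longleftrightarrow> (\<forall>i\<le>r. int (\<alpha> i) = int (apery_invariant A m x i))"
    by simp
  show ?thesis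
    unfolding nat cohen_macaulay_iff_regular
    using 1 2 3 unfolding a_def b_def c_def eq_iff_partial_sums_eq[symmetric] by (intro conjI)
qed

end
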